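(* Let $K=\mathbb{F}_q$ be a finite field with $\operatorname{char} K\neq 2$, and let $F=K(x,y)$ be an elliptic function field over $K$ given by $y^2=f(x)$, where $f(x)\in K[x]$ is a square-free polynomial of degree $3$. Write $f(x)=c\prod_{i=1}^{r}p_i(x)$ with $0\neq c\in K$ and $p_i(x)\in K[x]$ monic irreducible. Let $P_i$ be the place of $K(x)$ corresponding to $p_i(x)$ and $P_\infty$ the pole of $x$ in $K(x)$, and let $Q_1,\dots,Q_r,Q_\infty$ be the unique places of $F$ lying over $P_1,\dots,P_r,P_\infty$ respectively. Let $n>4$ be an even integer, and let $R_1,\dots,R_{n/2}$ be pairwise distinct places of $K(x)$ of degree $1$ such that $R_i\notin\{P_1,\dots,P_r\}$ and each $R_i$ has exactly two extensions $S_{i,1},S_{i,2}$ in $F$ ($q$ is assumed large enough for such places to exist). Put $D=\sum_{i=1}^{n/2}(S_{i,1}+S_{i,2})$, and let $g(x)\in K[x]$ be a polynomial whose zero divisor in $F$ is $(g(x))_0=D$. Let $G$ be a divisor of $F$ of degree $n/2$ with $\operatorname{supp}(G)\cap\operatorname{supp}(D)=\emptyset$. Then the code $C_{\mathcal L}(D,G)$ is self-dual if and only if there exists $u\in F$ with $u(P)=1$ for all $P\in\operatorname{supp}(D)$ such that $$(g'(x))=2G-(u)-(n-3)Q_\infty-Q_1-\cdots-Q_r .$$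
   Context: An elliptic function field over $K$ is an algebraic function field $F/K$ with full constant field $K$, of genus $1$, possessing a divisor of degree $1$. The places $P_1,\dots,P_r,P_\infty$ are exactly the places of $K(x)$ ramified in the degree-$2$ extension $F/K(x)$, so each has a unique extension in $F$. For $z\in F$, $z\ne 0$, $(z)$ denotes the principal divisor of $z$ in $F$ and $(z)_0$ its zero divisor; $g'(x)$ is the formal derivative of the polynomial $g(x)$ with respect to $x$. For a divisor $G$ of $F$, $\mathcal L(G)=\{z\in F\setminus\{0\} : (z)+G\ge 0\}\cup\{0\}$. For a place $P$ of degree $1$ and $z\in F$ regular at $P$, $z(P)\in K$ denotes the residue class of $z$ at $P$. If $D=T_1+\cdots+T_n$ is a sum of pairwise distinct places of degree $1$ and $\operatorname{supp}(G)\cap\operatorname{supp}(D)=\emptyset$, the geometric Goppa code is $C_{\mathcal L}(D,G)=\{(z(T_1),\dots,z(T_n)) : z\in\mathcal L(G)\}\subseteq\mathbb{F}_q^n$. A linear code $C\subseteq\mathbb{F}_q^n$ is self-dual if $C=C^\perp$, where $C^\perp$ is the dual with respect to the Euclidean scalar product on $\mathbb{F}_q^n$. *)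

theory Defs
  imports
    "HOL-Computational_Algebra.Computational_Algebra"
    "HOL-Library.Poly_Mapping"
    "Jordan_Normal_Form.Matrix"
begin

text \<open>
  The constant field \<open>K\<close> is a type \<open>'k\<close>, embedded by a field homomorphism \<open>emb\<close> into the function
  field \<open>F\<close>, which is a whole type \<open>'f\<close>. Intermediate fields such as \<open>K(x)\<close> are subsets of \<open>'f\<close>;
  notions needed both for \<open>F\<close> and for \<open>K(x)\<close> take the field as a set argument \<open>E\<close>.
\<close>

section \<open>Function fields\<close>

definition peval :: "('k::field \<Rightarrow> 'f::field) \<Rightarrow> 'k poly \<Rightarrow> 'f \<Rightarrow> 'f" where
  "peval emb p z = poly (map_poly emb p) z"

definition is_subfield :: "'f::field set \<Rightarrow> bool" where
  "is_subfield E \<longleftrightarrow> 0 \<in> E \<and> 1 \<in> E \<and>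
     (\<forall>a\<in>E. \<forall>b\<in>E. a - b \<in> E \<and> a * b \<in> E) \<and> (\<forall>a\<in>E. inverse a \<in> E)"

definition adjoin :: "('k::field \<Rightarrow> 'f::field) \<Rightarrow> 'f set \<Rightarrow> 'f set" where
  "adjoin emb X = \<Inter>{E. is_subfield E \<and> range emb \<subseteq> E \<and> X \<subseteq> E}"

definition algebraic_over :: "('k::field \<Rightarrow> 'f::field) \<Rightarrow> 'f \<Rightarrow> bool" where
  "algebraic_over emb z \<longleftrightarrow> (\<exists>p. p \<noteq> 0 \<and> peval emb p z = 0)"

definition finite_over :: "'f::field set \<Rightarrow> bool" where
  "finite_over E \<longleftrightarrow>
     (\<exists>B. finite B \<and> (\<forall>z. \<exists>c. c ` B \<subseteq> E \<and> z = (\<Sum>b\<in>B. c b * b)))"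

definition algebraic_function_field :: "('k::field \<Rightarrow> 'f::field) \<Rightarrow> bool" where
  "algebraic_function_field emb \<longleftrightarrow> field_hom emb \<and>
     (\<exists>t. \<not> algebraic_over emb t \<and> finite_over (adjoin emb {t}))"

definition full_constant_field :: "('k::field \<Rightarrow> 'f::field) \<Rightarrow> bool" where
  "full_constant_field emb \<longleftrightarrow> {z. algebraic_over emb z} = range emb"

section \<open>Places\<close>

definition valuation_ring :: "('k::field \<Rightarrow> 'f::field) \<Rightarrow> 'f set \<Rightarrow> 'f set \<Rightarrow> bool" where
  "valuation_ring emb E A \<longleftrightarrow> range emb \<subset> A \<and> A \<subset> E \<and>
     (\<forall>a\<in>A. \<forall>b\<in>A. a - b \<in> A \<and> a * b \<in> A) \<and>
     (\<forall>z\<in>E. z \<in> A \<or> inverse z \<in> A)"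

definition ideal_of :: "'f::field set \<Rightarrow> 'f set \<Rightarrow> bool" where
  "ideal_of A J \<longleftrightarrow> J \<subseteq> A \<and> 0 \<in> J \<and>
     (\<forall>a\<in>J. \<forall>b\<in>J. a - b \<in> J) \<and> (\<forall>a\<in>A. \<forall>b\<in>J. a * b \<in> J)"

definition maximal_ideal_of :: "'f::field set \<Rightarrow> 'f set \<Rightarrow> bool" where
  "maximal_ideal_of A P \<longleftrightarrow> ideal_of A P \<and> P \<noteq> A \<and>
     (\<forall>J. ideal_of A J \<and> P \<subseteq> J \<longrightarrow> J = P \<or> J = A)"

definition places :: "('k::field \<Rightarrow> 'f::field) \<Rightarrow> 'f set \<Rightarrow> 'f set set" where
  "places emb E = {P. \<exists>A. valuation_ring emb E A \<and> maximal_ideal_of A P}"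

text \<open>
  The valuation ring is recovered from its maximal ideal. Zero is listed separately because
  \<open>inverse 0 = 0\<close>.
\<close>

definition place_ring :: "'f::field set \<Rightarrow> 'f set \<Rightarrow> 'f set" where
  "place_ring E P = {z \<in> E. z = 0 \<or> inverse z \<notin> P}"

text \<open>
  The normalised discrete valuation at \<open>P\<close> (only meaningful for \<open>z \<noteq> 0\<close>): \<open>z = t\<^sup>n u\<close> with
  \<open>t\<close> a generator of \<open>P\<close> and \<open>u\<close> a unit of the valuation ring.
\<close>

definition place_val :: "'f::field set \<Rightarrow> 'f set \<Rightarrow> 'f \<Rightarrow> int" where
  "place_val E P z = (THE n. \<exists>t u.
     P = (\<lambda>a. t * a) ` place_ring E P \<and>
     u \<noteq> 0 \<and> u \<in> place_ring E P \<and> inverse u \<in> place_ring E P \<and>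
     z = t powi n * u)"

text \<open>
  The dimension over \<open>K\<close> of the residue class field, as the size of a set of representatives of
  one of its bases.
\<close>

definition place_degree :: "('k::field \<Rightarrow> 'f::field) \<Rightarrow> 'f set \<Rightarrow> 'f set \<Rightarrow> nat" where
  "place_degree emb E P = (THE d. \<exists>B. finite B \<and> card B = d \<and> B \<subseteq> place_ring E P \<and>
     (\<forall>z\<in>place_ring E P. \<exists>!c. (\<forall>b. b \<notin> B \<longrightarrow> c b = 0) \<and>
        z - (\<Sum>b\<in>B. emb (c b) * b) \<in> P))"

text \<open>The value in \<open>K\<close> of \<open>z\<close> at a place of degree 1; only meaningful for \<open>z\<close> regular at \<open>P\<close>.\<close>

definition residue_at :: "('k::field \<Rightarrow> 'f::field) \<Rightarrow> 'f set \<Rightarrow> 'f \<Rightarrow> 'k" where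
  "residue_at emb P z = (THE a. z - emb a \<in> P)"

definition extensions :: "('k::field \<Rightarrow> 'f::field) \<Rightarrow> 'f set \<Rightarrow> 'f set set" where
  "extensions emb P = {Q \<in> places emb UNIV. P \<subseteq> Q}"

text \<open>The place of \<open>K(x)\<close> corresponding to a monic irreducible polynomial \<open>p(x)\<close>.\<close>

definition poly_place :: "('k::field \<Rightarrow> 'f::field) \<Rightarrow> 'f \<Rightarrow> 'k poly \<Rightarrow> 'f set" where
  "poly_place emb x p = {peval emb a x / peval emb b x |a b. p dvd a \<and> \<not> p dvd b}"

section \<open>Divisors\<close>

text \<open>
  Divisors of \<open>F\<close> are elements of the free abelian group on the places of \<open>F\<close>. The type
  \<open>'f set \<Rightarrow>\<^sub>0 int\<close> is larger, since its keys may be arbitrary sets.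
\<close>

definition divisors :: "('k::field \<Rightarrow> 'f::field) \<Rightarrow> ('f set \<Rightarrow>\<^sub>0 int) set" where
  "divisors emb = {A. Poly_Mapping.keys A \<subseteq> places emb UNIV}"

definition effective :: "('f set \<Rightarrow>\<^sub>0 int) \<Rightarrow> bool" where
  "effective A \<longleftrightarrow> (\<forall>P. 0 \<le> Poly_Mapping.lookup A P)"

definition div_degree :: "('k::field \<Rightarrow> 'f::field) \<Rightarrow> ('f set \<Rightarrow>\<^sub>0 int) \<Rightarrow> int" where
  "div_degree emb A = (\<Sum>P\<in>Poly_Mapping.keys A. Poly_Mapping.lookup A P * int (place_degree emb UNIV P))"

definition pdiv :: "('k::field \<Rightarrow> 'f::field) \<Rightarrow> 'f \<Rightarrow> ('f set \<Rightarrow>\<^sub>0 int)" where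
  "pdiv emb z = Abs_poly_mapping
     (\<lambda>P. if P \<in> places emb UNIV then place_val UNIV P z else 0)"

definition zero_div :: "('k::field \<Rightarrow> 'f::field) \<Rightarrow> 'f \<Rightarrow> ('f set \<Rightarrow>\<^sub>0 int)" where
  "zero_div emb z = Poly_Mapping.map (\<lambda>m. max 0 m) (pdiv emb z)"

definition RR_space :: "('k::field \<Rightarrow> 'f::field) \<Rightarrow> ('f set \<Rightarrow>\<^sub>0 int) \<Rightarrow> 'f set" where
  "RR_space emb G = {z. z \<noteq> 0 \<and> effective (pdiv emb z + G)} \<union> {0}"

definition RR_dim :: "('k::field \<Rightarrow> 'f::field) \<Rightarrow> ('f set \<Rightarrow>\<^sub>0 int) \<Rightarrow> nat" where
  "RR_dim emb G = vector_space.dim (\<lambda>c z. emb c * z) (RR_space emb G)"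

text \<open>The genus is the maximum of \<open>deg A - \<ell>(A) + 1\<close> over all divisors \<open>A\<close>.\<close>

definition has_genus :: "('k::field \<Rightarrow> 'f::field) \<Rightarrow> int \<Rightarrow> bool" where
  "has_genus emb g \<longleftrightarrow>
     (\<exists>A\<in>divisors emb. div_degree emb A - int (RR_dim emb A) + 1 = g) \<and>
     (\<forall>A\<in>divisors emb. div_degree emb A - int (RR_dim emb A) + 1 \<le> g)"

definition elliptic_function_field :: "('k::field \<Rightarrow> 'f::field) \<Rightarrow> bool" where
  "elliptic_function_field emb \<longleftrightarrow>
     algebraic_function_field emb \<and> full_constant_field emb \<and> has_genus emb 1 \<and>
     (\<exists>A\<in>divisors emb. div_degree emb A = 1)"

section \<open>Codes\<close>

definition dual_code :: "nat \<Rightarrow> 'k::field vec set \<Rightarrow> 'k vec set" where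
  "dual_code n C = {w \<in> carrier_vec n. \<forall>v\<in>C. scalar_prod v w = 0}"

definition self_dual :: "nat \<Rightarrow> 'k::field vec set \<Rightarrow> bool" where
  "self_dual n C \<longleftrightarrow> C = dual_code n C"

text \<open>
  The divisor \<open>D = T\<^sub>1 + \<dots> + T\<^sub>n\<close> enters the code through the list \<open>Ts\<close> of its places, which
  fixes the order of the coordinates.
\<close>

definition goppa_code ::
  "('k::field \<Rightarrow> 'f::field) \<Rightarrow> 'f set list \<Rightarrow> ('f set \<Rightarrow>\<^sub>0 int) \<Rightarrow> 'k vec set" where
  "goppa_code emb Ts G =
     {vec (length Ts) (\<lambda>i. residue_at emb (Ts ! i) z) |z. z \<in> RR_space emb G}"

end

theory Submission
  imports Defs "HOL-Library.FuncSet"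
begin

text \<open>
  The function \<open>g\<close> has degree \<open>n/2\<close> and simple zeros exactly at \<open>D\<close>, so \<open>dg/g\<close> has simple poles with
  residue 1 there, and \<open>H = D - G + (dg/g) = (g' y) + n Q\<^sub>\<infinity> - G\<close> satisfies \<open>C(D,H) \<subseteq> C(D,G)\<^sup>\<bottom>\<close>. No
  differentials are needed: for \<open>s \<in> L(G + H)\<close> the function \<open>s g' y\<close> is \<open>a + b y\<close> with
  \<open>deg b \<le> n/2 - 2\<close>, the values of \<open>s\<close> at two conjugate points add up to \<open>2 b/g'\<close>, and Lagrange
  interpolation gives \<open>\<Sum> s(T) = 0\<close>. Genus 1 enters only as Riemann's inequality \<open>deg A \<le> \<ell>(A)\<close>, which
  also yields \<open>deg (z) = 0\<close>; hence both codes have at least \<open>q\<^sup>n\<^sup>/\<^sup>2\<close> words and \<open>C(D,H) = C(D,G)\<^sup>\<bottom>\<close>.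

  If \<open>H = G - (u)\<close> with \<open>u = 1\<close> on \<open>D\<close>, then \<open>L(H) = u L(G)\<close> and the codes agree. Conversely, if the codes
  agree, let \<open>h \<in> L(H)\<close> have the same values as \<open>z \<in> L(G)\<close>. The functions \<open>z\<^sub>i h\<^sub>j - z\<^sub>j h\<^sub>i\<close> lie in
  \<open>L(G + H - D)\<close>, which is spanned by the single function \<open>g/(g' y)\<close>; as \<open>\<ell>(G) \<ge> n/2 \<ge> 3\<close>, the identity
  \<open>\<Sum> z\<^sub>i (z\<^sub>j h\<^sub>k - z\<^sub>k h\<^sub>j) = 0\<close> (cyclic sum) forces them to vanish, so \<open>h = u z\<close> for a fixed \<open>u\<close>. Then
  \<open>H = G - (u)\<close> because \<open>L(G)\<close> and \<open>L(H)\<close> have no base points.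
\<close>

text \<open>\<open>place_val\<close> and \<open>place_degree\<close> are definite descriptions and
  \<open>pdiv\<close> is an \<open>Abs_poly_mapping\<close>, so nothing can be said about them
  before every place of F is known to be discrete with finite residue field and every function to
  have finitely many poles. These facts are obtained by descending to K(x), where the places are
  explicit, and returning through the equation z^2 = T z - N with trace T and norm N in K(x). It
  makes z^2 a unit times an element of K(x), which yields a valuation, and it makes residues roots
  of quadratic equations over a finite field.

  Riemann's inequality bounds spaces only from below. Upper bounds come from the codes: L(A) embeds
  in K^n by evaluation if deg A < n and A avoids D, and the sizes of a code and its dual multiply to
  at most q^n. Spaces are therefore compared by cardinality, which is how the finiteness of K
  enters.\<close>

locale const_field = field_hom emb for emb :: "'k::field \<Rightarrow> 'f::field"
begin

lemma peval_0 [simp]: "peval emb 0 z = 0"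
  by (simp add: peval_def)

lemma peval_pCons [simp]: "peval emb (pCons a p) z = emb a + z * peval emb p z"
  by (cases "a = 0 \<and> p = 0") (auto simp: peval_def map_poly_pCons)

lemma peval_1 [simp]: "peval emb 1 z = 1"
  by (simp add: one_pCons)

lemma peval_add [simp]: "peval emb (p + q) z = peval emb p z + peval emb q z"
proof (induction p arbitrary: q)
  case (pCons a p)
  obtain b r where "q = pCons b r" by (cases q)
  then show ?case
    by (simp add: pCons.IH hom_add algebra_simps)
qed simp

lemma peval_smult [simp]: "peval emb (Polynomial.smult c p) z = emb c * peval emb p z"
  by (induction p) (simp_all add: hom_mult algebra_simps)

lemma peval_mult [simp]: "peval emb (p * q) z = peval emb p z * peval emb q z"
  by (induction p) (simp_all add: algebra_simps)

lemma peval_uminus [simp]: "peval emb (- p) z = - peval emb p z"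
  by (induction p) (simp_all add: hom_uminus algebra_simps)

lemma peval_diff [simp]: "peval emb (p - q) z = peval emb p z - peval emb q z"
  using peval_add[of p "- q" z] by simp

lemma peval_power [simp]: "peval emb (p ^ n) z = peval emb p z ^ n"
  by (induction n) simp_all

lemma peval_prod: "peval emb (\<Prod>i\<in>I. p i) z = (\<Prod>i\<in>I. peval emb (p i) z)"
  by (induction I rule: infinite_finite_induct) simp_all

text \<open>Division by X - a. At a place containing \<open>z - emb a\<close> the residue of p(z) is
  therefore p(a); values of polynomials at rational points are computed this way.\<close>

lemma peval_minus_linear: "\<exists>q. peval emb p z = emb (poly p a) + (z - emb a) * peval emb q z"
proof -
  have "p = [:poly p a:] + [:-a, 1:] * synthetic_div p a"
    using synthetic_div_correct'[of a p] by (simp add: algebra_simps)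
  then have "peval emb p z = peval emb ([:poly p a:] + [:-a, 1:] * synthetic_div p a) z"
    by simp
  also have "\<dots> = emb (poly p a) + (z - emb a) * peval emb (synthetic_div p a) z"
    by (simp add: hom_uminus algebra_simps)
  finally show ?thesis by blast
qed

end

lemma is_subfieldD:
  assumes "is_subfield E"
  shows "0 \<in> E" "1 \<in> E" "\<And>a b. a \<in> E \<Longrightarrow> b \<in> E \<Longrightarrow> a - b \<in> E"
    "\<And>a b. a \<in> E \<Longrightarrow> b \<in> E \<Longrightarrow> a * b \<in> E" "\<And>a. a \<in> E \<Longrightarrow> inverse a \<in> E"
    "\<And>a. a \<in> E \<Longrightarrow> - a \<in> E" "\<And>a b. a \<in> E \<Longrightarrow> b \<in> E \<Longrightarrow> a + b \<in> E"
    "\<And>a b. a \<in> E \<Longrightarrow> b \<in> E \<Longrightarrow> a / b \<in> E"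
proof -
  show *: "0 \<in> E" "1 \<in> E" "\<And>a b. a \<in> E \<Longrightarrow> b \<in> E \<Longrightarrow> a - b \<in> E"
    "\<And>a b. a \<in> E \<Longrightarrow> b \<in> E \<Longrightarrow> a * b \<in> E" "\<And>a. a \<in> E \<Longrightarrow> inverse a \<in> E"
    using assms by (auto simp: is_subfield_def)
  show neg: "- a \<in> E" if "a \<in> E" for a
    using *(3)[OF *(1) that] by simp
  show "a + b \<in> E" if "a \<in> E" "b \<in> E" for a b
    using *(3)[OF that(1) neg[OF that(2)]] by simp
  show "a / b \<in> E" if "a \<in> E" "b \<in> E" for a b
    using *(4,5) that by (simp add: divide_inverse)
qed

lemma is_subfield_UNIV [simp]: "is_subfield UNIV"
  by (simp add: is_subfield_def)

lemma is_subfield_power: "is_subfield E \<Longrightarrow> a \<in> E \<Longrightarrow> a ^ n \<in> E"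
  by (induction n) (auto intro: is_subfieldD)

lemma is_subfield_powi: "is_subfield E \<Longrightarrow> a \<in> E \<Longrightarrow> a powi k \<in> E"
  by (simp add: power_int_def is_subfield_power is_subfieldD)

section \<open>Valuation rings\<close>

context const_field
begin

definition nonunits :: "'f set \<Rightarrow> 'f set" where
  "nonunits A = {z \<in> A. z = 0 \<or> inverse z \<notin> A}"

lemma valuation_ringD:
  assumes "valuation_ring emb E A"
  shows "emb c \<in> A" "A \<subseteq> E" "\<exists>z\<in>E. z \<notin> A" "0 \<in> A" "1 \<in> A"
    "\<And>a b. a \<in> A \<Longrightarrow> b \<in> A \<Longrightarrow> a - b \<in> A" "\<And>a b. a \<in> A \<Longrightarrow> b \<in> A \<Longrightarrow> a * b \<in> A"
    "\<And>z. z \<in> E \<Longrightarrow> z \<notin> A \<Longrightarrow> inverse z \<in> A"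
proof -
  show *: "emb c \<in> A" "A \<subseteq> E" "\<exists>z\<in>E. z \<notin> A"
    "\<And>a b. a \<in> A \<Longrightarrow> b \<in> A \<Longrightarrow> a - b \<in> A" "\<And>a b. a \<in> A \<Longrightarrow> b \<in> A \<Longrightarrow> a * b \<in> A"
    "\<And>z. z \<in> E \<Longrightarrow> z \<notin> A \<Longrightarrow> inverse z \<in> A" for c
    using assms by (auto simp: valuation_ring_def)
  show "0 \<in> A" "1 \<in> A" using *(1)[of 0] *(1)[of 1] by simp_all
qed

lemma ideal_nonunits:
  assumes "valuation_ring emb E A" "is_subfield E"
  shows "ideal_of A (nonunits A)"
proof -
  note A = valuation_ringD[OF assms(1)]
  have mult: "a * b \<in> nonunits A" if a: "a \<in> A" and b: "b \<in> nonunits A" for a b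
  proof (cases "a * b = 0")
    case False
    have "inverse (a * b) \<notin> A"
    proof
      assume "inverse (a * b) \<in> A"
      have "inverse b = a * inverse (a * b)" using False by (simp add: field_simps)
      also have "\<dots> \<in> A" using a A(7) \<open>inverse (a * b) \<in> A\<close> by blast
      finally have "inverse b \<in> A" .
      then show False using b False by (simp add: nonunits_def)
    qed
    then show ?thesis using a b A by (simp add: nonunits_def)
  qed (use A in \<open>auto simp: nonunits_def\<close>)
  \<comment> \<open>If \<open>a / b\<close> is in A, then \<open>a - b\<close> is a multiple of the
    nonunit \<open>b\<close>. A contains \<open>a / b\<close> or its inverse, and the second case
    follows by swapping.\<close>
  have lt: "a - b \<in> nonunits A" if "a \<in> nonunits A" "b \<in> nonunits A" "b \<noteq> 0" "a / b \<in> A" for a b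
  proof -
    have "(a / b - 1) * b \<in> nonunits A"
      by (rule mult[OF A(6)[OF that(4) A(5)] that(2)])
    moreover have "(a / b - 1) * b = a - b" using that(3) by (simp add: left_diff_distrib)
    ultimately show ?thesis by simp
  qed
  have diff: "a - b \<in> nonunits A" if a: "a \<in> nonunits A" and b: "b \<in> nonunits A" for a b
  proof (cases "a = 0 \<or> b = 0")
    case True
    have "- 1 \<in> A" using A(6)[OF A(4,5)] by simp
    then have "- b \<in> nonunits A" using mult[OF _ b, of "-1"] by simp
    then show ?thesis using True a by auto
  next
    case False
    have "a \<in> E" "b \<in> E" using a b A by (auto simp: nonunits_def)
    then have "a / b \<in> A \<or> inverse (a / b) \<in> A"
      using A(8) is_subfieldD(8)[OF assms(2)] by blast
    then show ?thesis
    proof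
      assume "inverse (a / b) \<in> A"
      then have "b - a \<in> nonunits A" using lt[OF b a] False by simp
      then have "(-1) * (b - a) \<in> nonunits A" using mult[of "-1" "b - a"] A(6)[OF A(4,5)] by simp
      then show ?thesis by simp
    qed (use lt a b False in blast)
  qed
  show ?thesis unfolding ideal_of_def using mult diff A by (auto simp: nonunits_def)
qed

text \<open>A valuation ring is local, as a proper ideal contains no unit. So ring and maximal ideal
  determine each other, and a place can be handled as an ideal.\<close>

lemma maximal_ideal_nonunits:
  assumes "valuation_ring emb E A" "is_subfield E"
  shows "maximal_ideal_of A P \<longleftrightarrow> P = nonunits A"
proof -
  note A = valuation_ringD[OF assms(1)]
  have N: "ideal_of A (nonunits A)" using ideal_nonunits[OF assms] .
  have "1 \<notin> nonunits A" using A(5) by (simp add: nonunits_def)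
  then have NA: "nonunits A \<noteq> A" using A(5) by blast
  have sub: "J \<subseteq> nonunits A" if J: "ideal_of A J" "J \<noteq> A" for J
  proof
    fix z assume z: "z \<in> J"
    have JA: "J \<subseteq> A" and m: "\<And>a b. a \<in> A \<Longrightarrow> b \<in> J \<Longrightarrow> a * b \<in> J"
      using J by (auto simp: ideal_of_def)
    show "z \<in> nonunits A"
    proof (rule ccontr)
      assume "z \<notin> nonunits A"
      then have z0: "z \<noteq> 0" "inverse z \<in> A" using z JA by (auto simp: nonunits_def)
      have "1 \<in> J" using m[OF z0(2) z] z0 by simp
      then have "A \<subseteq> J" using m by (metis mult.right_neutral subsetI)
      then show False using J JA by blast
    qed
  qed
  show ?thesis
  proof
    assume "maximal_ideal_of A P"
    then show "P = nonunits A" using sub[of P] N NA by (auto simp: maximal_ideal_of_def)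
  next
    assume "P = nonunits A"
    then show "maximal_ideal_of A P" using sub N NA by (auto simp: maximal_ideal_of_def)
  qed
qed

lemma places_iff:
  assumes "is_subfield E"
  shows "P \<in> places emb E \<longleftrightarrow> (\<exists>A. valuation_ring emb E A \<and> P = nonunits A)"
  unfolding places_def using maximal_ideal_nonunits[OF _ assms] by auto

lemma place_ring_nonunits:
  assumes "valuation_ring emb E A"
  shows "place_ring E (nonunits A) = A"
  using valuation_ringD[OF assms] unfolding place_ring_def nonunits_def by fastforce

end

locale place = const_field emb for emb :: "'k::field \<Rightarrow> 'f::field" +
  fixes E P :: "'f set"
  assumes sub: "is_subfield E" and pl: "P \<in> places emb E"
begin

abbreviation "A \<equiv> place_ring E P"

lemma valuation_ring_A: "valuation_ring emb E A" and P_eq: "P = nonunits A"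
  using pl places_iff[OF sub] place_ring_nonunits by auto

lemmas A_emb = valuation_ringD(1)[OF valuation_ring_A]
  and A_sub = valuation_ringD(2)[OF valuation_ring_A]
  and A_proper = valuation_ringD(3)[OF valuation_ring_A]
  and A_0 [simp] = valuation_ringD(4)[OF valuation_ring_A]
  and A_1 [simp] = valuation_ringD(5)[OF valuation_ring_A]
  and A_diff = valuation_ringD(6)[OF valuation_ring_A]
  and A_mult = valuation_ringD(7)[OF valuation_ring_A]
  and A_total = valuation_ringD(8)[OF valuation_ring_A]

lemma A_in_E: "z \<in> A \<Longrightarrow> z \<in> E"
  using A_sub by blast

lemma A_uminus: "z \<in> A \<Longrightarrow> - z \<in> A"
  using A_diff[OF A_0] by simp

lemma A_add: "z \<in> A \<Longrightarrow> w \<in> A \<Longrightarrow> z + w \<in> A"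
  using A_diff[of z "- w"] A_uminus by simp

lemma A_power: "z \<in> A \<Longrightarrow> z ^ n \<in> A"
  by (induction n) (auto intro: A_mult)

lemma A_sum: "(\<And>i. i \<in> I \<Longrightarrow> h i \<in> A) \<Longrightarrow> sum h I \<in> A"
  by (induction I rule: infinite_finite_induct) (auto intro: A_add)

lemma A_peval: "z \<in> A \<Longrightarrow> peval emb p z \<in> A"
  by (induction p) (auto intro: A_add A_mult A_emb)

lemma P_iff: "z \<in> P \<longleftrightarrow> z \<in> A \<and> (z = 0 \<or> inverse z \<notin> A)"
  by (subst P_eq) (auto simp: nonunits_def)

lemma P_in_A: "z \<in> P \<Longrightarrow> z \<in> A"
  by (simp add: P_iff)

lemma ideal_P: "ideal_of A P"
  using ideal_nonunits[OF valuation_ring_A sub] P_eq by simp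

lemma P_0 [simp]: "0 \<in> P" and P_diff: "z \<in> P \<Longrightarrow> w \<in> P \<Longrightarrow> z - w \<in> P"
  and P_mult: "z \<in> A \<Longrightarrow> w \<in> P \<Longrightarrow> z * w \<in> P"
  using ideal_P by (auto simp: ideal_of_def)

lemma P_mult2: "w \<in> P \<Longrightarrow> z \<in> A \<Longrightarrow> w * z \<in> P"
  by (subst mult.commute) (rule P_mult)

lemma P_uminus: "z \<in> P \<Longrightarrow> - z \<in> P"
  using P_diff[OF P_0] by simp

lemma P_uminus_iff [simp]: "- z \<in> P \<longleftrightarrow> z \<in> P"
  using P_uminus[of z] P_uminus[of "- z"] by auto

lemma P_add: "z \<in> P \<Longrightarrow> w \<in> P \<Longrightarrow> z + w \<in> P"
  using P_diff[of z "- w"] P_uminus by simp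

lemma P_1 [simp]: "1 \<notin> P"
  by (simp add: P_iff)

lemma not_A: "z \<in> E \<Longrightarrow> z \<notin> A \<Longrightarrow> z \<noteq> 0 \<and> inverse z \<in> P"
  using A_total[of z] by (auto simp: P_iff)

lemma unit_inverse: "z \<in> A \<Longrightarrow> z \<notin> P \<Longrightarrow> inverse z \<in> A \<and> inverse z \<notin> P"
  by (auto simp: P_iff)

lemma unit_mult: "z \<in> A \<Longrightarrow> z \<notin> P \<Longrightarrow> w \<in> A \<Longrightarrow> w \<notin> P \<Longrightarrow> z * w \<notin> P"
proof
  assume *: "z \<in> A" "z \<notin> P" "w \<in> A" "w \<notin> P" "z * w \<in> P"
  then have "inverse z * (z * w) \<in> P" using unit_inverse P_mult by blast
  moreover have "z \<noteq> 0" using * by auto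
  ultimately show False using * by (simp add: mult.assoc[symmetric])
qed

lemma P_prime: "z * w \<in> P \<Longrightarrow> z \<in> A \<Longrightarrow> w \<in> A \<Longrightarrow> z \<in> P \<or> w \<in> P"
  using unit_mult by blast

lemma emb_P_iff [simp]: "emb c \<in> P \<longleftrightarrow> c = 0"
proof
  assume "emb c \<in> P"
  then show "c = 0"
    using A_emb[of "inverse c"] by (auto simp: P_iff hom_inverse)
qed simp

lemma A_root: assumes "z ^ n \<in> A" "z \<in> E" "n > 0" shows "z \<in> A"
proof (rule ccontr)
  assume "z \<notin> A"
  then have z: "z \<noteq> 0" "inverse z \<in> P" using not_A assms by auto
  have "inverse z ^ n * z ^ n \<in> P"
  proof (rule P_mult2[OF _ assms(1)])
    obtain k where "n = Suc k" using assms(3) gr0_implies_Suc by blast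
    then show "inverse z ^ n \<in> P" using z by (auto intro: P_mult2 A_power P_in_A)
  qed
  then show False using z by (simp flip: power_mult_distrib)
qed

end

section \<open>Integer valuations of a place and their normalisation\<close>

locale valued_place = place emb E P for emb :: "'k::field \<Rightarrow> 'f::field" and E P +
  fixes v :: "'f \<Rightarrow> int"
  assumes v_mult: "z \<in> E \<Longrightarrow> w \<in> E \<Longrightarrow> z \<noteq> 0 \<Longrightarrow> w \<noteq> 0 \<Longrightarrow> v (z * w) = v z + v w"
    and v_A: "z \<in> E \<Longrightarrow> z \<noteq> 0 \<Longrightarrow> z \<in> A \<longleftrightarrow> v z \<ge> 0"
begin

lemma v_1 [simp]: "v 1 = 0"
  using v_mult[of 1 1] is_subfieldD[OF sub] by simp

lemma v_inverse: "z \<in> E \<Longrightarrow> z \<noteq> 0 \<Longrightarrow> v (inverse z) = - v z"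
  using v_mult[of z "inverse z"] is_subfieldD[OF sub] by simp

lemma v_divide: "z \<in> E \<Longrightarrow> w \<in> E \<Longrightarrow> z \<noteq> 0 \<Longrightarrow> w \<noteq> 0 \<Longrightarrow> v (z / w) = v z - v w"
  using v_mult[of z "inverse w"] v_inverse[of w] is_subfieldD[OF sub] by (simp add: divide_inverse)

lemma v_power: "z \<in> E \<Longrightarrow> z \<noteq> 0 \<Longrightarrow> v (z ^ n) = int n * v z"
  by (induction n) (auto simp: v_mult is_subfield_power[OF sub] algebra_simps)

lemma v_powi: "z \<in> E \<Longrightarrow> z \<noteq> 0 \<Longrightarrow> v (z powi k) = k * v z"
  by (simp add: power_int_def v_power v_inverse is_subfieldD[OF sub])

lemma v_unit: "z \<in> E \<Longrightarrow> z \<noteq> 0 \<Longrightarrow> v z = 0 \<longleftrightarrow> z \<in> A \<and> z \<notin> P"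
  by (auto simp: P_iff v_A v_inverse is_subfieldD[OF sub])

lemma v_P: "z \<in> E \<Longrightarrow> z \<noteq> 0 \<Longrightarrow> z \<in> P \<longleftrightarrow> v z > 0"
  by (auto simp: P_iff v_A v_inverse is_subfieldD[OF sub])

lemma v_uminus [simp]: assumes "z \<in> E" shows "v (- z) = v z"
proof (cases "z = 0")
  case False
  have "v (- 1) = 0"
    using v_unit[of "-1"] A_uminus[OF A_1] is_subfieldD[OF sub] by auto
  then show ?thesis
    using v_mult[of "-1" z] False assms is_subfieldD[OF sub] by simp
qed simp

lemma v_emb: "c \<noteq> 0 \<Longrightarrow> v (emb c) = 0"
  using v_unit[of "emb c"] A_in_E[OF A_emb[of c]] A_emb by simp

lemma v_add: 
  assumes "z \<in> E" "w \<in> E" "z \<noteq> 0" "w \<noteq> 0" "z + w \<noteq> 0"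
  shows "v (z + w) \<ge> min (v z) (v w)"
proof -
  have *: "v (z + w) \<ge> v z" if "z \<in> E" "w \<in> E" "z \<noteq> 0" "w \<noteq> 0" "z + w \<noteq> 0" "v z \<le> v w" for z w
  proof -
    have "w / z \<in> A" using that v_A[of "w / z"] v_divide[of w z] is_subfieldD[OF sub] by auto
    then have "1 + w / z \<in> A" using A_add by auto
    moreover have eq: "1 + w / z = (z + w) / z" using that by (simp add: field_simps)
    ultimately have "v ((z + w) / z) \<ge> 0"
      using v_A[of "(z + w) / z"] that is_subfieldD[OF sub] by auto
    then show ?thesis using v_divide[of "z + w" z] that is_subfieldD[OF sub] by auto
  qed
  show ?thesis
    using *[of z w] *[of w z] assms by (cases "v z \<le> v w") (auto simp: add.commute)
qed

lemma v_add_less: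
  assumes "z \<in> E" "w \<in> E" "z \<noteq> 0" "w = 0 \<or> v z < v w"
  shows "z + w \<noteq> 0" "v (z + w) = v z"
proof -
  show nz: "z + w \<noteq> 0"
  proof
    assume "z + w = 0"
    then have "w = - z" by (simp add: eq_neg_iff_add_eq_0 add.commute)
    then show False using assms by auto
  qed
  show "v (z + w) = v z"
  proof (cases "w = 0")
    case False
    have 1: "v (z + w) \<ge> v z" using v_add[of z w] assms nz False by auto
    have 2: "v z \<ge> min (v (z + w)) (v w)"
      using v_add[of "z + w" "- w"] assms nz False is_subfieldD[OF sub] by auto
    show ?thesis using 1 2 assms False by auto
  qed simp
qed

text \<open>The \<open>THE n\<close> in \<open>place_val\<close> needs independence of the generator
  and of the unit. The generators of P are exactly the elements of least positive value d, and units
  have value 0, so n is forced to be v z / d.\<close>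

lemma place_val_eq:
  assumes t: "t \<in> E" "t \<noteq> 0" "v t = d" "d > 0" and dvd: "\<And>z. z \<in> E \<Longrightarrow> z \<noteq> 0 \<Longrightarrow> d dvd v z"
    and z: "z \<in> E" "z \<noteq> 0"
  shows "place_val E P z = v z div d"
proof -
  have gen: "P = (\<lambda>a. s * a) ` A \<longleftrightarrow> v s = d" if s: "s \<in> E" "s \<noteq> 0" for s
  proof
    assume P: "P = (\<lambda>a. s * a) ` A"
    have "t \<in> P" using t by (simp add: v_P)
    then obtain a where a: "a \<in> A" "t = s * a" using P by auto
    then have "v t = v s + v a" "v a \<ge> 0" using v_mult[of s a] s t v_A[of a] A_in_E by auto
    moreover have "s \<in> P" using P by (metis A_1 imageI mult.right_neutral)
    then have "v s > 0" using s v_P by auto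
    then have "v s \<ge> d" using dvd[OF s] by (simp add: zdvd_imp_le)
    ultimately show "v s = d" using t by auto
  next
    assume vs: "v s = d"
    show "P = (\<lambda>a. s * a) ` A"
    proof (intro equalityI subsetI)
      fix w assume w: "w \<in> P"
      have wE: "w \<in> E" using w P_in_A A_in_E by blast
      show "w \<in> (\<lambda>a. s * a) ` A"
      proof (cases "w = 0")
        case True
        then show ?thesis using A_0 by (metis imageI mult_zero_right)
      next
        case False
        then have "v w > 0" using w wE v_P by auto
        then have "v w \<ge> d" using dvd[OF wE False] by (simp add: zdvd_imp_le)
        then have "w / s \<in> A"
          using v_A[of "w / s"] v_divide[of w s] s wE False vs is_subfieldD[OF sub] by auto
        then show ?thesis using s by (metis imageI nonzero_mult_div_cancel_left times_divide_eq_right)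
      qed
    next
      fix w assume "w \<in> (\<lambda>a. s * a) ` A"
      moreover have "s \<in> P" using v_P s vs t by auto
      ultimately show "w \<in> P" using P_mult2 by auto
    qed
  qed
  have key: "v z = n * d" if "P = (\<lambda>a. s * a) ` A"
      "u \<noteq> 0" "u \<in> A" "inverse u \<in> A" "z = s powi n * u" for n s u
  proof -
    have uE: "u \<in> E" using that A_in_E by blast
    have vu: "v u = 0" using v_A[of u] v_A[of "inverse u"] v_inverse[of u] that uE
        is_subfieldD[OF sub] by auto
    have "s \<noteq> 0"
    proof
      assume "s = 0"
      then have "P = {0}" using that(1) A_1 by auto
      moreover have "t \<in> P" using t v_P by auto
      ultimately show False using t by auto
    qed
    moreover have "s \<in> E"
      using that(1) P_in_A A_in_E by (metis A_1 imageI mult.right_neutral)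
    ultimately have "v s = d" "s powi n \<in> E" "s powi n \<noteq> 0"
      using gen that(1) is_subfield_powi[OF sub] by auto
    then show ?thesis using v_mult[of "s powi n" u] uE that v_powi vu \<open>s \<noteq> 0\<close> \<open>s \<in> E\<close> by auto
  qed
  obtain n where n: "v z = d * n" using dvd[OF z] by auto
  have "t powi n \<noteq> 0" "t powi n \<in> E" using t is_subfield_powi[OF sub] by auto
  then have ex: "v (z / t powi n) = 0" "z / t powi n \<in> E" "z / t powi n \<noteq> 0"
    using v_divide[of z "t powi n"] z v_powi[of t n] t n is_subfieldD[OF sub] by (auto simp: mult.commute)
  then have "z / t powi n \<in> A" "inverse (z / t powi n) \<in> A"
    using iffD1[OF v_unit[OF ex(2,3)] ex(1)] unit_inverse[of "z / t powi n"] by blast+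
  moreover have "P = (\<lambda>a. t * a) ` A" using gen t by blast
  moreover have "z = t powi n * (z / t powi n)" using \<open>t powi n \<noteq> 0\<close> by simp
  ultimately have "place_val E P z = n"
    unfolding place_val_def using key n t(4) ex(3)
    by (intro the_equality) (blast, auto)
  then show ?thesis using n t(4) by simp
qed

text \<open>v need not be normalised: on F it is first built with values that may all be even. The
  least positive value generates the group of values, and dividing by it gives
  \<open>place_val\<close>. The scale factor \<open>v t\<close> is kept for the computation of
  ramification indices.\<close>

lemma valued_place_place_val:
  obtains t where "t \<in> E" "t \<noteq> 0" "place_val E P t = 1" "valued_place emb E P (place_val E P)"
    "\<And>z. z \<in> E \<Longrightarrow> z \<noteq> 0 \<Longrightarrow> v z = v t * place_val E P z"
proof -
  obtain z0 where z0: "z0 \<in> E" "z0 \<notin> A" using A_proper by blast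
  then have "z0 \<noteq> 0" by auto
  with z0 have z1: "inverse z0 \<in> E" "inverse z0 \<noteq> 0" "v (inverse z0) > 0"
    using v_A[of z0] v_inverse[of z0] is_subfieldD[OF sub] by auto
  define S where "S = {n. n > 0 \<and> (\<exists>z\<in>E. z \<noteq> 0 \<and> v z = int n)}"
  define d where "d = (LEAST n. n \<in> S)"
  have S_I: "nat (v z) \<in> S" if "z \<in> E" "z \<noteq> 0" "v z > 0" for z
    unfolding S_def using that by (intro CollectI conjI bexI[of _ z]) simp_all
  have "nat (v (inverse z0)) \<in> S" using z1 by (rule S_I)
  then have dS: "d \<in> S" unfolding d_def by (rule LeastI)
  have dmin: "d \<le> n" if "n \<in> S" for n unfolding d_def using that by (rule Least_le)
  obtain t where t: "t \<in> E" "t \<noteq> 0" "v t = int d" "d > 0" using dS by (auto simp: S_def)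
  \<comment> \<open>Euclidean division: a nonzero remainder of \<open>v z\<close> modulo d would be
    the value of \<open>w\<close>, positive and smaller than d.\<close>
  have dvd: "int d dvd v z" if z: "z \<in> E" "z \<noteq> 0" for z
  proof (rule ccontr)
    assume nd: "\<not> int d dvd v z"
    define w where "w = z / t powi (v z div int d)"
    have w: "w \<in> E" "w \<noteq> 0"
      using z t is_subfield_powi[OF sub] is_subfieldD[OF sub] by (auto simp: w_def)
    have "v w = v z - (v z div int d) * int d"
      unfolding w_def using v_divide[of z "t powi (v z div int d)"] z t
        is_subfield_powi[OF sub] v_powi by auto
    then have vw: "v w = v z mod int d" by (simp add: minus_div_mult_eq_mod)
    then have "v w > 0" using nd t(4)
      by (metis dvd_eq_mod_eq_0 of_nat_0_less_iff order_le_less pos_mod_sign)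
    then have "nat (v w) \<in> S" using w S_I by blast
    then have "d \<le> nat (v w)" by (rule dmin)
    then show False using vw t(4) pos_mod_bound[of "int d" "v z"] by linarith
  qed
  have eq: "place_val E P z = v z div int d" if "z \<in> E" "z \<noteq> 0" for z
    using place_val_eq[OF t(1,2,3) _ dvd that] t(4) by simp
  have "valued_place emb E P (place_val E P)"
  proof
    fix z w assume zw: "z \<in> E" "w \<in> E" "z \<noteq> 0" "w \<noteq> 0"
    then have "z * w \<in> E" using is_subfieldD[OF sub] by auto
    then show "place_val E P (z * w) = place_val E P z + place_val E P w"
      using zw eq[of z] eq[of w] eq[of "z * w"] v_mult[of z w] dvd[of z] dvd[of w]
      by (auto simp: div_plus_div_distrib_dvd_left)
  next
    fix z assume "z \<in> E" "z \<noteq> 0"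
    then show "z \<in> A \<longleftrightarrow> 0 \<le> place_val E P z"
      using v_A[of z] eq[of z] t(4) by (simp add: pos_imp_zdiv_nonneg_iff)
  qed
  moreover have "place_val E P t = 1" using eq[of t] t by simp
  moreover have "v z = v t * place_val E P z" if "z \<in> E" "z \<noteq> 0" for z
    using eq[OF that] dvd[OF that] t by simp
  ultimately show ?thesis using that[OF t(1,2)] by blast
qed

end

text \<open>Discreteness without a uniformizer: if every N-th power is a power of \<pi> times a
  unit, the exponent is additive in z, and it decides membership in A because A is closed under N-th
  roots. N = 1 serves K(x); N = 2 serves F, with \<pi> taken from K(x).\<close>

lemma (in place) valued_place_if_power:
  assumes N: "N > 0" and \<pi>: "\<pi> \<in> P" "\<pi> \<noteq> 0"
    and ex: "\<And>z. z \<in> E \<Longrightarrow> z \<noteq> 0 \<Longrightarrow> \<exists>k. z ^ N / \<pi> powi k \<in> A - P"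
  obtains v where "valued_place emb E P v" "v \<pi> = int N"
    "\<And>z. z \<in> E \<Longrightarrow> z \<noteq> 0 \<Longrightarrow> z ^ N / \<pi> powi v z \<in> A - P"
proof -
  have \<pi>E: "\<pi> \<in> E" using \<pi> P_in_A A_in_E by blast
  have pos: "\<pi> powi k \<in> P" if kp: "k > 0" for k
  proof -
    obtain m where m: "m > 0" "k = int m" using zero_less_imp_eq_int[OF kp] by blast
    obtain n where "m = Suc n" using gr0_implies_Suc[OF m(1)] by blast
    then have n: "k = int (Suc n)" using m by simp
    have "\<pi> * \<pi> ^ n \<in> P" by (rule P_mult2[OF \<pi>(1) A_power[OF P_in_A[OF \<pi>(1)]]])
    then show ?thesis unfolding n power_int_of_nat by simp
  qed
  have unit0: "k = 0" if "\<pi> powi k \<in> A - P" for k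
  proof (cases "k < 0")
    case True
    then have "\<pi> powi (- k) \<in> P" using pos[of "- k"] by simp
    moreover have "inverse (\<pi> powi k) \<notin> P" using unit_inverse that by blast
    ultimately show ?thesis by (simp add: power_int_minus)
  next
    case False
    then show ?thesis using pos[of k] that by (cases "k = 0") auto
  qed
  have ge0: "\<pi> powi k \<in> A \<longleftrightarrow> k \<ge> 0" for k
  proof (cases "k < 0")
    case True
    then have "inverse (\<pi> powi k) \<in> P" using pos[of "- k"] by (simp add: power_int_minus)
    then have "\<pi> powi k \<notin> A"
      using P_iff[of "inverse (\<pi> powi k)"] \<pi>(2) by auto
    then show ?thesis using True by simp
  next
    case False
    then show ?thesis using pos[of k] P_in_A by (cases "k = 0") auto
  qed
  define v where "v z = (SOME k. z ^ N / \<pi> powi k \<in> A - P)" for z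
  have v: "z ^ N / \<pi> powi v z \<in> A - P" if "z \<in> E" "z \<noteq> 0" for z
    unfolding v_def by (rule someI_ex[OF ex[OF that]])
  have uniq: "k = v z" if "z \<in> E" "z \<noteq> 0" "z ^ N / \<pi> powi k \<in> A - P" for z k
  proof -
    have "inverse (z ^ N / \<pi> powi k) \<in> A - P" using unit_inverse that(3) by blast
    then have "inverse (z ^ N / \<pi> powi k) * (z ^ N / \<pi> powi v z) \<in> A - P"
      using v[OF that(1,2)] unit_mult A_mult by blast
    also have "inverse (z ^ N / \<pi> powi k) * (z ^ N / \<pi> powi v z) = \<pi> powi (k - v z)"
      using \<pi>(2) that(2) by (simp add: power_int_diff field_simps)
    finally show ?thesis using unit0 by fastforce
  qed
  have "valued_place emb E P v"
  proof
    fix z w assume zw: "z \<in> E" "w \<in> E" "z \<noteq> 0" "w \<noteq> 0"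
    have "(z ^ N / \<pi> powi v z) * (w ^ N / \<pi> powi v w) \<in> A - P"
      using v[of z] v[of w] zw unit_mult A_mult by blast
    also have "(z ^ N / \<pi> powi v z) * (w ^ N / \<pi> powi v w) = (z * w) ^ N / \<pi> powi (v z + v w)"
      using \<pi>(2) by (simp add: power_int_add power_mult_distrib)
    finally show "v (z * w) = v z + v w"
      using uniq[of "z * w" "v z + v w"] zw is_subfieldD[OF sub] by auto
  next
    fix z assume z: "z \<in> E" "z \<noteq> 0"
    have "z \<in> A \<longleftrightarrow> z ^ N \<in> A" using A_power A_root N z by blast
    also have "\<dots> \<longleftrightarrow> \<pi> powi v z \<in> A"
    proof -
      define u where "u = z ^ N / \<pi> powi v z"
      have u: "u \<in> A" "inverse u \<in> A" using v[OF z] unit_inverse[of u] by (simp_all add: u_def[symmetric])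
      have 1: "z ^ N = u * \<pi> powi v z" using \<pi>(2) by (simp add: u_def)
      have 2: "\<pi> powi v z = inverse u * z ^ N" using \<pi>(2) z by (simp add: u_def)
      show ?thesis
      proof
        show "\<pi> powi v z \<in> A" if "z ^ N \<in> A" by (subst 2) (rule A_mult[OF u(2) that])
        show "z ^ N \<in> A" if "\<pi> powi v z \<in> A" by (subst 1) (rule A_mult[OF u(1) that])
      qed
    qed
    finally show "z \<in> A \<longleftrightarrow> 0 \<le> v z" using ge0 by simp
  qed
  moreover have "\<pi> ^ N / \<pi> powi int N \<in> A - P" using \<pi>(2) by simp
  then have "v \<pi> = int N" by (rule uniq[OF \<pi>E \<pi>(2), symmetric])
  ultimately show ?thesis using that v by blast
qed

context place
begin

text \<open>Finiteness of A/P, expressed by representatives so that no quotient ring has to be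
  formed.\<close>

definition finite_residue :: bool where
  "finite_residue \<longleftrightarrow> (\<exists>C. finite C \<and> C \<subseteq> A \<and> (\<forall>z\<in>A. \<exists>c\<in>C. z - c \<in> P))"

end

locale discrete_place = place emb E P for emb :: "'k::field \<Rightarrow> 'f::field" and E P +
  assumes discrete: "\<exists>v. valued_place emb E P v"
begin

lemma valued_place_val: "valued_place emb E P (place_val E P)"
  and ex_uniformizer: "\<exists>t\<in>E. t \<noteq> 0 \<and> place_val E P t = 1"
  using discrete valued_place.valued_place_place_val[of emb E P] by metis+

end

sublocale discrete_place \<subseteq> valued_place emb E P "place_val E P"
  by (rule valued_place_val)

section \<open>Places of the rational function field\<close>

lemma finite_degree_bounded: "finite {p :: 'k::{zero,finite} poly. degree p < n}"
proof -
  have "{p :: 'k poly. degree p < n} \<subseteq> Poly ` {xs. set xs \<subseteq> UNIV \<and> length xs \<le> n}"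
  proof
    fix p :: "'k poly" assume "p \<in> {p. degree p < n}"
    then have "length (coeffs p) \<le> n" by (cases "p = 0") (auto simp: length_coeffs)
    then show "p \<in> Poly ` {xs. set xs \<subseteq> UNIV \<and> length xs \<le> n}"
      by (metis (mono_tags, lifting) Poly_coeffs image_eqI mem_Collect_eq subset_UNIV)
  qed
  then show ?thesis
    by (rule finite_subset) (intro finite_imageI finite_lists_length_le, simp)
qed

lemma poly_power_split:
  fixes p a :: "'k::field poly"
  assumes "degree p > 0" "a \<noteq> 0"
  shows "\<exists>i b. a = p ^ i * b \<and> \<not> p dvd b"
  using assms(2)
proof (induction "degree a" arbitrary: a rule: less_induct)
  case less
  show ?case
  proof (cases "p dvd a")
    case False
    then show ?thesis by (intro exI[of _ 0] exI[of _ a]) simp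
  next
    case True
    then obtain c where c: "a = p * c" by auto
    then have "c \<noteq> 0" "p \<noteq> 0" using less.prems by auto
    then have "degree c < degree a" using c assms(1) by (simp add: degree_mult_eq)
    then obtain i b where "c = p ^ i * b" "\<not> p dvd b" using less.hyps[of c] \<open>c \<noteq> 0\<close> by auto
    then show ?thesis using c by (intro exI[of _ "Suc i"] exI[of _ b]) (simp add: mult.assoc)
  qed
qed

text \<open>K[x] is principal: the remainder modulo an element of least degree stays in the ideal,
  hence is 0. Applied to the polynomials whose value lies in a place.\<close>

lemma dvd_if_mod_closed:
  fixes I :: "'k::field poly set"
  assumes diff: "\<And>a b. a \<in> I \<Longrightarrow> b \<in> I \<Longrightarrow> a - b \<in> I" and mult: "\<And>a b. b \<in> I \<Longrightarrow> a * b \<in> I"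
    and p: "p \<in> I" "p \<noteq> 0" "\<And>a. a \<in> I \<Longrightarrow> a \<noteq> 0 \<Longrightarrow> degree p \<le> degree a"
  shows "a \<in> I \<longleftrightarrow> p dvd a"
proof
  assume a: "a \<in> I"
  have "a - a div p * p \<in> I" using a p(1) diff mult by blast
  then have "a mod p \<in> I" by (simp add: minus_div_mult_eq_mod)
  then have "a mod p = 0"
    using p(3)[of "a mod p"] degree_mod_less[OF p(2), of a] by (meson leD)
  then show "p dvd a" by auto
next
  assume "p dvd a"
  then show "a \<in> I" using mult[OF p(1)] by (auto simp: mult.commute)
qed

locale rational_subfield = const_field emb for emb :: "'k::{field,finite} \<Rightarrow> 'f::field" +
  fixes x :: 'f
  assumes transcendental: "peval emb p x = 0 \<Longrightarrow> p = 0"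
begin

abbreviation pv :: "'k poly \<Rightarrow> 'f" where "pv p \<equiv> peval emb p x"

lemma pv_eq_0_iff [simp]: "pv p = 0 \<longleftrightarrow> p = 0"
  using transcendental by auto

lemma adjoin_eq: "adjoin emb {x} = {pv a / pv b | a b. b \<noteq> 0}" (is "_ = ?R")
proof
  have 0: "pv a / pv b \<in> ?R" if "b \<noteq> 0" for a b
    using that by blast
  have "is_subfield ?R"
    unfolding is_subfield_def
  proof (intro conjI ballI)
    show "0 \<in> ?R" using 0[of 1 0] by simp
    show "1 \<in> ?R" using 0[of 1 1] by simp
  next
    fix s t assume "s \<in> ?R" "t \<in> ?R"
    then obtain a b a' b' where st: "s = pv a / pv b" "b \<noteq> 0" "t = pv a' / pv b'" "b' \<noteq> 0" by auto
    have eq: "s - t = pv (a * b' - a' * b) / pv (b * b')" using st by (simp add: diff_frac_eq)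
    show "s - t \<in> ?R" unfolding eq by (rule 0) (use st in simp)
    have eq: "s * t = pv (a * a') / pv (b * b')" using st by simp
    show "s * t \<in> ?R" unfolding eq by (rule 0) (use st in simp)
  next
    fix s assume "s \<in> ?R"
    then obtain a b where s: "s = pv a / pv b" "b \<noteq> 0" by auto
    show "inverse s \<in> ?R"
    proof (cases "a = 0")
      case True
      then show ?thesis using s 0[of 1 0] by simp
    next
      case False
      then show ?thesis using s 0[of a b] by (simp add: inverse_eq_divide)
    qed
  qed
  moreover have "range emb \<subseteq> ?R"
  proof
    fix s assume "s \<in> range emb"
    then obtain c where "s = emb c" by auto
    then show "s \<in> ?R" using 0[of 1 "[:c:]"] by simp
  qed
  moreover have "{x} \<subseteq> ?R" using 0[of 1 "[:0, 1:]"] by simp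
  ultimately show "adjoin emb {x} \<subseteq> ?R" unfolding adjoin_def by blast
next
  show "?R \<subseteq> adjoin emb {x}"
    unfolding adjoin_def
  proof (intro Inter_greatest)
    fix E assume "E \<in> {E. is_subfield E \<and> range emb \<subseteq> E \<and> {x} \<subseteq> E}"
    then have E: "is_subfield E" "\<And>c. emb c \<in> E" "x \<in> E" by auto
    have "pv p \<in> E" for p
      by (induction p) (use E is_subfieldD[OF E(1)] in auto)
    then show "?R \<subseteq> E" using is_subfieldD(8)[OF E(1)] by auto
  qed
qed

abbreviation "Kx \<equiv> adjoin emb {x}"

lemma Kx_I: "b \<noteq> 0 \<Longrightarrow> pv a / pv b \<in> Kx"
  unfolding adjoin_eq by blast

lemma Kx_E:
  assumes "z \<in> Kx"
  obtains a b where "z = pv a / pv b" "b \<noteq> 0"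
  using assms unfolding adjoin_eq by blast

lemma is_subfield_Kx: "is_subfield Kx"
  unfolding adjoin_def is_subfield_def by auto

lemma pv_Kx [simp]: "pv p \<in> Kx"
  using Kx_I[of 1 p] by simp

lemma emb_Kx [simp]: "emb c \<in> Kx"
  using pv_Kx[of "[:c:]"] by simp

lemma x_Kx [simp]: "x \<in> Kx"
  using pv_Kx[of "[:0, 1:]"] by simp

lemmas Kx_closed = is_subfieldD[OF is_subfield_Kx]

text \<open>The elements of positive value for the valuation deg b - deg a. The clause
  \<open>a = 0\<close> is separate because the zero polynomial has degree 0.\<close>

definition infinite_place :: "'f set" where
  "infinite_place = {pv a / pv b | a b. b \<noteq> 0 \<and> (a = 0 \<or> degree a < degree b)}"

end

lemma (in valued_place) place_val_eq_v:
  assumes "t \<in> E" "t \<noteq> 0" "v t = 1" "z \<in> E" "z \<noteq> 0"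
  shows "place_val E P z = v z"
  using place_val_eq[of t 1 z] assms by simp

locale rational_place = rational_subfield emb x + place emb "adjoin emb {x}" P
  for emb :: "'k::{field,finite} \<Rightarrow> 'f::field" and x P
begin

lemma pv_A: "x \<in> A \<Longrightarrow> pv a \<in> A"
  by (rule A_peval)

text \<open>The polynomials with value in P form a prime ideal, nonzero because A would otherwise
  contain every quotient a(x)/b(x); p is its monic generator.\<close>

lemma finite_place:
  assumes x: "x \<in> A"
  obtains p where "lead_coeff p = 1" "irreducible p" "\<forall>a. pv a \<in> P \<longleftrightarrow> p dvd a"
proof -
  define I where "I = {a. pv a \<in> P}"
  obtain z where z: "z \<in> Kx" "z \<notin> A" using A_proper by blast
  then obtain a b where ab: "z = pv a / pv b" "b \<noteq> 0" using Kx_E by blast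
  have "b \<in> I"
  proof (rule ccontr)
    assume "b \<notin> I"
    then have "inverse (pv b) \<in> A" using unit_inverse pv_A[OF x] by (auto simp: I_def)
    then have "pv a * inverse (pv b) \<in> A" using pv_A[OF x] A_mult by blast
    then show False using z ab by (simp add: divide_inverse)
  qed
  define d where "d = (LEAST d. \<exists>a\<in>I. a \<noteq> 0 \<and> degree a = d)"
  have "\<exists>a\<in>I. a \<noteq> 0 \<and> degree a = d"
    unfolding d_def by (rule LeastI[of _ "degree b"]) (use \<open>b \<in> I\<close> ab in blast)
  then obtain q where q: "q \<in> I" "q \<noteq> 0" "degree q = d" by blast
  have dmin: "d \<le> degree a" if "a \<in> I" "a \<noteq> 0" for a
    unfolding d_def by (rule Least_le) (use that in blast)
  define p where "p = Polynomial.smult (inverse (lead_coeff q)) q"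
  have p: "p \<in> I" "p \<noteq> 0" "degree p = d" "lead_coeff p = 1"
    using q P_mult[OF A_emb, of "pv q"] by (auto simp: p_def I_def)
  have dvd: "a \<in> I \<longleftrightarrow> p dvd a" for a
  proof (rule dvd_if_mod_closed)
    show "a - b \<in> I" if "a \<in> I" "b \<in> I" for a b using that P_diff by (simp add: I_def)
    show "a * b \<in> I" if "b \<in> I" for a b using that P_mult[OF pv_A[OF x]] by (simp add: I_def)
  qed (use p dmin in auto)
  have "\<not> p dvd 1"
    using dvd[of 1] by (simp add: I_def)
  have "irreducible p"
  proof (rule irreducibleI)
    fix a b assume ab: "p = a * b"
    then have "a \<in> I \<or> b \<in> I"
      using p(1) P_prime[of "pv a" "pv b"] pv_A[OF x] by (auto simp: I_def)
    moreover have "b' dvd 1" if "p = a' * b'" "a' \<in> I" for a' b'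
    proof -
      have nz: "a' \<noteq> 0" "b' \<noteq> 0" using p(2) that by auto
      have "degree b' = 0" using dmin[OF that(2) nz(1)] p(3) that(1) nz by (simp add: degree_mult_eq)
      then show ?thesis using nz by (simp add: is_unit_iff_degree)
    qed
    ultimately show "a dvd 1 \<or> b dvd 1" using ab by (metis mult.commute)
  qed (use p \<open>\<not> p dvd 1\<close> in auto)
  then show ?thesis using that[of p] p dvd by (auto simp: I_def)
qed

lemma finite_place_facts:
  assumes x: "x \<in> A" and p: "irreducible p" "\<And>a. pv a \<in> P \<longleftrightarrow> p dvd a"
  shows "P = poly_place emb x p" "discrete_place emb Kx P" "place_val Kx P (pv p) = 1"
    "\<And>z. z \<in> A \<Longrightarrow> \<exists>c. degree c < degree p \<and> z - pv c \<in> P"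
proof -
  have degp: "degree p > 0" using p(1) by (metis irreducible_def is_unit_iff_degree neq0_conv)
  then have p0: "p \<noteq> 0" by auto
  have quot: "\<exists>k a b. z = pv p powi k * (pv a / pv b) \<and> \<not> p dvd a \<and> \<not> p dvd b"
    if z: "z \<in> Kx" "z \<noteq> 0" for z
  proof -
    obtain a b where ab: "z = pv a / pv b" "b \<noteq> 0" using z(1) by (rule Kx_E)
    then have "a \<noteq> 0" using z by auto
    obtain i a' where a': "a = p ^ i * a'" "\<not> p dvd a'" using poly_power_split[OF degp \<open>a \<noteq> 0\<close>] by auto
    obtain j b' where b': "b = p ^ j * b'" "\<not> p dvd b'" using poly_power_split[OF degp ab(2)] by auto
    have "z = pv p powi (int i - int j) * (pv a' / pv b')"
      using ab a' b' p0 by (simp add: power_int_diff)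
    then show ?thesis using a' b' by blast
  qed
  have unit: "pv a / pv b \<in> A - P" if "\<not> p dvd a" "\<not> p dvd b" for a b
  proof -
    have "pv a \<in> A - P" "inverse (pv b) \<in> A - P"
      using p(2) that pv_A[OF x] unit_inverse by auto
    then show ?thesis using unit_mult A_mult by (auto simp: divide_inverse)
  qed
  have pP: "pv p \<in> P" using p(2) by simp
  have ex: "\<exists>k. z ^ 1 / pv p powi k \<in> A - P" if z: "z \<in> Kx" "z \<noteq> 0" for z
  proof -
    obtain k a b where *: "z = pv p powi k * (pv a / pv b)" "\<not> p dvd a" "\<not> p dvd b" 
      using quot[OF z] by blast
    then have "z ^ 1 / pv p powi k = pv a / pv b" using p0 by simp
    then show ?thesis using unit[OF *(2,3)] by metis
  qed
  have "pv p \<noteq> 0" using p0 by simp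
  have "\<exists>v. valued_place emb Kx P v \<and> v (pv p) = int 1"
  proof (rule valued_place_if_power[of 1 "pv p"])
    show "\<exists>k. z ^ 1 / pv p powi k \<in> A - P" if "z \<in> Kx" "z \<noteq> 0" for z
      using ex[OF that] .
  qed (use pP p0 in \<open>simp, simp, simp, blast\<close>)
  then obtain v where v: "valued_place emb Kx P v" "v (pv p) = 1" by auto
  interpret v: valued_place emb Kx P v by (rule v(1))
  show "discrete_place emb Kx P" using v(1) by unfold_locales blast
  show "place_val Kx P (pv p) = 1" using v.place_val_eq_v[of "pv p" "pv p"] v(2) p0 by simp
  show "P = poly_place emb x p"
  proof (intro equalityI subsetI)
    fix z assume zP: "z \<in> P"
    show "z \<in> poly_place emb x p"
    proof (cases "z = 0")
      case True
      then have "z = pv 0 / pv 1 \<and> p dvd 0 \<and> \<not> p dvd 1"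
        using p by (auto simp: irreducible_def)
      then show ?thesis unfolding poly_place_def by blast
    next
      case False
      have zK: "z \<in> Kx" using zP P_in_A A_in_E by blast
      obtain k a b where kab: "z = pv p powi k * (pv a / pv b)" "\<not> p dvd a" "\<not> p dvd b" 
        using quot[OF zK False] by blast
      have nz: "pv a / pv b \<noteq> 0" "pv p powi k \<noteq> 0" "pv a / pv b \<in> Kx" "pv p powi k \<in> Kx"
        using kab False Kx_I is_subfield_powi[OF is_subfield_Kx] by auto
      have "v (pv a / pv b) = 0" using v.v_unit[OF nz(3,1)] unit kab by auto
      then have "v z = k" using v.v_mult[OF nz(4,3,2,1)] v.v_powi[of "pv p" k] v(2) kab p0 by simp
      then have "k > 0" using v.v_P[OF zK False] zP by auto
      then obtain n where n: "k = int n" "n > 0" using zero_less_imp_eq_int by blast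
      then have "z = pv (p ^ n * a) / pv b" using kab by simp
      moreover have "p dvd p ^ n * a" using n by (simp add: dvd_power)
      ultimately show ?thesis unfolding poly_place_def using kab by blast
    qed
  next
    fix z assume "z \<in> poly_place emb x p"
    then obtain a b where "z = pv a / pv b" "p dvd a" "\<not> p dvd b" unfolding poly_place_def by blast
    moreover then have "pv a \<in> P" "inverse (pv b) \<in> A" using p(2) pv_A[OF x] unit_inverse by auto
    ultimately show "z \<in> P" using P_mult2 by (auto simp: divide_inverse)
  qed
  fix z assume zA: "z \<in> A"
  obtain a b where ab: "z = pv a / pv b" "\<not> p dvd b"
  proof (cases "z = 0")
    case True
    then show ?thesis using that[of 0 1] p by (auto simp: irreducible_def)
  next
    case False
    have zK: "z \<in> Kx" using zA A_in_E by blast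
    obtain k a b where kab: "z = pv p powi k * (pv a / pv b)" "\<not> p dvd a" "\<not> p dvd b" 
      using quot[OF zK False] by blast
    have nz: "pv a / pv b \<noteq> 0" "pv p powi k \<noteq> 0" "pv a / pv b \<in> Kx" "pv p powi k \<in> Kx"
      using kab False Kx_I is_subfield_powi[OF is_subfield_Kx] by auto
    have "v (pv a / pv b) = 0" using v.v_unit[OF nz(3,1)] unit kab by auto
    then have "v z = k" using v.v_mult[OF nz(4,3,2,1)] v.v_powi[of "pv p" k] v(2) kab p0 by simp
    then have "k \<ge> 0" using v.v_A[OF zK False] zA by auto
    then obtain n where n: "k = int n" using zero_le_imp_eq_int by blast
    then have "z = pv (p ^ n * a) / pv b" using kab by simp
    then show ?thesis using that kab by blast
  qed
  have "b \<noteq> 0" using ab(2) by auto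
  have mod_less: "degree (c mod p) < degree p" for c
    using degree_mod_less[OF p0, of c] degp by auto
  define C where "C = {c :: 'k poly. degree c < degree p}"
  \<comment> \<open>Multiplication by b is injective on the finite set of remainders modulo p, hence
    a permutation of it; so the division a/b can be carried out among remainders.\<close>
  have img: "(\<lambda>c. (b * c) mod p) ` C = C"
  proof (rule endo_inj_surj)
    show "finite C" unfolding C_def by (rule finite_degree_bounded)
    show "(\<lambda>c. (b * c) mod p) ` C \<subseteq> C"
      using mod_less by (auto simp: C_def)
    show "inj_on (\<lambda>c. (b * c) mod p) C"
    proof
      fix c c' assume *: "c \<in> C" "c' \<in> C" "(b * c) mod p = (b * c') mod p"
      then have "p dvd b * (c - c')"
        by (simp only: mod_eq_dvd_iff right_diff_distrib)
      then have "pv b * pv (c - c') \<in> P" using p(2)[of "b * (c - c')"] by simp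
      then have "pv (c - c') \<in> P"
        using P_prime[OF _ pv_A[OF x, of b] pv_A[OF x, of "c - c'"]] p(2)[of b] ab(2) by auto
      then have "p dvd c - c'" using p(2)[of "c - c'"] by simp
      moreover have "degree (c - c') < degree p" using * by (auto simp: C_def intro: degree_diff_less)
      ultimately show "c = c'" using dvd_imp_degree_le[of p "c - c'"] by force
    qed
  qed
  have "a mod p \<in> C"
    using mod_less by (auto simp: C_def)
  then have "a mod p \<in> (\<lambda>c. (b * c) mod p) ` C" by (simp only: img)
  then obtain c where c: "a mod p = (b * c) mod p" "c \<in> C" by (rule imageE)
  then have "p dvd a - b * c" by (simp only: mod_eq_dvd_iff)
  then have "pv a - pv b * pv c \<in> P" using p(2)[of "a - b * c"] by simp
  then have "inverse (pv b) * (pv a - pv b * pv c) \<in> P"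
    using unit_inverse[OF pv_A[OF x, of b]] p(2)[of b] ab(2) P_mult by simp
  also have "inverse (pv b) * (pv a - pv b * pv c) = z - pv c"
    using ab \<open>b \<noteq> 0\<close> by (simp add: field_simps)
  finally have "z - pv c \<in> P" .
  moreover have "degree c < degree p" using c(2) by (simp add: C_def)
  ultimately show "\<exists>c. degree c < degree p \<and> z - pv c \<in> P" by blast
qed

lemma infinite_place_facts:
  assumes x: "x \<notin> A"
  shows "P = infinite_place" "discrete_place emb Kx P"
    "\<And>a. a \<noteq> 0 \<Longrightarrow> place_val Kx P (pv a) = - int (degree a)"
    "\<And>z. z \<in> A \<Longrightarrow> \<exists>c. z - emb c \<in> P"
proof -
  have x0: "x \<noteq> 0" "inverse x \<in> P" using not_A[OF x_Kx x] by auto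
  \<comment> \<open>Pulling out the power of x leaves a unit whose residue is the leading
    coefficient. The residue is carried along because it will show that the residue field is
    K.\<close>
  have pvx: "\<exists>u. pv a = x ^ degree a * u \<and> u - emb (lead_coeff a) \<in> P" if "a \<noteq> 0" for a
    using that
  proof (induction a)
    case (pCons c a)
    show ?case
    proof (cases "a = 0")
      case True
      then show ?thesis using pCons by (intro exI[of _ "emb c"]) simp
    next
      case False
      then obtain u where u: "pv a = x ^ degree a * u" "u - emb (lead_coeff a) \<in> P"
        using pCons by auto
      define d where "d = degree a"
      define w where "w = u + emb c * (inverse x * inverse x ^ d)"
      have "emb c * (inverse x * inverse x ^ d) \<in> P"
        using x0 by (intro P_mult[OF A_emb] P_mult2 A_power P_in_A)
      then have "u - emb (lead_coeff a) + emb c * (inverse x * inverse x ^ d) \<in> P"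
        by (rule P_add[OF u(2)])
      moreover have "u - emb (lead_coeff a) + emb c * (inverse x * inverse x ^ d) = w - emb (lead_coeff a)"
        by (simp add: w_def)
      ultimately have "w - emb (lead_coeff a) \<in> P" by (simp only:)
      moreover have "pv (pCons c a) = x ^ degree (pCons c a) * w"
      proof -
        have "x ^ Suc d * (inverse x * inverse x ^ d) = 1"
          using x0(1) by (simp add: field_simps)
        then have "emb c * (x ^ Suc d * (inverse x * inverse x ^ d)) = emb c" by simp
        then have "x ^ Suc d * w = x ^ Suc d * u + emb c"
          unfolding w_def by (simp only: distrib_left mult.left_commute[of "x ^ Suc d" "emb c"])
        then show ?thesis using u False by (simp add: d_def)
      qed
      ultimately show ?thesis using False by (intro exI[of _ w]) simp
    qed
  qed simp
  have unit: "u \<in> A - P" if "u - emb c \<in> P" "c \<noteq> 0" for u c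
    using P_add[OF that(1)] P_diff[OF _ that(1), of u] A_add[OF P_in_A[OF that(1)] A_emb[of c]] that
    by auto
  have quot: "\<exists>u c. pv a / pv b = inverse x powi (int (degree b) - int (degree a)) * u \<and> 
      u \<in> A - P \<and> u - emb c \<in> P" if ab: "a \<noteq> 0" "b \<noteq> 0" for a b
  proof -
    obtain u where u: "pv a = x ^ degree a * u" "u - emb (lead_coeff a) \<in> P" using pvx ab by blast
    obtain w where w: "pv b = x ^ degree b * w" "w - emb (lead_coeff b) \<in> P" using pvx ab by blast
    have u': "u \<in> A - P" using unit[OF u(2)] ab by simp
    have w': "w \<in> A - P" using unit[OF w(2)] ab by simp
    then have w0: "w \<noteq> 0" by auto
    have eq: "pv a / pv b = inverse x powi (int (degree b) - int (degree a)) * (u * inverse w)"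
      using u w x0 w0 by (simp add: power_int_diff field_simps)
    \<comment> \<open>The residue of u/w is the quotient of the leading coefficients: the difference
      is an explicit combination of the two elements of P just obtained.\<close>
    have "inverse w * ((u - emb (lead_coeff a)) * emb (lead_coeff b) - 
        emb (lead_coeff a) * (w - emb (lead_coeff b))) * emb (inverse (lead_coeff b)) \<in> P"
      using w' unit_inverse[of w] u(2) w(2)
      by (intro P_mult2[OF P_mult[OF _ P_diff[OF P_mult2 P_mult]]] A_emb) auto
    also have "inverse w * ((u - emb (lead_coeff a)) * emb (lead_coeff b) - 
        emb (lead_coeff a) * (w - emb (lead_coeff b))) * emb (inverse (lead_coeff b)) =
        u * inverse w - emb (lead_coeff a * inverse (lead_coeff b))"
    proof -
      define k l where "k = emb (lead_coeff a)" and "l = emb (lead_coeff b)"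
      have "l \<noteq> 0" using ab by (simp add: l_def)
      have "inverse w * ((u - k) * l - k * (w - l)) * inverse l = u * inverse w - k * inverse l"
        using w0 \<open>l \<noteq> 0\<close> by (simp add: field_simps)
      then show ?thesis by (simp only: hom_mult hom_inverse k_def l_def)
    qed
    finally have res: "u * inverse w - emb (lead_coeff a * inverse (lead_coeff b)) \<in> P" .
    have "u * inverse w \<in> A - P" using u' w' unit_mult unit_inverse[of w] A_mult by auto
    then show ?thesis
      using eq res by (intro exI[of _ "u * inverse w"] exI[of _ "lead_coeff a * inverse (lead_coeff b)"]) auto
  qed
  have ex: "\<exists>k. z ^ 1 / inverse x powi k \<in> A - P" if z: "z \<in> Kx" "z \<noteq> 0" for z
  proof -
    obtain a b where ab: "z = pv a / pv b" "b \<noteq> 0" using z(1) by (rule Kx_E)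
    then have "a \<noteq> 0" using z by auto
    then obtain u where "z = inverse x powi (int (degree b) - int (degree a)) * u" "u \<in> A - P" 
      using quot[OF _ ab(2), of a] ab(1) by blast
    then have "z ^ 1 / inverse x powi (int (degree b) - int (degree a)) = u" using x0 by simp
    then show ?thesis using \<open>u \<in> A - P\<close> by metis
  qed
  have "inverse x \<noteq> 0" using x0 by simp
  have "\<exists>v. valued_place emb Kx P v \<and> v (inverse x) = int 1"
  proof (rule valued_place_if_power[of 1 "inverse x"])
    show "\<exists>k. z ^ 1 / inverse x powi k \<in> A - P" if "z \<in> Kx" "z \<noteq> 0" for z
      using ex[OF that] .
  qed (use x0 in \<open>simp, simp, simp, blast\<close>)
  then obtain v where v: "valued_place emb Kx P v" "v (inverse x) = 1" by auto
  interpret v: valued_place emb Kx P v by (rule v(1))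
  show "discrete_place emb Kx P" using v(1) by unfold_locales blast
  have xi: "inverse x \<in> Kx" "inverse x \<noteq> 0" using x0 Kx_closed by auto
  have vq: "v (pv a / pv b) = int (degree b) - int (degree a)" if ab: "a \<noteq> 0" "b \<noteq> 0" for a b
  proof -
    obtain u where u: "pv a / pv b = inverse x powi (int (degree b) - int (degree a)) * u" "u \<in> A - P" 
      using quot[OF ab] by blast
    have u0: "u \<noteq> 0" "u \<in> Kx" using u(2) A_in_E by auto
    have "v u = 0" using u(2) v.v_unit[OF u0(2,1)] by simp
    moreover define k where "k = int (degree b) - int (degree a)"
    have "v (inverse x powi k * u) = v (inverse x powi k) + v u"
      using xi u0 by (intro v.v_mult is_subfield_powi[OF is_subfield_Kx]) auto
    ultimately show ?thesis
      unfolding u(1) k_def[symmetric] using v.v_powi[OF xi, of k] v(2) by simp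
  qed
  show "place_val Kx P (pv a) = - int (degree a)" if "a \<noteq> 0" for a
    using v.place_val_eq_v[OF xi v(2), of "pv a"] vq[OF that, of 1] that by simp
  have iff: "pv a / pv b \<in> P \<longleftrightarrow> a = 0 \<or> degree a < degree b" if "b \<noteq> 0" for a b
    using vq[of a b] that v.v_P[OF Kx_I[OF that], of a] by (cases "a = 0") auto
  show "P = infinite_place"
  proof (intro equalityI subsetI)
    fix z assume z: "z \<in> P"
    then have "z \<in> Kx" using P_in_A A_in_E by blast
    then obtain a b where ab: "z = pv a / pv b" "b \<noteq> 0" by (rule Kx_E)
    then have "a = 0 \<or> degree a < degree b" using z iff[OF ab(2), of a] by simp
    then show "z \<in> infinite_place" unfolding infinite_place_def using ab by blast
  next
    fix z assume "z \<in> infinite_place"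
    then obtain a b where ab: "z = pv a / pv b" "b \<noteq> 0" "a = 0 \<or> degree a < degree b"
      unfolding infinite_place_def by blast
    then show "z \<in> P" using iff[OF ab(2), of a] by simp
  qed
  fix z assume z: "z \<in> A"
  show "\<exists>c. z - emb c \<in> P"
  proof (cases "z \<in> P")
    case True
    then show ?thesis by (intro exI[of _ 0]) simp
  next
    case False
    then have nz: "z \<noteq> 0" "z \<in> Kx" using z A_in_E by auto
    then obtain a b where ab: "z = pv a / pv b" "b \<noteq> 0" using Kx_E by blast
    then have "a \<noteq> 0" using nz by auto
    have "v z = 0" using v.v_unit[OF nz(2,1)] z False by simp
    then have "v (pv a / pv b) = 0" unfolding ab(1) .
    then have deg: "degree a = degree b" using vq[OF \<open>a \<noteq> 0\<close> ab(2)] by linarith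
    obtain u c where u: "pv a / pv b = inverse x powi (int (degree b) - int (degree a)) * u"
      "u - emb c \<in> P" using quot[OF \<open>a \<noteq> 0\<close> ab(2)] by blast
    have "z = u" unfolding ab(1) u(1) deg by simp
    show ?thesis unfolding \<open>z = u\<close> using u(2) by (rule exI[of _ c])
  qed
qed

lemma discrete_place_P: "discrete_place emb Kx P"
proof (cases "x \<in> A")
  case True
  obtain p where "lead_coeff p = 1" "irreducible p" "\<forall>a. pv a \<in> P \<longleftrightarrow> p dvd a"
    by (rule finite_place[OF True])
  note p = this[rule_format]
  show ?thesis by (rule finite_place_facts(2)[OF True p(2,3)])
qed (rule infinite_place_facts(2))

lemma finite_residue_P: finite_residue
proof (cases "x \<in> A")
  case True
  obtain p where "lead_coeff p = 1" "irreducible p" "\<forall>a. pv a \<in> P \<longleftrightarrow> p dvd a"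
    by (rule finite_place[OF True])
  note p = this[rule_format]
  show ?thesis unfolding finite_residue_def
  proof (intro exI conjI ballI)
    show "finite (pv ` {c. degree c < degree p})" by (intro finite_imageI finite_degree_bounded)
    show "pv ` {c. degree c < degree p} \<subseteq> A" using pv_A[OF True] by blast
    show "\<exists>c\<in>pv ` {c. degree c < degree p}. z - c \<in> P" if "z \<in> A" for z
      using finite_place_facts(4)[OF True p(2,3) that] by blast
  qed
next
  case False
  show ?thesis unfolding finite_residue_def
  proof (intro exI conjI ballI)
    show "\<exists>c\<in>range emb. z - c \<in> P" if "z \<in> A" for z
      using infinite_place_facts(4)[OF False that] by blast
  qed (use A_emb in auto)
qed

end

context rational_subfield
begin

lemma place_eq_poly_place:
  assumes PP: "P \<in> places emb Kx" "pv p \<in> P" "x \<in> place_ring Kx P" and p: "irreducible p"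
  shows "P = poly_place emb x p"
proof -
  interpret rational_place emb x P by unfold_locales (use PP is_subfield_Kx in auto)
  obtain q where "lead_coeff q = 1" "irreducible q" "\<forall>a. pv a \<in> P \<longleftrightarrow> q dvd a"
    by (rule finite_place[OF PP(3)])
  note q = this[rule_format]
  have "q dvd p" using q(3)[of p] PP by simp
  moreover have "\<not> q dvd 1" using q(2) by (simp add: irreducible_def)
  ultimately have "p dvd q" using irreducibleD'[OF p] by blast
  then have "q dvd a \<longleftrightarrow> p dvd a" for a using \<open>q dvd p\<close> dvd_trans by blast
  then show ?thesis using finite_place_facts(1)[OF PP(3) p] q(3) by simp
qed

lemma rational_place_unique:
  assumes "P \<in> places emb Kx" "P' \<in> places emb Kx" "irreducible p" "pv p \<in> P" "pv p \<in> P'"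
    "x \<in> place_ring Kx P" "x \<in> place_ring Kx P'"
  shows "P = P'"
  using place_eq_poly_place assms by metis

text \<open>A pole at a finite place comes from a prime factor of the denominator b, and over a
  finite field only finitely many polynomials have degree at most deg b.\<close>

lemma finite_poles_Kx:
  assumes "z \<in> Kx"
  shows "finite {P \<in> places emb Kx. z \<notin> place_ring Kx P}"
proof -
  obtain a b where ab: "z = pv a / pv b" "b \<noteq> 0" using assms by (rule Kx_E)
  have "{P \<in> places emb Kx. z \<notin> place_ring Kx P} \<subseteq> 
      insert infinite_place (poly_place emb x ` {p. degree p < Suc (degree b)})"
  proof
    fix P assume "P \<in> {P \<in> places emb Kx. z \<notin> place_ring Kx P}"
    then have P: "P \<in> places emb Kx" "z \<notin> place_ring Kx P" by auto
    interpret rational_place emb x P by unfold_locales (use P is_subfield_Kx in auto)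
    show "P \<in> insert infinite_place (poly_place emb x ` {p. degree p < Suc (degree b)})"
    proof (cases "x \<in> A")
      case True
      obtain q where "lead_coeff q = 1" "irreducible q" "\<forall>a. pv a \<in> P \<longleftrightarrow> q dvd a"
        by (rule finite_place[OF True])
      note q = this(2,3)[rule_format]
      have "pv b \<in> P"
      proof (rule ccontr)
        assume "pv b \<notin> P"
        then have "pv a * inverse (pv b) \<in> A" using unit_inverse[OF pv_A[OF True]] pv_A[OF True, of a] A_mult by simp
        then show False using P ab by (simp add: divide_inverse)
      qed
      then have "q dvd b" using q(2)[of b] by simp
      then have "degree q \<le> degree b" using ab by (simp add: dvd_imp_degree_le)
      then show ?thesis using finite_place_facts(1)[OF True q] by auto
    qed (use infinite_place_facts in auto)
  qed
  then show ?thesis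
    by (rule finite_subset) (intro finite.insertI finite_imageI finite_degree_bounded)
qed

end

section \<open>Places of the quadratic extension\<close>

locale quadratic_extension = rational_subfield emb x for emb :: "'k::{field,finite} \<Rightarrow> 'f::field" and x +
  fixes y :: 'f and f :: "'k poly"
  assumes two: "(2 :: 'k) \<noteq> 0" and gen: "adjoin emb {x, y} = UNIV"
    and eqn: "y ^ 2 = peval emb f x" and sqf: "squarefree f" and degf: "degree f = 3"
begin

lemma f_nz [simp]: "f \<noteq> 0"
  using degf by auto

lemma two_F: "(2 :: 'f) \<noteq> 0"
proof -
  have "emb 2 \<noteq> 0" using two by simp
  moreover have "emb 2 = 2" using hom_add[of 1 1] by simp
  ultimately show ?thesis by simp
qed

text \<open>Parity of degrees: a^2 = f b^2 would equate an even number with 3 + 2 deg b.\<close>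

lemma f_not_square: assumes "e \<in> Kx" shows "e ^ 2 \<noteq> pv f"
proof
  assume e: "e ^ 2 = pv f"
  obtain a b where ab: "e = pv a / pv b" "b \<noteq> 0" using assms by (rule Kx_E)
  have "pv a ^ 2 = pv f * pv b ^ 2" using e ab by (simp add: field_simps)
  then have "pv (a ^ 2 - f * b ^ 2) = 0" by simp
  then have eq: "a ^ 2 = f * b ^ 2" by (simp only: pv_eq_0_iff right_minus_eq)
  have "degree (a ^ 2) = 3 + 2 * degree b"
    unfolding eq using ab by (simp add: degree_mult_eq degree_power_eq degf)
  moreover have "even (degree (a ^ 2))"
    by (cases "a = 0") (simp_all add: degree_power_eq)
  ultimately show False by simp
qed

lemma y_nz [simp]: "y \<noteq> 0"
  using eqn f_nz pv_eq_0_iff[of f] by (metis power_zero_numeral)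

text \<open>The form is the norm of a + b y; it is anisotropic because f is not a square in
  K(x).\<close>

lemma norm_form_nz:
  assumes "a \<in> Kx" "b \<in> Kx" "a \<noteq> 0 \<or> b \<noteq> 0"
  shows "a ^ 2 - b ^ 2 * pv f \<noteq> 0"
proof
  assume 0: "a ^ 2 - b ^ 2 * pv f = 0"
  show False
  proof (cases "b = 0")
    case False
    then have "(a / b) ^ 2 = pv f" using 0 by (simp add: field_simps)
    then show False using f_not_square Kx_closed(8)[OF assms(1,2)] by blast
  qed (use 0 assms in auto)
qed

lemma repr_unique:
  assumes "a \<in> Kx" "b \<in> Kx" "a' \<in> Kx" "b' \<in> Kx" "a + b * y = a' + b' * y"
  shows "a = a'" "b = b'"
proof -
  have 0: "(a - a') = - ((b - b') * y)" using assms(5) by (simp add: algebra_simps)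
  then have "(a - a') ^ 2 - (b - b') ^ 2 * pv f = 0"
    unfolding eqn[symmetric] by (simp add: power_mult_distrib)
  then have "\<not> (a - a' \<noteq> 0 \<or> b - b' \<noteq> 0)"
    using norm_form_nz[of "a - a'" "b - b'"] Kx_closed(3) assms by blast
  then show "a = a'" "b = b'" by simp_all
qed

lemma repr_mult: "(a + b * y) * (a' + b' * y) = (a * a' + b * b' * pv f) + (a * b' + b * a') * y"
  unfolding eqn[symmetric] by (simp add: algebra_simps power2_eq_square)

text \<open>K(x) + K(x) y is closed under inverses because nonzero elements have nonzero norm. Being
  a field that contains x and y, it is all of F.\<close>

lemma repr_exists: "\<exists>a\<in>Kx. \<exists>b\<in>Kx. z = a + b * y"
proof -
  define R where "R = {a + b * y | a b. a \<in> Kx \<and> b \<in> Kx}"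
  have I: "a + b * y \<in> R" if "a \<in> Kx" "b \<in> Kx" for a b using that unfolding R_def by blast
  have E: "\<exists>a b. a \<in> Kx \<and> b \<in> Kx \<and> z = a + b * y" if "z \<in> R" for z
    using that unfolding R_def by blast
  have KR: "a \<in> R" if "a \<in> Kx" for a using I[OF that Kx_closed(1)] by simp
  have "is_subfield R"
    unfolding is_subfield_def
  proof (intro conjI ballI)
    fix s t assume "s \<in> R" "t \<in> R"
    then obtain a b a' b' where s: "a \<in> Kx" "b \<in> Kx" "s = a + b * y"
      and t: "a' \<in> Kx" "b' \<in> Kx" "t = a' + b' * y" using E by meson
    have eq: "s - t = (a - a') + (b - b') * y" using s t by (simp add: algebra_simps)
    show "s - t \<in> R" unfolding eq by (rule I) (use s t Kx_closed(3) in auto)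
    have eq: "s * t = (a * a' + b * b' * pv f) + (a * b' + b * a') * y" using s t repr_mult by simp
    show "s * t \<in> R" unfolding eq by (rule I) (use s t Kx_closed(4,7) in auto)
  next
    fix s assume "s \<in> R"
    then obtain a b where s: "a \<in> Kx" "b \<in> Kx" "s = a + b * y" using E by blast
    show "inverse s \<in> R"
    proof (cases "a = 0 \<and> b = 0")
      case True
      then show ?thesis using s KR[OF Kx_closed(1)] by simp
    next
      case False
      define d where "d = a ^ 2 - b ^ 2 * pv f"
      have d: "d \<noteq> 0" "d \<in> Kx"
        using norm_form_nz[OF s(1,2)] False s Kx_closed is_subfield_power[OF is_subfield_Kx]
        by (auto simp: d_def)
      have "s * (a / d + (- b / d) * y) = (a ^ 2 - b ^ 2 * pv f) / d"
        unfolding s(3) eqn[symmetric] using d by (simp add: field_simps power2_eq_square)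
      then have "s * (a / d + (- b / d) * y) = 1" using d by (simp add: d_def)
      then have "inverse s = a / d + (- b / d) * y" by (metis inverse_unique)
      then show ?thesis using I[of "a / d" "- b / d"] s d Kx_closed by simp
    qed
  qed (use KR Kx_closed in auto)
  moreover have "range emb \<subseteq> R" using KR emb_Kx by blast
  moreover have "{x, y} \<subseteq> R" using KR[OF x_Kx] I[OF Kx_closed(1,2)] by simp
  ultimately have "adjoin emb {x, y} \<subseteq> R" unfolding adjoin_def by blast
  then show ?thesis using gen E[of z] by blast
qed

text \<open>The nontrivial automorphism of F over K(x), sending y to -y; geometrically, negation on
  the elliptic curve.\<close>

definition bar :: "'f \<Rightarrow> 'f" where
  "bar z = (THE w. \<exists>a\<in>Kx. \<exists>b\<in>Kx. z = a + b * y \<and> w = a - b * y)"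

lemma bar_eq: assumes "a \<in> Kx" "b \<in> Kx" shows "bar (a + b * y) = a - b * y"
  unfolding bar_def
proof (rule the_equality)
  fix w assume "\<exists>a'\<in>Kx. \<exists>b'\<in>Kx. a + b * y = a' + b' * y \<and> w = a' - b' * y"
  then obtain a' b' where *: "a' \<in> Kx" "b' \<in> Kx" "a + b * y = a' + b' * y" "w = a' - b' * y" by blast
  show "w = a - b * y" using repr_unique[OF assms *(1-3)] *(4) by simp
qed (use assms in blast)

lemma bar_Kx: "a \<in> Kx \<Longrightarrow> bar a = a"
  using bar_eq[of a 0] Kx_closed(1) by simp

lemma bar_0 [simp]: "bar 0 = 0" and bar_1 [simp]: "bar 1 = 1"
  using bar_Kx Kx_closed(1,2) by auto

lemma bar_pv [simp]: "bar (pv a) = pv a" and bar_emb [simp]: "bar (emb c) = emb c"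
  using bar_Kx by auto

lemma bar_y [simp]: "bar y = - y"
  using bar_eq[of 0 1] Kx_closed(1,2) by simp

lemma repr_obtain:
  obtains a b where "a \<in> Kx" "b \<in> Kx" "z = a + b * y" "bar z = a - b * y"
  using repr_exists[of z] bar_eq by metis

lemma bar_diff: "bar (z - w) = bar z - bar w"
proof -
  obtain a b where z: "a \<in> Kx" "b \<in> Kx" "z = a + b * y" "bar z = a - b * y" by (rule repr_obtain)
  obtain a' b' where w: "a' \<in> Kx" "b' \<in> Kx" "w = a' + b' * y" "bar w = a' - b' * y" by (rule repr_obtain)
  have eq: "z - w = (a - a') + (b - b') * y" using z(3) w(3) by (simp add: algebra_simps)
  have "bar (z - w) = (a - a') - (b - b') * y"
    unfolding eq by (rule bar_eq) (use z w Kx_closed(3) in auto)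
  then show ?thesis unfolding z(4) w(4) by (simp add: algebra_simps)
qed

lemma bar_mult: "bar (z * w) = bar z * bar w"
proof -
  obtain a b where z: "a \<in> Kx" "b \<in> Kx" "z = a + b * y" "bar z = a - b * y" by (rule repr_obtain)
  obtain a' b' where w: "a' \<in> Kx" "b' \<in> Kx" "w = a' + b' * y" "bar w = a' - b' * y" by (rule repr_obtain)
  have "z * w = (a * a' + b * b' * pv f) + (a * b' + b * a') * y" using z w repr_mult by simp
  then have "bar (z * w) = (a * a' + b * b' * pv f) - (a * b' + b * a') * y"
    using bar_eq[of "a * a' + b * b' * pv f" "a * b' + b * a'"] z(1,2) w(1,2) Kx_closed(4,7) pv_Kx by simp
  also have "\<dots> = bar z * bar w"
    unfolding z(4) w(4) eqn[symmetric] by (simp add: algebra_simps power2_eq_square)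
  finally show ?thesis .
qed

lemma bar_bar [simp]: "bar (bar z) = z"
proof -
  obtain a b where z: "a \<in> Kx" "b \<in> Kx" "z = a + b * y" "bar z = a - b * y" by (rule repr_obtain)
  have "bar z = a + (- b) * y" using z by simp
  then have "bar (bar z) = a - (- b) * y" using bar_eq[of a "- b"] z(1,2) Kx_closed(6) by simp
  then show ?thesis using z by simp
qed

lemma bar_eq_0_iff [simp]: "bar z = 0 \<longleftrightarrow> z = 0"
  using bar_bar[of z] bar_0 by metis

lemma bar_inverse: "bar (inverse z) = inverse (bar z)"
proof (cases "z = 0")
  case False
  then have "bar z * bar (inverse z) = 1" by (simp flip: bar_mult)
  then show ?thesis by (metis inverse_unique)
qed simp

lemma trace_Kx: "z + bar z \<in> Kx"
proof -
  obtain a b where z: "a \<in> Kx" "b \<in> Kx" "z = a + b * y" "bar z = a - b * y" by (rule repr_obtain)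
  then have "z + bar z = a + a" by simp
  then show ?thesis using Kx_closed(7)[OF z(1,1)] by simp
qed

lemma norm_Kx: "z * bar z \<in> Kx"
proof -
  obtain a b where z: "a \<in> Kx" "b \<in> Kx" "z = a + b * y" "bar z = a - b * y" by (rule repr_obtain)
  have "z * bar z = a * a - b * b * pv f"
    unfolding arg_cong2[OF z(3,4), of "(*)"] eqn[symmetric] by (simp add: algebra_simps power2_eq_square)
  then show ?thesis using Kx_closed(3,4) z(1,2) pv_Kx by simp
qed

text \<open>The characteristic polynomial of z over K(x): trace and norm lie in K(x), which makes
  this equation the bridge from places of K(x) to places of F.\<close>

lemma quadratic_equation: "z ^ 2 = (z + bar z) * z - z * bar z"
  by (simp add: algebra_simps power2_eq_square)

end

locale curve_place = quadratic_extension emb x y f + place emb UNIV Q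
  for emb :: "'k::{field,finite} \<Rightarrow> 'f::field" and x y f Q
begin

lemma valuation_ring_Kx: "valuation_ring emb Kx (A \<inter> Kx)"
  unfolding valuation_ring_def
proof (intro conjI ballI)
  have x0: "x \<noteq> emb c" for c
    using pv_eq_0_iff[of "[:- c, 1:]"] by (auto simp: hom_uminus)
  have ix0: "inverse x \<noteq> emb c" for c
    using x0[of "inverse c"] by (metis hom_inverse inverse_inverse_eq)
  \<comment> \<open>One of x and 1/x is regular and neither is constant, so the restricted ring is
    larger than K.\<close>
  have "x \<in> A \<or> inverse x \<in> A" using A_total[of x] by auto
  then have "\<exists>z. z \<in> A \<inter> Kx \<and> z \<notin> range emb"
    using x0 ix0 x_Kx Kx_closed(5)[OF x_Kx] by blast
  then show "range emb \<subset> A \<inter> Kx" using A_emb emb_Kx by blast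
  \<comment> \<open>Otherwise every z would be integral over A: z^2 = T z - N gives z = T - N/z,
    which is regular as soon as 1/z is.\<close>
  have "\<not> Kx \<subseteq> A"
  proof
    assume KA: "Kx \<subseteq> A"
    obtain z where z: "z \<notin> A" using A_proper by blast
    then have iz: "z \<noteq> 0" "inverse z \<in> A" using not_A[of z] P_in_A by auto
    have "(z + bar z) - (z * bar z) * inverse z = z" using iz by (simp add: field_simps)
    moreover have "(z + bar z) - (z * bar z) * inverse z \<in> A"
      using KA trace_Kx[of z] norm_Kx[of z] iz(2) by (intro A_diff[OF _ A_mult]) auto
    ultimately show False using z by (simp only:)
  qed
  then show "A \<inter> Kx \<subset> Kx" by blast
next
  fix z w assume zw: "z \<in> A \<inter> Kx" "w \<in> A \<inter> Kx"
  show "z - w \<in> A \<inter> Kx" using zw A_diff Kx_closed(3) by simp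
  show "z * w \<in> A \<inter> Kx" using zw A_mult Kx_closed(4) by simp
next
  fix z assume z: "z \<in> Kx"
  show "z \<in> A \<inter> Kx \<or> inverse z \<in> A \<inter> Kx"
    using A_total[of z] z Kx_closed(5)[OF z] by auto
qed

lemma nonunits_Kx: "nonunits (A \<inter> Kx) = Q \<inter> Kx"
  unfolding nonunits_def using P_iff Kx_closed(5) by auto

lemma restrict_place: "Q \<inter> Kx \<in> places emb Kx"
  unfolding places_iff[OF is_subfield_Kx] using valuation_ring_Kx nonunits_Kx by auto

lemma restrict_ring: "place_ring Kx (Q \<inter> Kx) = A \<inter> Kx"
  using place_ring_nonunits[OF valuation_ring_Kx] nonunits_Kx by simp

end

sublocale curve_place \<subseteq> R: rational_place emb x "Q \<inter> Kx"
  by unfold_locales (use is_subfield_Kx restrict_place in auto)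

sublocale curve_place \<subseteq> R: discrete_place emb Kx "Q \<inter> Kx"
  by (rule R.discrete_place_P)

context curve_place
begin

abbreviation "w \<equiv> place_val Kx (Q \<inter> Kx)"

text \<open>The Newton polygon of X^2 - T X + N, read off before a valuation exists, by comparing z
  with its conjugate through z^2/N. If this is a unit, e = N. If z has the larger value, T z/N = 1 +
  z^2/N is a unit and e = (N/T)^2. If z has the smaller value, T/z = 1 + N/z^2 is a unit and e =
  T^2.\<close>

lemma square_val:
  assumes z: "z \<noteq> 0"
  shows "\<exists>e\<in>Kx. e \<noteq> 0 \<and> z ^ 2 / e \<in> A - Q"
proof -
  define T where "T = z + bar z"
  define N where "N = z * bar z"
  have K: "T \<in> Kx" "N \<in> Kx" using trace_Kx norm_Kx by (auto simp: T_def N_def)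
  have N: "N \<noteq> 0" using z by (simp add: N_def)
  have eq: "z ^ 2 = T * z - N" unfolding T_def N_def by (rule quadratic_equation)
  have unit1: "1 + s \<in> A - Q" if "s \<in> Q" for s
    using P_diff[OF _ that, of "1 + s"] A_add[OF A_1 P_in_A[OF that]] by auto
  have sq: "s ^ 2 \<in> A - Q" if "s \<in> A - Q" for s
    using that unit_mult[of s s] A_mult[of s s] by (simp add: power2_eq_square)
  consider "z ^ 2 / N \<in> A - Q" | "z ^ 2 / N \<in> Q" | "inverse (z ^ 2 / N) \<in> Q"
    using not_A[of "z ^ 2 / N"] by auto
  then show ?thesis
  proof cases
    case 1
    then show ?thesis using K N by blast
  next
    case 2
    have "T * z / N \<in> A - Q" using unit1[OF 2] eq N by (simp add: field_simps)
    then have "(T * z / N) ^ 2 \<in> A - Q" and T: "T \<noteq> 0" using sq by auto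
    moreover have "(T * z / N) ^ 2 = z ^ 2 / (N / T) ^ 2" by (simp add: field_simps)
    moreover have "(N / T) ^ 2 \<in> Kx" using K Kx_closed(8) is_subfield_power[OF is_subfield_Kx] by blast
    moreover have "(N / T) ^ 2 \<noteq> 0" using N T by simp
    ultimately show ?thesis by (intro bexI[of _ "(N / T) ^ 2"]) simp_all
  next
    case 3
    have "T / z = 1 + inverse (z ^ 2 / N)" using eq z N by (simp add: field_simps power2_eq_square)
    then have Tz: "T / z \<in> A - Q" using unit1[OF 3] by simp
    then have T: "T \<noteq> 0" by auto
    have "inverse (T / z) \<in> A - Q" using Tz unit_inverse by blast
    then have "(inverse (T / z)) ^ 2 \<in> A - Q" by (rule sq)
    moreover have "(inverse (T / z)) ^ 2 = z ^ 2 / T ^ 2" by (simp add: power_divide)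
    moreover have "T ^ 2 \<in> Kx" using K is_subfield_power[OF is_subfield_Kx] by blast
    ultimately show ?thesis using T by (intro bexI[of _ "T ^ 2"]) simp_all
  qed
qed

text \<open>The exponent of a uniformizer t of K(x) in z^2 is a valuation, so every place of F is
  discrete. Its restriction to K(x) is \<open>2 * w\<close> whatever the ramification; hence the
  valuations of two places over the same place of K(x) agree there, and \<open>places_over\<close>
  can compare them.\<close>

lemma double_val: "\<exists>v. valued_place emb UNIV Q v \<and> (\<forall>e\<in>Kx. e \<noteq> 0 \<longrightarrow> v e = 2 * w e)"
proof -
  obtain t where t: "t \<in> Kx" "t \<noteq> 0" "w t = 1" using R.ex_uniformizer by blast
  have tQ: "t \<in> Q" using R.v_P[OF t(1,2)] t(3) by simp
  have kx_unit: "e / t powi w e \<in> A - Q \<and> e / t powi w e \<in> Kx" if e: "e \<in> Kx" "e \<noteq> 0" for e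
  proof -
    have tp: "t powi w e \<in> Kx" "t powi w e \<noteq> 0" using is_subfield_powi[OF is_subfield_Kx t(1)] t(2) by auto
    have "w (t powi w e) = w e" using R.v_powi[OF t(1,2)] t(3) by simp
    then have "w (e / t powi w e) = 0" using R.v_divide[OF e(1) tp(1) e(2) tp(2)] by simp
    moreover have *: "e / t powi w e \<in> Kx" "e / t powi w e \<noteq> 0" using Kx_closed(8)[OF e(1) tp(1)] e tp by auto
    ultimately have "e / t powi w e \<in> place_ring Kx (Q \<inter> Kx) \<and> e / t powi w e \<notin> Q \<inter> Kx"
      using R.v_unit[OF *] by simp
    then show ?thesis using * restrict_ring by auto
  qed
  have "\<exists>v. valued_place emb UNIV Q v \<and> v t = int 2 \<and> (\<forall>z. z \<noteq> 0 \<longrightarrow> z ^ 2 / t powi v z \<in> A - Q)"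
  proof (rule valued_place_if_power[of 2 t])
    fix z :: 'f assume "z \<in> UNIV" "z \<noteq> 0"
    then obtain e where e: "e \<in> Kx" "e \<noteq> 0" "z ^ 2 / e \<in> A - Q" using square_val by blast
    have "(z ^ 2 / e) * (e / t powi w e) \<in> A - Q"
      using e(3) kx_unit[OF e(1,2)] by (intro DiffI A_mult unit_mult) auto
    then have "z ^ 2 / t powi w e \<in> A - Q" using e(2) by simp
    then show "\<exists>k. z ^ 2 / t powi k \<in> A - Q" by (rule exI)
  qed (use tQ t in \<open>simp, simp, simp, blast\<close>)
  then obtain v where v: "valued_place emb UNIV Q v" "v t = int 2" by blast
  interpret v: valued_place emb UNIV Q v by (rule v(1))
  have "v e = 2 * w e" if e: "e \<in> Kx" "e \<noteq> 0" for e
  proof -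
    have ep: "e / t powi w e \<noteq> 0" using e t by simp
    have "v (e / t powi w e) = 0" using kx_unit[OF e] v.v_unit[OF _ ep] by simp
    then have "v e - v (t powi w e) = 0" using v.v_divide[of e "t powi w e"] e t by simp
    then show ?thesis using v.v_powi[of t "w e"] t v(2) by simp
  qed
  then show ?thesis using v(1) by blast
qed

end

sublocale curve_place \<subseteq> discrete_place emb UNIV Q
  by unfold_locales (use double_val in blast)

context curve_place
begin

abbreviation "v \<equiv> place_val UNIV Q"

text \<open>The doubled valuation has the value 2 at a uniformizer of K(x). So the factor that
  normalises it divides 2, and e is the complementary factor.\<close>

lemma ramification: "\<exists>e::int. (e = 1 \<or> e = 2) \<and> (\<forall>z\<in>Kx. z \<noteq> 0 \<longrightarrow> v z = e * w z)"
proof -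
  obtain u where u: "valued_place emb UNIV Q u" "\<And>z. z \<in> Kx \<Longrightarrow> z \<noteq> 0 \<Longrightarrow> u z = 2 * w z"
    using double_val by blast
  interpret u: valued_place emb UNIV Q u by (rule u(1))
  obtain t where t: "t \<noteq> 0" "v t = 1" and uv: "\<And>z. z \<noteq> 0 \<Longrightarrow> u z = u t * v z"
    using u.valued_place_place_val by (metis UNIV_I)
  have ut: "u t > 0" using v_P[of t] u.v_P[of t] t by simp
  obtain s where s: "s \<in> Kx" "s \<noteq> 0" "w s = 1" using R.ex_uniformizer by blast
  have us: "u t * v s = 2" using uv[OF s(2)] u(2)[OF s(1,2)] s(3) by simp
  then have "u t dvd 2" by (metis dvd_triv_left)
  then have "u t \<le> 2" by (rule zdvd_imp_le) simp
  then have *: "u t = 1 \<or> u t = 2" using ut by linarith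
  have "v z = v s * w z" if z: "z \<in> Kx" "z \<noteq> 0" for z
  proof -
    have "u t * v z = u t * (v s * w z)"
      using uv[OF z(2)] u(2)[OF z] us by (simp add: mult.assoc[symmetric])
    then show ?thesis using ut by simp
  qed
  moreover have "v s = 1 \<or> v s = 2" using * us by auto
  ultimately show ?thesis by blast
qed

text \<open>The rules for the slopes of the Newton polygon: the norm fixes the sum of the two
  values, and the trace fixes the smaller one when they differ.\<close>

lemma val_bar_facts:
  assumes "valued_place emb UNIV Q u" "z \<noteq> 0"
  shows "u z + u (bar z) = u (z * bar z)"
    "u z \<noteq> u (bar z) \<Longrightarrow> z + bar z \<noteq> 0 \<and> u (z + bar z) = min (u z) (u (bar z))"
    "z + bar z \<noteq> 0 \<Longrightarrow> u (z + bar z) \<ge> min (u z) (u (bar z))"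
proof -
  interpret u: valued_place emb UNIV Q u by (rule assms(1))
  have cz: "bar z \<noteq> 0" using assms by simp
  show "u z + u (bar z) = u (z * bar z)" using u.v_mult assms(2) cz by simp
  show "z + bar z \<noteq> 0 \<and> u (z + bar z) = min (u z) (u (bar z))" if ne: "u z \<noteq> u (bar z)"
  proof (cases "u z < u (bar z)")
    case True
    then show ?thesis using u.v_add_less[of z "bar z"] assms(2) by simp
  next
    case False
    then show ?thesis using u.v_add_less[of "bar z" z] cz ne by (simp add: add.commute)
  qed
  show "u (z + bar z) \<ge> min (u z) (u (bar z))" if "z + bar z \<noteq> 0"
    using u.v_add[of z "bar z"] that assms(2) cz by simp
qed

end

section \<open>Conjugation, places over a place of K(x), and principal divisors\<close>

context quadratic_extension
begin

lemma curve_place_I: "Q \<in> places emb UNIV \<Longrightarrow> curve_place emb x y f Q"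
  by unfold_locales auto

lemma place_eq_if_val_eq:
  assumes "valued_place emb UNIV Q v" "valued_place emb UNIV Q' v'" "\<And>z. z \<noteq> 0 \<Longrightarrow> v z = v' z"
  shows "Q = Q'"
proof -
  interpret v: valued_place emb UNIV Q v by (rule assms(1))
  interpret v': valued_place emb UNIV Q' v' by (rule assms(2))
  have "z \<in> Q \<longleftrightarrow> z \<in> Q'" for z
    using assms(3)[of z] v.v_P[of z] v'.v_P[of z] by (cases "z = 0") auto
  then show ?thesis by blast
qed

lemma bar_place:
  assumes "Q \<in> places emb UNIV"
  shows "bar -` Q \<in> places emb UNIV" "place_ring UNIV (bar -` Q) = bar -` place_ring UNIV Q"
proof -
  interpret curve_place emb x y f Q by (rule curve_place_I[OF assms])
  have "valuation_ring emb UNIV (bar -` A)"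
    unfolding valuation_ring_def
  proof (intro conjI ballI)
    obtain z where "z \<in> A" "z \<notin> range emb" using valuation_ring_A by (auto simp: valuation_ring_def)
    then have "bar z \<in> bar -` A" "bar z \<notin> range emb" by (auto, metis bar_bar bar_emb rangeI)
    then show "range emb \<subset> bar -` A" using A_emb by auto
    obtain z where "z \<notin> A" using A_proper by blast
    then have "bar z \<notin> bar -` A" by simp
    then show "bar -` A \<subset> UNIV" by blast
  next
    fix s t assume "s \<in> bar -` A" "t \<in> bar -` A"
    then show "s - t \<in> bar -` A" "s * t \<in> bar -` A"
      using A_diff A_mult by (auto simp: bar_diff bar_mult)
  next
    fix s
    show "s \<in> bar -` A \<or> inverse s \<in> bar -` A"
      using A_total[of "bar s"] by (auto simp: bar_inverse)
  qed
  moreover have "nonunits (bar -` A) = bar -` Q"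
    unfolding nonunits_def using P_iff by (auto simp: bar_inverse)
  ultimately show "bar -` Q \<in> places emb UNIV" "place_ring UNIV (bar -` Q) = bar -` A"
    using places_iff[of UNIV "bar -` Q"] place_ring_nonunits[of UNIV "bar -` A"] by auto
qed

text \<open>
  Over a fixed place of \<open>K(x)\<close> the values of \<open>z\<close> and its conjugate are the slopes of the Newton
  polygon of the quadratic equation of \<open>z\<close>, so another extension takes, for each \<open>z\<close>, one of these
  two values; since a group is not a union of two proper subgroups, the choice does not depend on \<open>z\<close>.
\<close>

lemma places_over:
  assumes "Q \<in> places emb UNIV" "Q' \<in> places emb UNIV" "Q \<inter> Kx = Q' \<inter> Kx"
  shows "Q' = Q \<or> Q' = bar -` Q"
proof -
  interpret Q: curve_place emb x y f Q by (rule curve_place_I[OF assms(1)])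
  interpret Q': curve_place emb x y f Q' by (rule curve_place_I[OF assms(2)])
  obtain v where v: "valued_place emb UNIV Q v" "\<And>e. e \<in> Kx \<Longrightarrow> e \<noteq> 0 \<Longrightarrow> v e = 2 * Q.w e"
    using Q.double_val by blast
  obtain v' where v': "valued_place emb UNIV Q' v'" "\<And>e. e \<in> Kx \<Longrightarrow> e \<noteq> 0 \<Longrightarrow> v' e = 2 * Q'.w e"
    using Q'.double_val by blast
  interpret v: valued_place emb UNIV Q v by (rule v(1))
  interpret v': valued_place emb UNIV Q' v' by (rule v'(1))
  have same: "v e = v' e" if "e \<in> Kx" "e \<noteq> 0" for e
    using v(2)[OF that] v'(2)[OF that] assms(3) by simp
  have alt: "v' z = v z \<or> v' z = v (bar z)" if z: "z \<noteq> 0" for z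
  proof -
    note F = Q.val_bar_facts[OF v(1) z]
    note F' = Q'.val_bar_facts[OF v'(1) z]
    have N: "v (z * bar z) = v' (z * bar z)" using same norm_Kx z by simp
    have T: "z + bar z \<noteq> 0 \<Longrightarrow> v (z + bar z) = v' (z + bar z)" using same trace_Kx by simp
    show ?thesis
    proof (cases "v z = v (bar z)"; cases "v' z = v' (bar z)")
      assume 1: "v z = v (bar z)" "v' z = v' (bar z)"
      then show ?thesis using F(1) F'(1) N by linarith
    next
      assume 1: "v z = v (bar z)" "v' z \<noteq> v' (bar z)"
      then show ?thesis using F(1) F'(1) F(3) F'(2)[OF 1(2)] N T by linarith
    next
      assume 1: "v z \<noteq> v (bar z)" "v' z = v' (bar z)"
      then show ?thesis using F(1) F'(1) F'(3) F(2)[OF 1(1)] N T by linarith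
    next
      assume 1: "v z \<noteq> v (bar z)" "v' z \<noteq> v' (bar z)"
      then show ?thesis using F(1) F'(1) F(2)[OF 1(1)] F'(2)[OF 1(2)] N T by linarith
    qed
  qed
  have "(\<forall>z. z \<noteq> 0 \<longrightarrow> v' z = v z) \<or> (\<forall>z. z \<noteq> 0 \<longrightarrow> v' z = v (bar z))"
  proof (rule ccontr)
    assume "\<not> ?thesis"
    then obtain a b where a: "a \<noteq> 0" "v' a \<noteq> v a" and b: "b \<noteq> 0" "v' b \<noteq> v (bar b)" by blast
    have a': "v' a = v (bar a)" using alt[OF a(1)] a(2) by simp
    have b': "v' b = v b" using alt[OF b(1)] b(2) by simp
    have "v' (a * b) = v' a + v' b" "v (a * b) = v a + v b" "v (bar (a * b)) = v (bar a) + v (bar b)"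
      using v.v_mult[of a b] v'.v_mult[of a b] v.v_mult[of "bar a" "bar b"] a(1) b(1)
      by (simp_all add: bar_mult)
    moreover have "a * b \<noteq> 0" using a b by simp
    ultimately show False using alt[of "a * b"] a b a' b' by linarith
  qed
  then show ?thesis
  proof
    assume "\<forall>z. z \<noteq> 0 \<longrightarrow> v' z = v z"
    then show ?thesis using place_eq_if_val_eq[OF v'(1) v(1)] by blast
  next
    assume *: "\<forall>z. z \<noteq> 0 \<longrightarrow> v' z = v (bar z)"
    have "z \<in> Q' \<longleftrightarrow> bar z \<in> Q" for z
      using *[rule_format, of z] v.v_P[of "bar z"] v'.v_P[of z] by (cases "z = 0") auto
    then show ?thesis by auto
  qed
qed

text \<open>A pole of a + b y is a pole of a, of b or of f(x), as y is regular wherever f(x) is; and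
  each place of K(x) has at most two places above it.\<close>

lemma finite_poles: "finite {Q \<in> places emb UNIV. z \<notin> place_ring UNIV Q}"
proof -
  have K: "finite {Q \<in> places emb UNIV. e \<notin> place_ring UNIV Q}" (is "finite ?S") if e: "e \<in> Kx" for e
  proof -
    have sub: "(\<lambda>Q. Q \<inter> Kx) ` ?S \<subseteq> {P \<in> places emb Kx. e \<notin> place_ring Kx P}"
    proof
      fix P assume "P \<in> (\<lambda>Q. Q \<inter> Kx) ` ?S"
      then obtain Q where Q: "Q \<in> places emb UNIV" "e \<notin> place_ring UNIV Q" "P = Q \<inter> Kx" by blast
      interpret Q: curve_place emb x y f Q by (rule curve_place_I[OF Q(1)])
      show "P \<in> {P \<in> places emb Kx. e \<notin> place_ring Kx P}"
        using Q.restrict_place Q.restrict_ring Q by simp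
    qed
    have fib: "finite {Q \<in> ?S. Q \<inter> Kx = P}" for P
    proof (cases "\<exists>Q0\<in>?S. Q0 \<inter> Kx = P")
      case True
      then obtain Q0 where Q0: "Q0 \<in> places emb UNIV" "Q0 \<inter> Kx = P" by blast
      have "{Q \<in> ?S. Q \<inter> Kx = P} \<subseteq> {Q0, bar -` Q0}"
        using places_over[OF Q0(1)] Q0(2) by blast
      then show ?thesis by (rule finite_subset) simp
    next
      case False
      then have "{Q \<in> ?S. Q \<inter> Kx = P} = {}" by blast
      then show ?thesis by (simp only: finite.emptyI)
    qed
    have "finite ((\<lambda>Q. Q \<inter> Kx) ` ?S)" using finite_subset[OF sub finite_poles_Kx[OF e]] .
    then have "finite (\<Union>P\<in>(\<lambda>Q. Q \<inter> Kx) ` ?S. {Q \<in> ?S. Q \<inter> Kx = P})" using fib by (rule finite_UN_I)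
    moreover have "?S \<subseteq> (\<Union>P\<in>(\<lambda>Q. Q \<inter> Kx) ` ?S. {Q \<in> ?S. Q \<inter> Kx = P})" by auto
    ultimately show ?thesis by (rule finite_subset[rotated])
  qed
  obtain a b where ab: "a \<in> Kx" "b \<in> Kx" "z = a + b * y" using repr_obtain by metis
  have "{Q \<in> places emb UNIV. z \<notin> place_ring UNIV Q} \<subseteq> {Q \<in> places emb UNIV. a \<notin> place_ring UNIV Q} \<union>
      {Q \<in> places emb UNIV. b \<notin> place_ring UNIV Q} \<union> {Q \<in> places emb UNIV. pv f \<notin> place_ring UNIV Q}"
  proof
    fix Q assume "Q \<in> {Q \<in> places emb UNIV. z \<notin> place_ring UNIV Q}"
    then have Q: "Q \<in> places emb UNIV" "z \<notin> place_ring UNIV Q" by auto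
    interpret Q: curve_place emb x y f Q by (rule curve_place_I[OF Q(1)])
    have "\<not> (a \<in> Q.A \<and> b \<in> Q.A \<and> y \<in> Q.A)"
      using Q(2) Q.A_add Q.A_mult unfolding ab(3) by blast
    moreover have "y \<in> Q.A" if "pv f \<in> Q.A"
      using Q.A_root[of y 2] that eqn by simp
    ultimately show "Q \<in> {Q \<in> places emb UNIV. a \<notin> place_ring UNIV Q} \<union>
      {Q \<in> places emb UNIV. b \<notin> place_ring UNIV Q} \<union> {Q \<in> places emb UNIV. pv f \<notin> place_ring UNIV Q}"
      using Q(1) by blast
  qed
  then show ?thesis by (rule finite_subset) (intro finite_UnI K ab pv_Kx)
qed

text \<open>\<open>pdiv\<close> goes through \<open>Abs_poly_mapping\<close>, so finite support has
  to be known first: zeros and poles of z are the poles of 1/z and of z.\<close>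

lemma lookup_pdiv:
  assumes "z \<noteq> 0"
  shows "Poly_Mapping.lookup (pdiv emb z) Q = (if Q \<in> places emb UNIV then place_val UNIV Q z else 0)"
proof -
  have "finite {Q. (if Q \<in> places emb UNIV then place_val UNIV Q z else 0) \<noteq> 0}"
  proof (rule finite_subset)
    show "{Q. (if Q \<in> places emb UNIV then place_val UNIV Q z else 0) \<noteq> 0} \<subseteq>
      {Q \<in> places emb UNIV. z \<notin> place_ring UNIV Q} \<union> {Q \<in> places emb UNIV. inverse z \<notin> place_ring UNIV Q}"
    proof
      fix Q assume "Q \<in> {Q. (if Q \<in> places emb UNIV then place_val UNIV Q z else 0) \<noteq> 0}"
      then have Q: "Q \<in> places emb UNIV" "place_val UNIV Q z \<noteq> 0" by (auto split: if_splits)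
      interpret Q: curve_place emb x y f Q by (rule curve_place_I[OF Q(1)])
      have "z \<notin> Q.A \<or> inverse z \<notin> Q.A"
        using Q.v_A[of z] Q.v_A[of "inverse z"] Q.v_inverse[of z] assms Q(2) by auto
      then show "Q \<in> {Q \<in> places emb UNIV. z \<notin> place_ring UNIV Q} \<union>
          {Q \<in> places emb UNIV. inverse z \<notin> place_ring UNIV Q}" using Q(1) by blast
    qed
  qed (intro finite_UnI finite_poles)
  then show ?thesis unfolding pdiv_def by (subst Abs_poly_mapping_inverse) auto
qed

lemma pdiv_mult: "z \<noteq> 0 \<Longrightarrow> z' \<noteq> 0 \<Longrightarrow> pdiv emb (z * z') = pdiv emb z + pdiv emb z'"
proof (rule poly_mapping_eqI)
  fix Q assume z: "z \<noteq> 0" "z' \<noteq> 0"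
  show "Poly_Mapping.lookup (pdiv emb (z * z')) Q = Poly_Mapping.lookup (pdiv emb z + pdiv emb z') Q"
  proof (cases "Q \<in> places emb UNIV")
    case True
    interpret Q: curve_place emb x y f Q by (rule curve_place_I[OF True])
    show ?thesis using z Q.v_mult[of z z'] True by (simp add: lookup_pdiv lookup_add)
  qed (use z in \<open>simp add: lookup_pdiv lookup_add\<close>)
qed

lemma pdiv_1 [simp]: "pdiv emb 1 = 0"
  using pdiv_mult[of 1 1] by simp

lemma pdiv_inverse: "z \<noteq> 0 \<Longrightarrow> pdiv emb (inverse z) = - pdiv emb z"
  using pdiv_mult[of z "inverse z"] by (simp add: eq_neg_iff_add_eq_0 add.commute)

lemma pdiv_divide: "z \<noteq> 0 \<Longrightarrow> z' \<noteq> 0 \<Longrightarrow> pdiv emb (z / z') = pdiv emb z - pdiv emb z'"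
  by (simp add: divide_inverse pdiv_mult pdiv_inverse)

lemma pdiv_divisors: "z \<noteq> 0 \<Longrightarrow> pdiv emb z \<in> divisors emb"
  unfolding divisors_def by (auto simp: in_keys_iff lookup_pdiv split: if_splits)

end

section \<open>Linear functions on the group of divisors\<close>

definition frag_sum :: "('a \<Rightarrow> 'b::comm_ring_1) \<Rightarrow> ('a \<Rightarrow>\<^sub>0 int) \<Rightarrow> 'b" where
  "frag_sum h A = (\<Sum>P\<in>Poly_Mapping.keys A. of_int (Poly_Mapping.lookup A P) * h P)"

lemma frag_sum_superset:
  assumes "finite S" "Poly_Mapping.keys A \<subseteq> S"
  shows "frag_sum h A = (\<Sum>P\<in>S. of_int (Poly_Mapping.lookup A P) * h P)"
  unfolding frag_sum_def using assms by (intro sum.mono_neutral_left) (auto simp: in_keys_iff)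

lemma frag_sum_0 [simp]: "frag_sum h 0 = 0"
  by (simp add: frag_sum_def)

lemma frag_sum_add: "frag_sum h (A + B) = frag_sum h A + frag_sum h B"
proof -
  define S where "S = Poly_Mapping.keys A \<union> Poly_Mapping.keys B"
  have "finite S" "Poly_Mapping.keys A \<subseteq> S" "Poly_Mapping.keys B \<subseteq> S" "Poly_Mapping.keys (A + B) \<subseteq> S"
    using Poly_Mapping.keys_add[of A B] by (auto simp: S_def)
  then show ?thesis
    by (simp add: frag_sum_superset[of S] lookup_add algebra_simps flip: sum.distrib)
qed

lemma frag_sum_uminus: "frag_sum h (- A) = - frag_sum h A"
  using frag_sum_add[of h A "- A"] by (simp add: eq_neg_iff_add_eq_0 add.commute)

lemma frag_sum_diff: "frag_sum h (A - B) = frag_sum h A - frag_sum h B"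
  using frag_sum_add[of h A "- B"] by (simp add: frag_sum_uminus)

lemma frag_sum_of [simp]: "frag_sum h (frag_of P) = h P"
  by (simp add: frag_sum_def)

lemma frag_sum_cmul: "frag_sum h (frag_cmul c A) = of_int c * frag_sum h A"
  using frag_sum_superset[of "Poly_Mapping.keys A" "frag_cmul c A" h]
  by (simp add: frag_sum_def keys_cmul sum_distrib_left mult.assoc)

lemma frag_sum_sum: "frag_sum h (sum A I) = (\<Sum>i\<in>I. frag_sum h (A i))"
  by (induction I rule: infinite_finite_induct) (simp_all add: frag_sum_add)

lemma lookup_sum_pairs_pos:
  assumes "finite I" "i \<in> I" "T = a i \<or> T = b i"
  shows "0 < Poly_Mapping.lookup (\<Sum>i\<in>I. frag_of (a i) + frag_of (b i)) T"
proof -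
  have "0 < Poly_Mapping.lookup (frag_of (a i) + frag_of (b i)) T"
    using assms(3) by (auto simp: lookup_add)
  also have "\<dots> \<le> (\<Sum>i\<in>I. Poly_Mapping.lookup (frag_of (a i) + frag_of (b i)) T)"
    by (rule member_le_sum[OF assms(2)]) (auto simp: lookup_add assms(1))
  finally show ?thesis unfolding lookup_sum .
qed

lemma div_degree_eq: "div_degree emb A = frag_sum (\<lambda>P. int (place_degree emb UNIV P)) A"
  by (simp add: div_degree_def frag_sum_def)

section \<open>Degrees of places\<close>

locale place_over_finite_field = place emb E P for emb :: "'k::{field,finite} \<Rightarrow> 'f::field" and E P
begin

definition spans_residues :: "'f set \<Rightarrow> bool" where
  "spans_residues B \<longleftrightarrow> finite B \<and> B \<subseteq> A \<and> (\<forall>z\<in>A. \<exists>c. z - (\<Sum>b\<in>B. emb (c b) * b) \<in> P)"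

definition residue_basis :: "'f set \<Rightarrow> bool" where
  "residue_basis B \<longleftrightarrow> finite B \<and> B \<subseteq> A \<and>
     (\<forall>z\<in>A. \<exists>!c. (\<forall>b. b \<notin> B \<longrightarrow> c b = 0) \<and> z - (\<Sum>b\<in>B. emb (c b) * b) \<in> P)"

text \<open>\<open>residue_basis\<close> is the property behind \<open>place_degree\<close>: linear
  algebra in A/P on the level of representatives. A relation modulo P in which b0 occurs would allow
  b0 to be dropped, by subtracting the multiple of it that cancels the coefficient of b0.\<close>

lemma minimal_spanning_set_basis:
  assumes B: "spans_residues B" and min: "\<And>B'. spans_residues B' \<Longrightarrow> card B \<le> card B'"
  shows "residue_basis B"
proof -
  have fin: "finite B" "B \<subseteq> A" and sp: "\<And>z. z \<in> A \<Longrightarrow> \<exists>c. z - (\<Sum>b\<in>B. emb (c b) * b) \<in> P"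
    using B by (auto simp: spans_residues_def)
  have indep: "d b0 = 0" if d: "(\<Sum>b\<in>B. emb (d b) * b) \<in> P" and b0: "b0 \<in> B" for d b0
  proof (rule ccontr)
    assume nz: "d b0 \<noteq> 0"
    have "spans_residues (B - {b0})"
      unfolding spans_residues_def
    proof (intro conjI ballI)
      fix z assume "z \<in> A"
      then obtain c where c: "z - (\<Sum>b\<in>B. emb (c b) * b) \<in> P" using sp by blast
      define k where "k = c b0 / d b0"
      have "(z - (\<Sum>b\<in>B. emb (c b) * b)) + emb k * (\<Sum>b\<in>B. emb (d b) * b) \<in> P"
        by (rule P_add[OF c P_mult[OF A_emb d]])
      moreover have "(z - (\<Sum>b\<in>B. emb (c b) * b)) + emb k * (\<Sum>b\<in>B. emb (d b) * b) =
          z - (\<Sum>b\<in>B. emb (c b - k * d b) * b)"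
        by (simp add: hom_minus hom_mult sum_distrib_left sum_subtractf algebra_simps)
      moreover have "(\<Sum>b\<in>B. emb (c b - k * d b) * b) = (\<Sum>b\<in>B - {b0}. emb (c b - k * d b) * b)"
        using nz by (subst sum.remove[OF fin(1) b0]) (simp add: k_def)
      ultimately have "z - (\<Sum>b\<in>B - {b0}. emb (c b - k * d b) * b) \<in> P" by (simp only:)
      then show "\<exists>c. z - (\<Sum>b\<in>B - {b0}. emb (c b) * b) \<in> P" by (intro exI[of _ "\<lambda>b. c b - k * d b"])
    qed (use fin in auto)
    then have "card B \<le> card (B - {b0})" by (rule min)
    moreover have "card (B - {b0}) < card B" using fin(1) b0 by (rule card_Diff1_less)
    ultimately show False by simp
  qed
  show ?thesis
    unfolding residue_basis_def
  proof (intro conjI ballI)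
    fix z assume "z \<in> A"
    then obtain c where c: "z - (\<Sum>b\<in>B. emb (c b) * b) \<in> P" using sp by blast
    show "\<exists>!c. (\<forall>b. b \<notin> B \<longrightarrow> c b = 0) \<and> z - (\<Sum>b\<in>B. emb (c b) * b) \<in> P"
    proof (rule ex1I[of _ "\<lambda>b. if b \<in> B then c b else 0"])
      have "(\<Sum>b\<in>B. emb (if b \<in> B then c b else 0) * b) = (\<Sum>b\<in>B. emb (c b) * b)"
        by (rule sum.cong) auto
      then show "(\<forall>b. b \<notin> B \<longrightarrow> (if b \<in> B then c b else 0) = 0) \<and>
          z - (\<Sum>b\<in>B. emb (if b \<in> B then c b else 0) * b) \<in> P" using c by simp
    next
      fix c' assume c': "(\<forall>b. b \<notin> B \<longrightarrow> c' b = 0) \<and> z - (\<Sum>b\<in>B. emb (c' b) * b) \<in> P"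
      have "(z - (\<Sum>b\<in>B. emb (c b) * b)) - (z - (\<Sum>b\<in>B. emb (c' b) * b)) \<in> P"
        using c c' P_diff by blast
      then have "(\<Sum>b\<in>B. emb (c' b - c b) * b) \<in> P"
        by (simp add: hom_minus sum_subtractf left_diff_distrib)
      then have eq: "c' b = c b" if "b \<in> B" for b using indep[OF _ that, of "\<lambda>b. c' b - c b"] by simp
      show "c' = (\<lambda>b. if b \<in> B then c b else 0)"
        by (rule ext) (use eq c' in auto)
    qed
  qed (use fin in auto)
qed

lemma residue_basis_exists:
  assumes finite_residue
  shows "\<exists>B. residue_basis B"
proof -
  obtain C where C: "finite C" "C \<subseteq> A" "\<And>z. z \<in> A \<Longrightarrow> \<exists>c\<in>C. z - c \<in> P"
    using assms unfolding finite_residue_def by blast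
  have "spans_residues C"
    unfolding spans_residues_def
  proof (intro conjI ballI)
    fix z assume "z \<in> A"
    then obtain s where s: "s \<in> C" "z - s \<in> P" using C(3) by blast
    have "(\<Sum>b\<in>C. emb (if b = s then 1 else 0) * b) = (\<Sum>b\<in>C. if b = s then b else 0)"
      by (rule sum.cong) auto
    also have "\<dots> = s" using s C(1) by simp
    finally show "\<exists>c. z - (\<Sum>b\<in>C. emb (c b) * b) \<in> P"
      using s(2) by (intro exI[of _ "\<lambda>b. if b = s then 1 else 0"]) simp
  qed (use C in auto)
  then obtain B where "spans_residues B" "\<forall>B'. spans_residues B' \<longrightarrow> card B \<le> card B'"
    using ex_has_least_nat[of spans_residues C card] by blast
  then show ?thesis using minimal_spanning_set_basis by blast
qed

lemma card_finite_support:
  assumes "finite B"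
  shows "finite {c :: 'f \<Rightarrow> 'k. \<forall>b. b \<notin> B \<longrightarrow> c b = 0}"
    "card {c :: 'f \<Rightarrow> 'k. \<forall>b. b \<notin> B \<longrightarrow> c b = 0} = card (UNIV :: 'k set) ^ card B"
proof -
  have "bij_betw (\<lambda>c. restrict c B) {c :: 'f \<Rightarrow> 'k. \<forall>b. b \<notin> B \<longrightarrow> c b = 0} (B \<rightarrow>\<^sub>E UNIV)"
  proof (rule bij_betwI[where g = "\<lambda>c b. if b \<in> B then c b else 0"])
    show "(\<lambda>b. if b \<in> B then restrict c B b else 0) = c" 
      if "c \<in> {c :: 'f \<Rightarrow> 'k. \<forall>b. b \<notin> B \<longrightarrow> c b = 0}" for c
      using that by auto
    show "restrict (\<lambda>b. if b \<in> B then c b else 0) B = c" if "c \<in> B \<rightarrow>\<^sub>E (UNIV :: 'k set)" for c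
      using that by (auto simp: restrict_def PiE_def extensional_def)
  qed auto
  note bij = this
  have "finite (B \<rightarrow>\<^sub>E (UNIV :: 'k set))" using assms by (intro finite_PiE) auto
  moreover have "card (B \<rightarrow>\<^sub>E (UNIV :: 'k set)) = card (UNIV :: 'k set) ^ card B"
    using assms by (simp add: card_PiE)
  ultimately show "finite {c :: 'f \<Rightarrow> 'k. \<forall>b. b \<notin> B \<longrightarrow> c b = 0}"
    "card {c :: 'f \<Rightarrow> 'k. \<forall>b. b \<notin> B \<longrightarrow> c b = 0} = card (UNIV :: 'k set) ^ card B"
    using bij_betw_finite[OF bij] bij_betw_same_card[OF bij] by simp_all
qed

lemma card_field_gt_1: "card (UNIV :: 'k set) > 1"
proof -
  have "card {0, 1 :: 'k} \<le> card (UNIV :: 'k set)" by (rule card_mono) auto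
  then show ?thesis by simp
qed

lemma residue_basisD:
  "residue_basis B \<Longrightarrow> z \<in> A \<Longrightarrow>
    \<exists>!c. (\<forall>b. b \<notin> B \<longrightarrow> c b = 0) \<and> z - (\<Sum>b\<in>B. emb (c b) * b) \<in> P"
  by (simp add: residue_basis_def)

text \<open>Counting residue classes: different coefficient families over B represent different
  classes, and every class has coefficients over B', so q^(card B) \<le> q^(card B'). Used in both
  directions it makes the \<open>THE d\<close> in \<open>place_degree\<close> well defined.\<close>

lemma residue_basis_card_le:
  assumes B: "residue_basis B" and B': "residue_basis B'"
  shows "card B \<le> card B'"
proof -
  let ?S = "\<lambda>B. {c :: 'f \<Rightarrow> 'k. \<forall>b. b \<notin> B \<longrightarrow> c b = 0}"
  let ?v = "\<lambda>B c. \<Sum>b\<in>B. emb (c b) * b"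
  have fin: "finite B" "B \<subseteq> A" "finite B'" using B B' by (auto simp: residue_basis_def)
  have vA: "?v B c \<in> A" for c using fin(2) A_emb by (intro A_sum A_mult) auto
  have "\<exists>c'. c' \<in> ?S B' \<and> ?v B c - ?v B' c' \<in> P" for c
    using ex1_implies_ex[OF residue_basisD[OF B' vA[of c]]] by simp
  then have "\<forall>c. \<exists>c'. c' \<in> ?S B' \<and> ?v B c - ?v B' c' \<in> P" by (rule allI)
  from choice[OF this] obtain h where "\<forall>c. h c \<in> ?S B' \<and> ?v B c - ?v B' (h c) \<in> P" ..
  then have h: "\<And>c. h c \<in> ?S B'" "\<And>c. ?v B c - ?v B' (h c) \<in> P" by simp_all
  have "inj_on h (?S B)"
  proof
    fix c1 c2 assume c: "c1 \<in> ?S B" "c2 \<in> ?S B" "h c1 = h c2"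
    have "(?v B c1 - ?v B' (h c1)) - (?v B c2 - ?v B' (h c2)) \<in> P" by (rule P_diff[OF h(2) h(2)])
    then have 2: "?v B c1 - ?v B c2 \<in> P" using c(3) by simp
    have 1: "?v B c1 - ?v B c1 \<in> P" by simp
    note the = the1_equality[OF residue_basisD[OF B vA[of c1]]]
    show "c1 = c2" using the[of c1] the[of c2] c(1,2) 1 2 by simp
  qed
  then have "card (?S B) \<le> card (?S B')"
    by (rule card_inj_on_le) (use h(1) card_finite_support[OF fin(3)] in auto)
  then have "card (UNIV :: 'k set) ^ card B \<le> card (UNIV :: 'k set) ^ card B'"
    using card_finite_support fin by simp
  then show ?thesis using card_field_gt_1 by simp
qed

lemma place_degree_eq_card:
  assumes "residue_basis B"
  shows "place_degree emb E P = card B"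
  unfolding place_degree_def
proof (rule the_equality)
  show "\<exists>B'. finite B' \<and> card B' = card B \<and> B' \<subseteq> A \<and>
     (\<forall>z\<in>A. \<exists>!c. (\<forall>b. b \<notin> B' \<longrightarrow> c b = 0) \<and> z - (\<Sum>b\<in>B'. emb (c b) * b) \<in> P)"
    using assms unfolding residue_basis_def by blast
next
  fix d assume "\<exists>B'. finite B' \<and> card B' = d \<and> B' \<subseteq> A \<and>
     (\<forall>z\<in>A. \<exists>!c. (\<forall>b. b \<notin> B' \<longrightarrow> c b = 0) \<and> z - (\<Sum>b\<in>B'. emb (c b) * b) \<in> P)"
  then obtain B' where "residue_basis B'" "card B' = d" unfolding residue_basis_def by blast
  then show "d = card B" using residue_basis_card_le[OF assms] residue_basis_card_le[OF _ assms] by force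
qed

lemma place_degree_pos:
  assumes finite_residue
  shows "place_degree emb E P > 0"
proof -
  obtain B where B: "residue_basis B" using residue_basis_exists[OF assms] by blast
  then have "finite B" "\<exists>c. 1 - (\<Sum>b\<in>B. emb (c b) * b) \<in> P"
    using ex1_implies_ex[OF residue_basisD[OF B A_1]] by (auto simp: residue_basis_def)
  then have "B \<noteq> {}" by auto
  then show ?thesis using place_degree_eq_card[OF B] \<open>finite B\<close> by (simp add: card_gt_0_iff)
qed

lemma degree_one_residue:
  assumes finite_residue "place_degree emb E P = 1" "z \<in> A"
  shows "\<exists>c. z - emb c \<in> P"
proof -
  obtain B where B: "residue_basis B" using residue_basis_exists[OF assms(1)] by blast
  have "card B = 1" using place_degree_eq_card[OF B] assms(2) by simp
  then obtain b where b: "B = {b}" by (rule card_1_singletonE)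
  have ex: "\<exists>c. s - emb c * b \<in> P" if "s \<in> A" for s
  proof -
    have "\<exists>c. s - (\<Sum>b\<in>B. emb (c b) * b) \<in> P"
      using ex1_implies_ex[OF residue_basisD[OF B that]] by auto
    then show ?thesis using b by auto
  qed
  obtain c1 where c1: "1 - emb c1 * b \<in> P" using ex[OF A_1] by blast
  obtain c where c: "z - emb c * b \<in> P" using ex[OF assms(3)] by blast
  have "c1 \<noteq> 0" using c1 by auto
  \<comment> \<open>The basis element b need not be 1. Dividing by the coordinate c1 of 1 turns the
    coordinate c of z into its residue.\<close>
  then have eq: "(z - emb c * b) - emb (c / c1) * (1 - emb c1 * b) = z - emb (c / c1)"
    by (simp add: right_diff_distrib mult.assoc[symmetric] flip: hom_mult)
  have "(z - emb c * b) - emb (c / c1) * (1 - emb c1 * b) \<in> P"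
    by (rule P_diff[OF c P_mult[OF A_emb c1]])
  then show ?thesis unfolding eq by blast
qed

lemma residue_unique: "z - emb c \<in> P \<Longrightarrow> z - emb c' \<in> P \<Longrightarrow> c = c'"
  using P_diff[of "z - emb c" "z - emb c'"] emb_P_iff[of "c' - c"] by (simp add: hom_minus)

lemma place_degree_one:
  assumes "\<And>z. z \<in> A \<Longrightarrow> \<exists>c. z - emb c \<in> P"
  shows "place_degree emb E P = 1"
proof -
  have "residue_basis {1}"
    unfolding residue_basis_def
  proof (intro conjI ballI)
    fix z assume "z \<in> A"
    then obtain c where c: "z - emb c \<in> P" using assms by blast
    show "\<exists>!c. (\<forall>b. b \<notin> {1} \<longrightarrow> c b = 0) \<and> z - (\<Sum>b\<in>{1}. emb (c b) * b) \<in> P"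
    proof (rule ex1I[of _ "\<lambda>b. if b = 1 then c else 0"])
      fix c' assume *: "(\<forall>b. b \<notin> {1} \<longrightarrow> c' b = 0) \<and> z - (\<Sum>b\<in>{1}. emb (c' b) * b) \<in> P"
      then have "c' 1 = c" using residue_unique[OF _ c] by simp
      then show "c' = (\<lambda>b. if b = 1 then c else 0)" using * by auto
    qed (use c in simp)
  qed auto
  then show ?thesis using place_degree_eq_card by force
qed

end

sublocale rational_place \<subseteq> place_over_finite_field emb "adjoin emb {x}" P
  by unfold_locales

sublocale curve_place \<subseteq> place_over_finite_field emb UNIV Q
  by unfold_locales

context curve_place
begin

text \<open>The equation N - T z + z^2 = 0 is divided by whichever of its coefficients 1, T, N has
  the worst pole; then all coefficients are regular and one of them is a unit.\<close>

lemma quadratic_residue_equation: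
  assumes z: "z \<in> A"
  shows "\<exists>c0 c1 c2. {c0, c1, c2} \<subseteq> A \<inter> Kx \<and> \<not> {c0, c1, c2} \<subseteq> Q \<and> c0 + c1 * z + c2 * z ^ 2 = 0"
proof -
  define T where "T = z + bar z"
  define N where "N = z * bar z"
  have K: "T \<in> Kx" "N \<in> Kx" using trace_Kx norm_Kx by (auto simp: T_def N_def)
  have eq: "N - T * z + z ^ 2 = 0"
    using quadratic_equation[of z] by (simp add: T_def N_def)
  consider "T \<in> A" "N \<in> A" | "T \<notin> A" "N \<in> A" | "N \<notin> A" "T / N \<in> A" | "N \<notin> A" "T / N \<notin> A" by blast
  then show ?thesis
  proof cases
    case 1
    then show ?thesis using eq K Kx_closed(2,6) A_uminus
      by (intro exI[of _ N] exI[of _ "- T"] exI[of _ 1]) auto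
  next
    case 2
    then have T: "T \<noteq> 0" "inverse T \<in> Q" using not_A[of T] by auto
    have "N / T \<in> A" using A_mult[OF 2(2) P_in_A[OF T(2)]] by (simp add: divide_inverse)
    moreover have "N / T + (- 1) * z + inverse T * z ^ 2 = inverse T * (N - T * z + z ^ 2)"
      using T by (simp add: field_simps)
    ultimately show ?thesis using eq K Kx_closed T P_in_A A_uminus[OF A_1]
      by (intro exI[of _ "N / T"] exI[of _ "- 1"] exI[of _ "inverse T"]) simp
  next
    case 3
    then have N: "N \<noteq> 0" "inverse N \<in> Q" using not_A[of N] by auto
    have "1 + (- (T / N)) * z + inverse N * z ^ 2 = inverse N * (N - T * z + z ^ 2)"
      using N by (simp add: field_simps)
    then show ?thesis using eq K Kx_closed N P_in_A 3 A_uminus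
      by (intro exI[of _ 1] exI[of _ "- (T / N)"] exI[of _ "inverse N"]) simp
  next
    case 4
    then have N: "N \<noteq> 0" "inverse N \<in> Q" using not_A[of N] by auto
    have TN: "T / N \<noteq> 0" "inverse (T / N) \<in> Q" using not_A[of "T / N"] 4 by auto
    then have T: "T \<noteq> 0" by auto
    have "N / T \<in> A" using P_in_A[OF TN(2)] by simp
    have "inverse T = inverse N * (N / T)" using T N by (simp add: field_simps)
    moreover have "inverse N * (N / T) \<in> A" by (rule A_mult[OF P_in_A[OF N(2)] \<open>N / T \<in> A\<close>])
    ultimately have "inverse T \<in> A" by metis
    have "N / T + (- 1) * z + inverse T * z ^ 2 = inverse T * (N - T * z + z ^ 2)"
      using T by (simp add: field_simps)
    then have "N / T + (- 1) * z + inverse T * z ^ 2 = 0" by (simp only: eq mult_zero_right)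
    moreover have "{N / T, - 1, inverse T} \<subseteq> A \<inter> Kx"
      using \<open>N / T \<in> A\<close> \<open>inverse T \<in> A\<close> A_uminus[OF A_1] K Kx_closed(2,5,6,8) by simp
    moreover have "\<not> {N / T, - 1, inverse T} \<subseteq> Q" by simp
    ultimately show ?thesis
      by (intro exI[of _ "N / T"] exI[of _ "- 1"] exI[of _ "inverse T"] conjI)
  qed
qed

text \<open>A nonzero polynomial of degree at most 2 has at most two roots in the residue field. A
  third root would put c2, then c1, then c0 into Q.\<close>

lemma quadratic_residues:
  assumes "c0 \<in> A" "c1 \<in> A" "c2 \<in> A" "\<not> {c0, c1, c2} \<subseteq> Q"
  shows "\<exists>R. finite R \<and> R \<subseteq> A \<and> (\<forall>z\<in>A. c0 + c1 * z + c2 * z ^ 2 \<in> Q \<longrightarrow> (\<exists>r\<in>R. z - r \<in> Q))"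
proof -
  let ?h = "\<lambda>z. c0 + c1 * z + c2 * z ^ 2"
  \<comment> \<open>The divided difference of \<open>?h\<close>: it vanishes modulo Q at two roots
    that are different modulo Q.\<close>
  have slope: "c1 + c2 * (z + r) \<in> Q" if "z \<in> A" "r \<in> A" "?h z \<in> Q" "?h r \<in> Q" "z - r \<notin> Q" for z r
  proof -
    have "?h z - ?h r \<in> Q" using that P_diff by blast
    moreover have "?h z - ?h r = (z - r) * (c1 + c2 * (z + r))"
      by (simp add: algebra_simps power2_eq_square)
    ultimately have "(z - r) * (c1 + c2 * (z + r)) \<in> Q" by (simp only:)
    then have "z - r \<in> Q \<or> c1 + c2 * (z + r) \<in> Q"
      by (rule P_prime) (intro A_diff A_add A_mult assms that)+
    then show ?thesis using that(5) by blast
  qed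
  show ?thesis
  proof (cases "\<exists>r1 r2. r1 \<in> A \<and> r2 \<in> A \<and> ?h r1 \<in> Q \<and> ?h r2 \<in> Q \<and> r2 - r1 \<notin> Q")
    case True
    then obtain r1 r2 where r: "r1 \<in> A" "r2 \<in> A" "?h r1 \<in> Q" "?h r2 \<in> Q" "r2 - r1 \<notin> Q" by blast
    have "z - r1 \<in> Q \<or> z - r2 \<in> Q" if z: "z \<in> A" "?h z \<in> Q" for z
    proof (rule ccontr)
      assume n: "\<not> ?thesis"
      have s2: "c1 + c2 * (r2 + r1) \<in> Q" by (rule slope[OF r(2,1,4,3,5)])
      have "c1 + c2 * (z + r1) \<in> Q" by (rule slope[OF z(1) r(1) z(2) r(3)]) (use n in blast)
      from P_diff[OF this s2] have "c2 * (z - r2) \<in> Q" by (simp add: algebra_simps)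
      then have c2: "c2 \<in> Q" using P_prime[of c2 "z - r2"] n assms(3) A_diff[OF z(1) r(2)] by blast
      have c1: "c1 \<in> Q"
        using P_diff[OF s2 P_mult2[OF c2 A_add[OF r(2,1)]]] by simp
      have "c1 * r1 + c2 * r1 ^ 2 \<in> Q" using c1 c2 r(1) A_power by (intro P_add P_mult2)
      from P_diff[OF r(3) this] have "c0 \<in> Q" by simp
      then show False using c1 c2 assms(4) by simp
    qed
    then show ?thesis using r by (intro exI[of _ "{r1, r2}"]) auto
  next
    case False
    show ?thesis
    proof (cases "\<exists>r1\<in>A. ?h r1 \<in> Q")
      case True
      then obtain r1 where "r1 \<in> A" "?h r1 \<in> Q" by blast
      then show ?thesis using False by (intro exI[of _ "{r1}"]) auto
    qed (intro exI[of _ "{}"], auto)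
  qed
qed

text \<open>The residue field of the place below is finite, so only finitely many quadratic
  equations occur modulo Q, and every residue is a root of one of them.\<close>

lemma finite_residue_Q: finite_residue
proof -
  obtain C where C: "finite C" "C \<subseteq> A \<inter> Kx" "\<And>z. z \<in> A \<inter> Kx \<Longrightarrow> \<exists>c\<in>C. z - c \<in> Q \<inter> Kx"
    using R.finite_residue_P unfolding R.finite_residue_def restrict_ring by blast
  define M where "M = {(c0, c1, c2) \<in> C \<times> C \<times> C. \<not> {c0, c1, c2} \<subseteq> Q}"
  define good where "good t R \<longleftrightarrow> (case t of (c0, c1, c2) \<Rightarrow> finite R \<and> R \<subseteq> A \<and>
    (\<forall>z\<in>A. c0 + c1 * z + c2 * z ^ 2 \<in> Q \<longrightarrow> (\<exists>r\<in>R. z - r \<in> Q)))" for t R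
  have "M \<subseteq> C \<times> C \<times> C" by (auto simp: M_def)
  then have "finite M" by (rule finite_subset) (intro finite_cartesian_product C(1))
  have "\<exists>R. good t R" if t: "t \<in> M" for t
  proof -
    obtain c0 c1 c2 where c: "t = (c0, c1, c2)" using prod_cases3 by blast
    then have "c0 \<in> A" "c1 \<in> A" "c2 \<in> A" "\<not> {c0, c1, c2} \<subseteq> Q" using t C(2) unfolding M_def by blast+
    then show ?thesis using quadratic_residues unfolding good_def c by simp
  qed
  then obtain Rf where Rf: "\<And>t. t \<in> M \<Longrightarrow> good t (Rf t)" by metis
  show ?thesis
    unfolding finite_residue_def
  proof (intro exI conjI ballI)
    show "finite (\<Union>t\<in>M. Rf t)" using \<open>finite M\<close> Rf by (auto simp: good_def)
    show "(\<Union>t\<in>M. Rf t) \<subseteq> A" using Rf by (fastforce simp: good_def)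
  next
    fix z assume z: "z \<in> A"
    obtain d0 d1 d2 where d: "{d0, d1, d2} \<subseteq> A \<inter> Kx" "\<not> {d0, d1, d2} \<subseteq> Q" "d0 + d1 * z + d2 * z ^ 2 = 0"
      using quadratic_residue_equation[OF z] by blast
    obtain c0 c1 c2 where c: "c0 \<in> C" "d0 - c0 \<in> Q" "c1 \<in> C" "d1 - c1 \<in> Q" "c2 \<in> C" "d2 - c2 \<in> Q"
      using C(3)[of d0] C(3)[of d1] C(3)[of d2] d(1) by blast
    have t: "(c0, c1, c2) \<in> M"
      using c d(2) P_add[OF c(2), of c0] P_add[OF c(4), of c1] P_add[OF c(6), of c2] by (auto simp: M_def)
    have "(d0 - c0) + (d1 - c1) * z + (d2 - c2) * z ^ 2 \<in> Q"
      using c z A_power by (intro P_add P_mult2)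
    moreover have "(d0 - c0) + (d1 - c1) * z + (d2 - c2) * z ^ 2 =
        (d0 + d1 * z + d2 * z ^ 2) - (c0 + c1 * z + c2 * z ^ 2)" by (simp add: algebra_simps)
    ultimately have "- (c0 + c1 * z + c2 * z ^ 2) \<in> Q" by (simp only: d(3) diff_0)
    then have "c0 + c1 * z + c2 * z ^ 2 \<in> Q" by (simp only: P_uminus_iff)
    then have "\<exists>r\<in>Rf (c0, c1, c2). z - r \<in> Q" using Rf[OF t] z by (simp add: good_def)
    then show "\<exists>r\<in>(\<Union>t\<in>M. Rf t). z - r \<in> Q" using t by blast
  qed
qed

lemma degree_pos: "place_degree emb UNIV Q > 0"
  by (rule place_degree_pos[OF finite_residue_Q])

end

section \<open>Riemann-Roch spaces\<close>

context const_field
begin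

lemma vector_space_F: "vector_space (\<lambda>c z. emb c * z)"
  by unfold_locales (simp_all add: hom_add hom_mult algebra_simps)

lemma dim_mult:
  assumes "s \<noteq> 0"
  shows "vector_space.dim (\<lambda>c z. emb c * z) ((*) s ` V) = vector_space.dim (\<lambda>c z. emb c * z) V"
proof -
  interpret V: vector_space "\<lambda>c z. emb c * z" by (rule vector_space_F)
  interpret h: module_hom "\<lambda>c z. emb c * z" "\<lambda>c z. emb c * z" "(*) s"
    by unfold_locales (simp_all add: algebra_simps)
  obtain B where B: "B \<subseteq> V" "V.independent B" "V \<subseteq> V.span B" "card B = V.dim V"
    by (rule V.basis_exists)
  have sp: "V.span B = V.span V"
    using V.span_mono[OF B(1)] V.span_minimal[OF B(3) V.subspace_span] by blast
  have inj: "inj_on ((*) s) S" for S using assms by (auto intro: inj_onI)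
  have "V.span ((*) s ` B) = V.span ((*) s ` V)" by (simp only: h.span_image sp)
  moreover have "V.independent ((*) s ` B)" using h.independent_injective_image[OF B(2) inj] .
  ultimately have "V.dim ((*) s ` V) = card ((*) s ` B)" by (rule V.dim_eq_card)
  then show ?thesis using B(4) card_image[OF inj] by simp
qed

end

text \<open>The passage from dimensions, in which the genus is expressed, to cardinalities, by which
  the codes are compared.\<close>

lemma (in const_field) card_ge_power_dim:
  fixes V :: "'f set"
  assumes sub: "\<And>c z w. z \<in> V \<Longrightarrow> w \<in> V \<Longrightarrow> emb c * z + w \<in> V" "0 \<in> V" and fin: "finite V"
  shows "card (UNIV :: 'k set) ^ vector_space.dim (\<lambda>c z. emb c * z) V \<le> card V"
proof -
  interpret V: vector_space "\<lambda>c z. emb c * z" by (rule vector_space_F)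
  obtain B where B: "B \<subseteq> V" "V.independent B" "V \<subseteq> V.span B" "card B = V.dim V"
    by (rule V.basis_exists)
  have finB: "finite B" using B(1) fin finite_subset by blast
  define h where "h c = (\<Sum>b\<in>B. emb (c b) * b)" for c :: "'f \<Rightarrow> 'k"
  have "h c \<in> V" for c
  proof -
    have "(\<Sum>b\<in>S. emb (c b) * b) \<in> V" if "S \<subseteq> B" "finite S" for S
      using that(2,1) by (induction S rule: finite_induct) (use sub B(1) in auto)
    then show ?thesis using finB by (simp add: h_def)
  qed
  moreover have "inj_on h (B \<rightarrow>\<^sub>E UNIV)"
  proof
    fix c d assume cd: "c \<in> B \<rightarrow>\<^sub>E UNIV" "d \<in> B \<rightarrow>\<^sub>E UNIV" "h c = h d"
    have "(\<Sum>b\<in>B. emb (c b - d b) * b) = 0"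
      using cd(3) by (simp add: h_def hom_minus left_diff_distrib sum_subtractf)
    then have "c b - d b = 0" if "b \<in> B" for b
      using V.independentD[OF B(2) finB subset_refl, of "\<lambda>b. c b - d b" b] that by simp
    then show "c = d" using cd(1,2) by (intro PiE_ext) auto
  qed
  ultimately have "card (B \<rightarrow>\<^sub>E (UNIV :: 'k set)) \<le> card V"
    using fin by (intro card_inj_on_le[of h]) auto
  then show ?thesis using finB B(4) by (simp add: card_PiE)
qed

context quadratic_extension
begin

lemma div_degree_add: "div_degree emb (A + B) = div_degree emb A + div_degree emb B"
  and div_degree_diff: "div_degree emb (A - B) = div_degree emb A - div_degree emb B"
  and div_degree_uminus: "div_degree emb (- A) = - div_degree emb A"
  and div_degree_0 [simp]: "div_degree emb 0 = 0"
  and div_degree_cmul: "div_degree emb (frag_cmul c A) = c * div_degree emb A"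
  by (simp_all add: div_degree_eq frag_sum_add frag_sum_diff frag_sum_uminus frag_sum_cmul)

lemma div_degree_of: "div_degree emb (frag_of Q) = int (place_degree emb UNIV Q)"
  by (simp add: div_degree_eq)

lemma divisors_iff: "A \<in> divisors emb \<longleftrightarrow> (\<forall>Q. Q \<notin> places emb UNIV \<longrightarrow> Poly_Mapping.lookup A Q = 0)"
  unfolding divisors_def by (auto simp: in_keys_iff)

lemma divisors_add: "A \<in> divisors emb \<Longrightarrow> B \<in> divisors emb \<Longrightarrow> A + B \<in> divisors emb"
  and divisors_diff: "A \<in> divisors emb \<Longrightarrow> B \<in> divisors emb \<Longrightarrow> A - B \<in> divisors emb"
  and divisors_cmul: "A \<in> divisors emb \<Longrightarrow> frag_cmul c A \<in> divisors emb"
  and divisors_of: "Q \<in> places emb UNIV \<Longrightarrow> frag_of Q \<in> divisors emb"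
  unfolding divisors_iff by (auto simp: lookup_add lookup_minus)

lemma effective_degree:
  assumes "A \<in> divisors emb" "effective A"
  shows "div_degree emb A \<ge> 0" "div_degree emb A \<le> 0 \<Longrightarrow> A = 0"
proof -
  have nonneg: "Poly_Mapping.lookup A P * int (place_degree emb UNIV P) \<ge> 0" for P
    using assms(2) by (simp add: effective_def)
  then show ge: "div_degree emb A \<ge> 0" unfolding div_degree_def by (rule sum_nonneg)
  show "A = 0" if "div_degree emb A \<le> 0"
  proof (rule ccontr)
    assume "A \<noteq> 0"
    then obtain P where P: "P \<in> Poly_Mapping.keys A" by (meson all_not_in_conv keys_eq_empty)
    then have "P \<in> places emb UNIV" using assms(1) by (auto simp: divisors_def)
    then interpret curve_place emb x y f P by (rule curve_place_I)
    have "Poly_Mapping.lookup A P > 0"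
      using P assms(2) by (metis effective_def in_keys_iff order_le_less)
    then have "0 < Poly_Mapping.lookup A P * int (place_degree emb UNIV P)" using degree_pos by simp
    also have "\<dots> \<le> div_degree emb A"
      unfolding div_degree_def using P nonneg by (intro member_le_sum) auto
    finally show False using that by simp
  qed
qed

lemma RR_iff:
  assumes "A \<in> divisors emb"
  shows "z \<in> RR_space emb A \<longleftrightarrow>
    z = 0 \<or> (\<forall>Q\<in>places emb UNIV. place_val UNIV Q z + Poly_Mapping.lookup A Q \<ge> 0)"
proof (cases "z = 0")
  case False
  have "Poly_Mapping.lookup A Q = 0" if "Q \<notin> places emb UNIV" for Q
    using assms that by (auto simp: divisors_def in_keys_iff)
  then show ?thesis using False
    unfolding RR_space_def effective_def by (auto simp: lookup_add lookup_pdiv)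
qed (simp add: RR_space_def)

lemma RR_closed:
  assumes "A \<in> divisors emb" "z \<in> RR_space emb A" "w \<in> RR_space emb A"
  shows "emb c * z + w \<in> RR_space emb A"
proof -
  have mult: "emb c * z \<in> RR_space emb A"
  proof (cases "c = 0 \<or> z = 0")
    case False
    have "place_val UNIV Q (emb c * z) = place_val UNIV Q z" if "Q \<in> places emb UNIV" for Q
    proof -
      interpret curve_place emb x y f Q by (rule curve_place_I[OF that])
      show ?thesis using False v_mult[of "emb c" z] v_emb[of c] by simp
    qed
    then show ?thesis using assms(2) False unfolding RR_iff[OF assms(1)] by simp
  qed (auto simp: RR_space_def)
  show ?thesis
  proof (cases "emb c * z = 0 \<or> w = 0 \<or> emb c * z + w = 0")
    case True
    then show ?thesis using mult assms(3) by (auto simp: RR_space_def)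
  next
    case False
    have "place_val UNIV Q (emb c * z + w) + Poly_Mapping.lookup A Q \<ge> 0" if "Q \<in> places emb UNIV" for Q
    proof -
      interpret curve_place emb x y f Q by (rule curve_place_I[OF that])
      have "v (emb c * z + w) \<ge> min (v (emb c * z)) (v w)" using v_add[of "emb c * z" w] False by simp
      moreover have "v (emb c * z) + Poly_Mapping.lookup A Q \<ge> 0" "v w + Poly_Mapping.lookup A Q \<ge> 0"
        using mult assms(3) that False unfolding RR_iff[OF assms(1)] by auto
      ultimately show ?thesis by linarith
    qed
    then show ?thesis unfolding RR_iff[OF assms(1)] by simp
  qed
qed

lemma RR_0 [simp]: "0 \<in> RR_space emb A"
  by (simp add: RR_space_def)

lemma RR_diff: "A \<in> divisors emb \<Longrightarrow> z \<in> RR_space emb A \<Longrightarrow> w \<in> RR_space emb A \<Longrightarrow> z - w \<in> RR_space emb A"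
  using RR_closed[of A w z "- 1"] by (simp add: hom_uminus)

lemma RR_mult:
  assumes "z \<in> RR_space emb A" "w \<in> RR_space emb B"
  shows "z * w \<in> RR_space emb (A + B)"
proof (cases "z = 0 \<or> w = 0")
  case False
  then have "effective (pdiv emb z + A)" "effective (pdiv emb w + B)"
    using assms by (auto simp: RR_space_def)
  then have "effective (pdiv emb (z * w) + (A + B))"
    using False by (simp add: effective_def pdiv_mult lookup_add add_nonneg_nonneg algebra_simps)
      (metis add.assoc add.left_commute add_nonneg_nonneg)
  then show ?thesis using False by (simp add: RR_space_def)
qed auto

text \<open>Linear equivalence, in the form used twice: for the bound behind
  \<open>degree_pdiv\<close> and for the equality of the codes of G and G - (u).\<close>

lemma RR_shift:
  assumes "s \<noteq> 0"
  shows "RR_space emb (A + pdiv emb s) = (*) (inverse s) ` RR_space emb A"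
proof -
  have iff: "inverse s * z \<in> RR_space emb (A + pdiv emb s) \<longleftrightarrow> z \<in> RR_space emb A" for z
  proof (cases "z = 0")
    case False
    have "pdiv emb (inverse s * z) + (A + pdiv emb s) = pdiv emb z + A"
      using assms False by (simp add: pdiv_mult pdiv_inverse)
    then have "effective (pdiv emb (inverse s * z) + (A + pdiv emb s)) = effective (pdiv emb z + A)"
      by (simp only:)
    then show ?thesis using False assms by (simp add: RR_space_def)
  qed simp
  have "z \<in> (*) (inverse s) ` RR_space emb A" if "z \<in> RR_space emb (A + pdiv emb s)" for z
  proof (rule image_eqI)
    show eq: "z = inverse s * (s * z)" using assms by (simp add: mult.assoc[symmetric])
    show "s * z \<in> RR_space emb A" using iff[of "s * z"] that eq by simp
  qed
  then show ?thesis using iff by blast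
qed

end

locale elliptic_curve = quadratic_extension emb x y f
  for emb :: "'k::{field,finite} \<Rightarrow> 'f::field" and x y f +
  assumes genus: "has_genus emb 1"
begin

lemma riemann: "A \<in> divisors emb \<Longrightarrow> div_degree emb A \<le> int (RR_dim emb A)"
  using genus unfolding has_genus_def by force

text \<open>The degrees of the multiples of \<open>(z)\<close> are bounded by Riemann's inequality, since
  the corresponding spaces are all isomorphic to \<open>L(0)\<close>.\<close>

lemma degree_pdiv:
  assumes "z \<noteq> 0"
  shows "div_degree emb (pdiv emb z) = 0"
proof -
  have bound: "div_degree emb (pdiv emb s) \<le> int (RR_dim emb 0)" if "s \<noteq> 0" for s
  proof -
    have "RR_dim emb (0 + pdiv emb s) = RR_dim emb 0"
      unfolding RR_dim_def RR_shift[OF that] by (rule dim_mult) (use that in simp)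
    then show ?thesis using riemann[OF pdiv_divisors[OF that]] by simp
  qed
  have pow: "div_degree emb (pdiv emb (s ^ n)) = int n * div_degree emb (pdiv emb s)" if "s \<noteq> 0" for s n
    using that by (induction n) (simp_all add: pdiv_mult div_degree_add algebra_simps)
  have le: "div_degree emb (pdiv emb s) \<le> 0" if s: "s \<noteq> 0" for s
  proof (rule ccontr)
    assume "\<not> ?thesis"
    \<comment> \<open>A positive degree is at least 1, so the power with exponent l(0) + 1 already
      violates the bound.\<close>
    then have "int (Suc (RR_dim emb 0)) * 1 \<le> int (Suc (RR_dim emb 0)) * div_degree emb (pdiv emb s)"
      by (intro mult_left_mono) auto
    also have "\<dots> \<le> int (RR_dim emb 0)"
      using bound[of "s ^ Suc (RR_dim emb 0)"] s unfolding pow[OF s] by simp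
    finally show False by simp
  qed
  show ?thesis using le[OF assms] le[of "inverse z"] assms by (simp add: pdiv_inverse div_degree_uminus)
qed

lemma RR_negative:
  assumes "A \<in> divisors emb" "div_degree emb A < 0" "z \<in> RR_space emb A"
  shows "z = 0"
proof (rule ccontr)
  assume "z \<noteq> 0"
  then have "effective (pdiv emb z + A)" using assms(3) by (simp add: RR_space_def)
  then have "div_degree emb (pdiv emb z + A) \<ge> 0"
    using effective_degree(1)[OF divisors_add[OF pdiv_divisors[OF \<open>z \<noteq> 0\<close>] assms(1)]] by simp
  then show False using assms(2) degree_pdiv[OF \<open>z \<noteq> 0\<close>] by (simp add: div_degree_add)
qed

lemma card_RR:
  assumes "A \<in> divisors emb" "finite (RR_space emb A)" "int d \<le> div_degree emb A"
  shows "card (UNIV :: 'k set) ^ d \<le> card (RR_space emb A)"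
proof -
  have "d \<le> RR_dim emb A" using riemann[OF assms(1)] assms(3) by linarith
  then have "card (UNIV :: 'k set) ^ d \<le> card (UNIV :: 'k set) ^ RR_dim emb A" by (intro power_increasing) (auto simp: Suc_le_eq card_gt_0_iff)
  also have "\<dots> \<le> card (RR_space emb A)"
    unfolding RR_dim_def using assms RR_closed by (intro card_ge_power_dim) auto
  finally show ?thesis .
qed

end

section \<open>Values of functions in the constant field\<close>

context place_over_finite_field
begin

text \<open>z has a value in K at P. The rules for residues assume only this, so that they can also
  serve to prove that a place has degree 1.\<close>

definition has_residue :: "'f \<Rightarrow> bool" where
  "has_residue z \<longleftrightarrow> (\<exists>c. z - emb c \<in> P)"

lemma has_residue_A: "has_residue z \<Longrightarrow> z \<in> A"
  unfolding has_residue_def using A_add[OF P_in_A A_emb] by (metis diff_add_cancel)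

lemma residue_at_eq: "z - emb c \<in> P \<Longrightarrow> residue_at emb P z = c"
  unfolding residue_at_def using residue_unique by (intro the_equality) auto

lemma residue_at_diff: "has_residue z \<Longrightarrow> z - emb (residue_at emb P z) \<in> P"
  unfolding has_residue_def using residue_at_eq by auto

lemma residue_add_cong: 
  assumes "z - emb c \<in> P" "w - emb d \<in> P" shows "(z + w) - emb (c + d) \<in> P"
  using P_add[OF assms] by (simp add: hom_add algebra_simps)

lemma residue_uminus_cong:
  assumes "z - emb c \<in> P" shows "(- z) - emb (- c) \<in> P"
  using P_uminus[OF assms] by (simp add: hom_uminus)

lemma residue_mult_cong: 
  assumes "z - emb c \<in> P" "w - emb d \<in> P" shows "z * w - emb (c * d) \<in> P"
proof -
  have "w \<in> A" using assms(2) has_residue_A unfolding has_residue_def by blast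
  have "(z - emb c) * w + emb c * (w - emb d) \<in> P"
    by (intro P_add P_mult2[OF assms(1) \<open>w \<in> A\<close>] P_mult[OF A_emb assms(2)])
  then show ?thesis by (simp add: hom_mult algebra_simps)
qed

lemma residue_inverse_cong:
  assumes "z - emb c \<in> P" "c \<noteq> 0" shows "inverse z - emb (inverse c) \<in> P"
proof -
  have z: "z \<in> A" using assms(1) has_residue_A unfolding has_residue_def by blast
  have "z \<notin> P" using P_diff[OF _ assms(1), of z] assms(2) by auto
  then have iz: "inverse z \<in> A" "z \<noteq> 0" using unit_inverse z by auto
  have "emb c \<noteq> 0" using assms(2) by simp
  then have "inverse z - inverse (emb c) = - ((z - emb c) * (inverse z * inverse (emb c)))"
    using iz by (simp add: field_simps)
  then have "inverse z - emb (inverse c) = - ((z - emb c) * (inverse z * emb (inverse c)))"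
    by (simp only: hom_inverse)
  moreover have "(z - emb c) * (inverse z * emb (inverse c)) \<in> P"
    by (intro P_mult2[OF assms(1)] A_mult iz A_emb)
  ultimately show ?thesis by simp
qed

lemma residue_at_emb [simp]: "residue_at emb P (emb c) = c"
  by (rule residue_at_eq) simp

lemma residue_at_0 [simp]: "residue_at emb P 0 = 0"
  using residue_at_emb[of 0] by simp

lemma residue_at_add: "has_residue z \<Longrightarrow> has_residue w \<Longrightarrow> residue_at emb P (z + w) = residue_at emb P z + residue_at emb P w"
  by (intro residue_at_eq residue_add_cong residue_at_diff)

lemma residue_at_mult: "has_residue z \<Longrightarrow> has_residue w \<Longrightarrow> residue_at emb P (z * w) = residue_at emb P z * residue_at emb P w"
  by (intro residue_at_eq residue_mult_cong residue_at_diff)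

lemma residue_at_0_iff: "has_residue z \<Longrightarrow> residue_at emb P z = 0 \<longleftrightarrow> z \<in> P"
  using residue_at_diff[of z] residue_at_eq[of z 0] by auto

end

context curve_place
begin

lemma y_sq_val: "2 * v y = v (pv f)"
  using v_power[of y 2] eqn by simp

text \<open>Infinity is ramified because deg f is odd: 2 v(y) = -3 e forces e to be even.\<close>

lemma infinite_val:
  assumes "x \<notin> A"
  shows "a \<noteq> 0 \<Longrightarrow> v (pv a) = - 2 * int (degree a)" "v y = - 3"
proof -
  have xR: "x \<notin> R.A" using assms restrict_ring by auto
  obtain e :: int where e: "e = 1 \<or> e = 2" "\<And>z. z \<in> Kx \<Longrightarrow> z \<noteq> 0 \<Longrightarrow> v z = e * w z"
    using ramification by blast
  have val: "v (pv a) = - (e * int (degree a))" if "a \<noteq> 0" for a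
    using e(2)[of "pv a"] R.infinite_place_facts(3)[OF xR that] that by simp
  have "2 * v y = - (e * 3)" using y_sq_val val[of f] degf by simp
  then have "e = 2" using e(1) by presburger
  then show "a \<noteq> 0 \<Longrightarrow> v (pv a) = - 2 * int (degree a)" "v y = - 3"
    using val[of a] \<open>2 * v y = - (e * 3)\<close> by auto
qed

lemma y_in_A: "x \<in> A \<Longrightarrow> y \<in> A"
  using A_root[of y 2] eqn A_peval[of x f] by simp

lemma finite_place_poly:
  assumes "x \<in> A"
  obtains q where "irreducible q" "\<forall>a. pv a \<in> Q \<longleftrightarrow> q dvd a" "w (pv q) = 1" "Q \<inter> Kx = poly_place emb x q"
    "\<forall>z\<in>A \<inter> Kx. \<exists>c. degree c < degree q \<and> z - pv c \<in> Q"
proof -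
  have xR: "x \<in> R.A" using assms restrict_ring by auto
  obtain q where q: "lead_coeff q = 1" "irreducible q" "\<forall>a. pv a \<in> Q \<inter> Kx \<longleftrightarrow> q dvd a"
    by (rule R.finite_place[OF xR])
  have q': "\<And>a. (pv a \<in> Q \<inter> Kx) = (q dvd a)" using q(3) by simp
  note F = R.finite_place_facts[OF xR q(2) q']
  show ?thesis
  proof (rule that[OF q(2) _ F(3,1)])
    show "\<forall>a. pv a \<in> Q \<longleftrightarrow> q dvd a" using q' by simp
    show "\<forall>z\<in>A \<inter> Kx. \<exists>c. degree c < degree q \<and> z - pv c \<in> Q"
      using F(4) restrict_ring by blast
  qed
qed

text \<open>Square-freeness of f: a double zero at the place of q would mean that q^2 divides
  f.\<close>

lemma w_f:
  assumes "x \<in> A"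
  shows "pv f \<in> Q \<Longrightarrow> w (pv f) = 1" "w (pv f) \<le> 1"
proof -
  obtain q where q: "irreducible q" "\<forall>a. pv a \<in> Q \<longleftrightarrow> q dvd a" "w (pv q) = 1"
    by (rule finite_place_poly[OF assms])
  have "degree q > 0" "q \<noteq> 0" using q(1) by (auto simp: irreducible_def is_unit_iff_degree)
  then obtain i b where ib: "f = q ^ i * b" "\<not> q dvd b" using poly_power_split[of q f] by auto
  have b: "pv b \<in> Kx" "pv b \<noteq> 0" "w (pv b) = 0"
  proof -
    show b0: "pv b \<noteq> 0" using ib f_nz by auto
    have "pv b \<in> R.A" using A_peval[OF assms] restrict_ring by simp
    moreover have "pv b \<notin> Q \<inter> Kx" using q(2) ib(2) by simp
    ultimately show "w (pv b) = 0" using R.v_unit[OF pv_Kx b0] by blast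
  qed simp
  have "w (pv f) = w (pv q ^ i * pv b)" unfolding ib(1) by simp
  also have "\<dots> = w (pv q ^ i) + w (pv b)"
    using b \<open>q \<noteq> 0\<close> by (intro R.v_mult) (auto intro: is_subfield_power[OF is_subfield_Kx])
  also have "\<dots> = int i" using R.v_power[of "pv q" i] q(3) b \<open>q \<noteq> 0\<close> by simp
  finally have wf: "w (pv f) = int i" .
  have "i \<le> 1"
  proof (rule ccontr)
    assume "\<not> i \<le> 1"
    then have "q ^ 2 dvd q ^ i" by (intro le_imp_power_dvd) simp
    then have "q ^ 2 dvd f" unfolding ib(1) by (rule dvd_mult2)
    then have "q dvd 1" using sqf unfolding squarefree_def by blast
    then show False using q(1) by (simp add: irreducible_def)
  qed
  then show "w (pv f) \<le> 1" using wf by simp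
  show "w (pv f) = 1" if "pv f \<in> Q"
    using R.v_P[of "pv f"] that wf \<open>i \<le> 1\<close> by simp
qed

lemma y_in_Q: "y \<in> Q \<longleftrightarrow> pv f \<in> Q"
  using v_P[of y] v_P[of "pv f"] by (simp add: y_sq_val[symmetric])

text \<open>At a zero of f(x) the value of f(x) below is 1, so 2 v(y) = e with e at most 2; the
  place is ramified and y is a uniformizer.\<close>

lemma val_y_finite:
  assumes "x \<in> A"
  shows "v y = (if y \<in> Q then 1 else 0)"
proof (cases "y \<in> Q")
  case True
  then have "w (pv f) = 1" using w_f(1)[OF assms] y_in_Q by simp
  moreover obtain e :: int where "e = 1 \<or> e = 2" "\<And>z. z \<in> Kx \<Longrightarrow> z \<noteq> 0 \<Longrightarrow> v z = e * w z"
    using ramification by blast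
  ultimately have "2 * v y = 1 \<or> 2 * v y = 2" using y_sq_val by force
  then have "v y = 1" by presburger
  then show ?thesis using True by simp
next
  case False
  then show ?thesis using v_unit[of y] y_in_A[OF assms] by simp
qed

text \<open>
  At an unramified rational point \<open>x = a\<close> whose place is not invariant under conjugation the curve
  splits: otherwise \<open>a + b y\<close> and its conjugate would always have the same value.
\<close>

lemma split_place:
  assumes t: "x - emb a \<in> Q" and ny: "y \<notin> Q" and nc: "bar -` Q \<noteq> Q"
  obtains b where "b \<noteq> 0" "y - emb b \<in> Q" "\<forall>z\<in>A. has_residue z"
proof -
  define t where "t = x - emb a"
  have tQ: "t \<in> Q" using assms(1) by (simp add: t_def)
  have xA: "x \<in> A" using A_add[OF P_in_A[OF t] A_emb[of a]] by simp
  obtain q where q: "irreducible q" "\<forall>a. pv a \<in> Q \<longleftrightarrow> q dvd a" "w (pv q) = 1"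
      "\<forall>z\<in>A \<inter> Kx. \<exists>c. degree c < degree q \<and> z - pv c \<in> Q"
    by (rule finite_place_poly[OF xA])
  have t_pv: "t = pv [:- a, 1:]" by (simp add: t_def hom_uminus)
  have "pv [:- a, 1:] \<in> Q" using tQ unfolding t_pv .
  then have "q dvd [:- a, 1:]" using q(2) by blast
  then have "degree q \<le> 1" using dvd_imp_degree_le[of q "[:- a, 1:]"] by simp
  have resK: "\<exists>c. z - emb c \<in> Q" if z: "z \<in> A" "z \<in> Kx" for z
  proof -
    obtain c where c: "degree c < degree q" "z - pv c \<in> Q" using q(4) z by blast
    then have "degree c = 0" using \<open>degree q \<le> 1\<close> by simp
    then obtain d where "c = [:d:]" using degree_0_id by metis
    then show ?thesis using c(2) by (intro exI[of _ d]) simp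
  qed
  \<comment> \<open>x - a is a nonzero constant times the generator q, hence a uniformizer of the
    place below.\<close>
  have qt: "w t = 1"
  proof -
    obtain s where s: "[:- a, 1:] = q * s" using \<open>q dvd [:- a, 1:]\<close> by auto
    have nz: "q \<noteq> 0" "s \<noteq> 0" using s by auto
    have "degree q > 0" using q(1) nz by (auto simp: irreducible_def is_unit_iff_degree)
    moreover have "degree q + degree s = 1" using s degree_mult_eq[OF nz] by (metis degree_pCons_eq_if one_neq_zero degree_1 one_pCons One_nat_def)
    ultimately have "degree s = 0" by simp
    then obtain d where d: "s = [:d:]" using degree_0_id by metis
    then have "d \<noteq> 0" using nz by auto
    have "t = emb d * pv q" unfolding t_pv s d by (simp add: mult.commute)
    then show ?thesis using R.v_mult[of "emb d" "pv q"] R.v_emb[of d] q(3) nz \<open>d \<noteq> 0\<close> by simp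
  qed
  have t0: "t \<noteq> 0" using t_pv pv_eq_0_iff[of "[:- a, 1:]"] by simp
  have tK: "t \<in> Kx" unfolding t_pv by (rule pv_Kx)
  have vt: "v t > 0" using v_P[of t] tQ t0 by simp
  have two0: "2 * c = 0 \<Longrightarrow> c = 0" for c :: 'k using two by simp
  have wt: "w (z / t powi k) = w z - k" "z / t powi k \<in> Kx" if "z \<in> Kx" "z \<noteq> 0" for z k
  proof -
    have "t powi k \<in> Kx" "t powi k \<noteq> 0" using is_subfield_powi[OF is_subfield_Kx tK] t0 by auto
    then show "w (z / t powi k) = w z - k" "z / t powi k \<in> Kx"
      using R.v_divide[of z "t powi k"] R.v_powi[OF tK t0] qt that Kx_closed(8) by simp_all
  qed
  have inA: "z / t powi k \<in> A \<inter> Kx" if "z \<in> Kx" "z = 0 \<or> k \<le> w z" for z k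
  proof (cases "z = 0")
    case True
    then show ?thesis using Kx_closed(1) by simp
  next
    case False
    then have "z / t powi k \<in> R.A"
      using R.v_A[of "z / t powi k"] wt[OF that(1) False, of k] that t0 by simp
    then show ?thesis using restrict_ring by simp
  qed
  have notQ: "z / t powi k \<notin> Q" if "z \<in> Kx" "z \<noteq> 0" "k = w z" for z k
  proof -
    have "z / t powi k \<notin> Q \<inter> Kx"
      using R.v_P[of "z / t powi k"] wt[OF that(1,2), of k] that t0 by simp
    then show ?thesis using wt(2)[OF that(1,2)] by blast
  qed
  \<comment> \<open>Taking for k the smaller value of the two coefficients makes c and d regular and
    not both zero modulo Q.\<close>
  have decomp: "\<exists>k c d. z = t powi k * (c + d * y) \<and> c \<in> A \<inter> Kx \<and> d \<in> A \<inter> Kx \<and> \<not> (c \<in> Q \<and> d \<in> Q)"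
    if "z \<noteq> 0" for z
  proof -
    obtain c d where cd: "c \<in> Kx" "d \<in> Kx" "z = c + d * y" by (rule repr_obtain)
    define k where "k = (if c = 0 then w d else if d = 0 then w c else min (w c) (w d))"
    have nz: "c \<noteq> 0 \<or> d \<noteq> 0" using that cd(3) by auto
    have "c / t powi k \<in> A \<inter> Kx" "d / t powi k \<in> A \<inter> Kx"
      by (rule inA[OF cd(1)], simp add: k_def, rule inA[OF cd(2)], simp add: k_def)
    moreover have "\<not> (c / t powi k \<in> Q \<and> d / t powi k \<in> Q)"
    proof (cases "c \<noteq> 0 \<and> k = w c")
      case True
      then show ?thesis using notQ[OF cd(1)] by blast
    next
      case False
      then have "d \<noteq> 0" "k = w d" using nz by (auto simp: k_def min_def split: if_splits)
      then show ?thesis using notQ[OF cd(2)] by blast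
    qed
    moreover have "z = t powi k * (c / t powi k + d / t powi k * y)"
      using t0 cd(3) by (simp add: field_simps)
    ultimately show ?thesis by blast
  qed
  have yA: "y \<in> A" by (rule y_in_A[OF xA])
  \<comment> \<open>If such a c + d y vanishes at Q, its residue equation can be solved for y: the
    residue of d is nonzero, as otherwise c would vanish at Q too.\<close>
  have lin: "\<exists>b. y - emb b \<in> Q" if c: "c \<in> A \<inter> Kx" and d: "d \<in> A \<inter> Kx" and n: "\<not> (c \<in> Q \<and> d \<in> Q)"
    and h: "c + d * y \<in> Q" for c d
  proof -
    obtain c0 where c0: "c - emb c0 \<in> Q" using resK c by blast
    obtain d0 where d0: "d - emb d0 \<in> Q" using resK d by blast
    have "(c - emb c0) + (d - emb d0) * y \<in> Q" by (intro P_add c0 P_mult2[OF d0 yA])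
    from P_diff[OF h this] have e: "emb c0 + emb d0 * y \<in> Q" by (simp add: algebra_simps)
    show ?thesis
    proof (cases "d0 = 0")
      case True
      then have "c0 = 0" using e by simp
      then show ?thesis using True c0 d0 n by simp
    next
      case False
      then have 1: "emb (inverse d0) * emb d0 = 1" using hom_mult[of "inverse d0" d0] by simp
      have 2: "emb (- (c0 / d0)) = - (emb (inverse d0) * emb c0)"
        by (simp only: hom_uminus divide_inverse hom_mult mult.commute)
      have eq: "y - emb (- (c0 / d0)) = emb (inverse d0) * (emb c0 + emb d0 * y)"
        unfolding distrib_left mult.assoc[symmetric] 1 2 by simp
      have "y - emb (- (c0 / d0)) \<in> Q" unfolding eq by (rule P_mult[OF A_emb e])
      then show ?thesis by (rule exI)
    qed
  qed
  have "\<exists>b. y - emb b \<in> Q"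
  proof (rule ccontr)
    assume no: "\<not> ?thesis"
    \<comment> \<open>By \<open>lin\<close>, neither c + d y nor c - d y vanishes at Q, so z and its
      conjugate both have the value of t^k.\<close>
    have "z \<in> Q \<longleftrightarrow> bar z \<in> Q" for z
    proof (cases "z = 0")
      case False
      obtain k c d where z: "z = t powi k * (c + d * y)" and c: "c \<in> A \<inter> Kx" and d: "d \<in> A \<inter> Kx"
        and n: "\<not> (c \<in> Q \<and> d \<in> Q)"
        using decomp[OF False] by blast
      have d': "- d \<in> A \<inter> Kx" using d A_uminus Kx_closed(6) by simp
      have u: "c + d * y \<notin> Q" using lin[OF c d n] no by blast
      have n': "\<not> (c \<in> Q \<and> - d \<in> Q)" using n by simp
      have u': "c + (- d) * y \<notin> Q" using lin[OF c d' n'] no by blast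
      have uA: "c + d * y \<in> A" "c + (- d) * y \<in> A"
        using c d d' by (intro A_add[OF _ A_mult[OF _ yA]]; simp)+
      have u0: "c + d * y \<noteq> 0" "c + (- d) * y \<noteq> 0" using u u' by (metis P_0)+
      have tp: "t powi k \<noteq> 0" "t powi k \<in> Kx" using t0 is_subfield_powi[OF is_subfield_Kx tK] by auto
      have bz: "bar z = t powi k * (c + (- d) * y)"
        unfolding z bar_mult using bar_Kx[OF tp(2)] bar_eq[of c d] c d by simp
      have "v (c + d * y) = 0" using v_unit[of "c + d * y"] u u0 uA by blast
      then have 1: "v z = v (t powi k)" unfolding z using v_mult[of "t powi k" "c + d * y"] tp u0 by simp
      have "v (c + (- d) * y) = 0" using v_unit[of "c + (- d) * y"] u' u0 uA by blast
      then have 2: "v (bar z) = v (t powi k)"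
        unfolding bz using v_mult[of "t powi k" "c + (- d) * y"] tp u0 by simp
      show ?thesis using v_P[of z] v_P[of "bar z"] 1 2 False by simp
    qed simp
    then show False using nc by blast
  qed
  then obtain b where b: "y - emb b \<in> Q" by blast
  have b0: "b \<noteq> 0" using b ny by auto
  have "has_residue z" if zA: "z \<in> A" for z
  proof (cases "z = 0")
    case True
    then show ?thesis unfolding has_residue_def by (intro exI[of _ 0]) simp
  next
    case False
    obtain k c d where z: "z = t powi k * (c + d * y)" and c: "c \<in> A \<inter> Kx" and d: "d \<in> A \<inter> Kx"
      and n: "\<not> (c \<in> Q \<and> d \<in> Q)"
      using decomp[OF False] by blast
    define u u' where "u = c + d * y" and "u' = c + (- d) * y"
    obtain c0 where c0: "c - emb c0 \<in> Q" using resK c by blast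
    obtain d0 where d0: "d - emb d0 \<in> Q" using resK d by blast
    have d0': "- d - emb (- d0) \<in> Q" by (rule residue_uminus_cong[OF d0])
    have ru: "u - emb (c0 + d0 * b) \<in> Q" unfolding u_def
      by (intro residue_add_cong c0 residue_mult_cong d0 b)
    have ru': "u' - emb (c0 + (- d0) * b) \<in> Q" unfolding u'_def
      by (intro residue_add_cong c0 residue_mult_cong d0' b)
    have tp: "t powi k \<noteq> 0" "t powi k \<in> Kx" using t0 is_subfield_powi[OF is_subfield_Kx tK] by auto
    show ?thesis
    proof (cases "c0 + d0 * b = 0")
      case False
      have "u \<notin> Q" using P_diff[OF _ ru, of u] False by auto
      moreover have "u \<in> A" using ru has_residue_A unfolding has_residue_def by blast
      ultimately have "inverse u \<in> A" "u \<noteq> 0" using unit_inverse by auto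
      then have "t powi k = z * inverse u" unfolding z u_def[symmetric] by simp
      then have "t powi k \<in> A" using A_mult[OF zA \<open>inverse u \<in> A\<close>] by simp
      then obtain e where "t powi k - emb e \<in> Q" using resK tp(2) by blast
      then have "z - emb (e * (c0 + d0 * b)) \<in> Q" unfolding z u_def[symmetric]
        by (rule residue_mult_cong[OF _ ru])
      then show ?thesis unfolding has_residue_def by blast
    next
      case True
      \<comment> \<open>u vanishes at Q, but its conjugate u' does not, since 2 and b are nonzero
        and c0, d0 are not both 0. So z u' = t^k u u' is a regular function in K(x), and its residue
        divided by that of u' is the residue of z.\<close>
      have nz: "c0 + (- d0) * b \<noteq> 0"
      proof
        assume 0: "c0 + (- d0) * b = 0"
        have "2 * c0 = (c0 + d0 * b) + (c0 + (- d0) * b)" by simp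
        also have "\<dots> = 0" by (simp only: True 0 add_0_left)
        finally have 1: "c0 = 0" by (rule two0)
        have "d0 * b = 0" using True unfolding 1 by simp
        then have 2: "d0 = 0" using b0 by simp
        show False using n c0 d0 unfolding 1 2 by simp
      qed
      have u'A: "u' \<in> A" using ru' has_residue_A unfolding has_residue_def by blast
      have "u' \<noteq> 0" using ru' nz by (auto simp flip: hom_uminus)
      have uu: "u * u' = c * c - d * d * pv f"
        unfolding u_def u'_def eqn[symmetric] by (simp add: algebra_simps power2_eq_square)
      have "u * u' \<in> Kx" unfolding uu using c d Kx_closed(3,4) pv_Kx by simp
      then have "t powi k * (u * u') \<in> Kx" using tp(2) Kx_closed(4) by blast
      moreover have eq: "t powi k * (u * u') = z * u'" unfolding z u_def by simp
      ultimately have "z * u' \<in> Kx" by simp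
      moreover have "z * u' \<in> A" by (rule A_mult[OF zA u'A])
      ultimately obtain e where e: "z * u' - emb e \<in> Q" using resK by blast
      have "z * u' * inverse u' - emb (e * inverse (c0 + (- d0) * b)) \<in> Q"
        by (rule residue_mult_cong[OF e residue_inverse_cong[OF ru' nz]])
      moreover have "z * u' * inverse u' = z" using \<open>u' \<noteq> 0\<close> by simp
      ultimately have "z - emb (e * inverse (c0 + (- d0) * b)) \<in> Q" by (simp only:)
      then show ?thesis unfolding has_residue_def by blast
    qed
  qed
  then show ?thesis using that[OF b0 b] by blast
qed

end

section \<open>The point at infinity\<close>

locale pointed_curve = elliptic_curve emb x y f for emb :: "'k::{field,finite} \<Rightarrow> 'f::field" and x y f +
  fixes Qinf :: "'f set"
  assumes Qinf: "Qinf \<in> places emb UNIV"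
    and x_regular_iff: "Q \<in> places emb UNIV \<Longrightarrow> x \<in> place_ring UNIV Q \<longleftrightarrow> Q \<noteq> Qinf"
begin

lemma x_pole: "x \<notin> place_ring UNIV Qinf"
  using x_regular_iff[OF Qinf] by simp

lemma val_Qinf: "a \<noteq> 0 \<Longrightarrow> place_val UNIV Qinf (pv a) = - 2 * int (degree a)"
  "place_val UNIV Qinf y = - 3"
  using curve_place.infinite_val[OF curve_place_I[OF Qinf] x_pole] by auto

text \<open>Places over a given prime exist because a function with a pole must have a zero.\<close>

lemma zero_exists:
  assumes "degree b > 0"
  obtains Q where "Q \<in> places emb UNIV" "x \<in> place_ring UNIV Q" "pv b \<in> Q"
proof -
  have b: "b \<noteq> 0" using assms by auto
  have "\<exists>Q\<in>places emb UNIV. place_val UNIV Q (pv b) > 0"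
  proof (rule ccontr)
    assume "\<not> ?thesis"
    then have "effective (- pdiv emb (pv b))" using b by (auto simp: effective_def lookup_pdiv not_less)
    moreover have "- pdiv emb (pv b) \<in> divisors emb"
      using pdiv_divisors[of "inverse (pv b)"] b by (simp add: pdiv_inverse)
    moreover have "div_degree emb (- pdiv emb (pv b)) \<le> 0"
      using degree_pdiv[of "pv b"] b by (simp add: div_degree_uminus)
    ultimately have "- pdiv emb (pv b) = 0" by (intro effective_degree(2))
    then have "Poly_Mapping.lookup (pdiv emb (pv b)) Qinf = 0" by simp
    then show False using val_Qinf(1)[OF b] b Qinf assms by (simp add: lookup_pdiv)
  qed
  then obtain Q where Q: "Q \<in> places emb UNIV" "place_val UNIV Q (pv b) > 0" by blast
  interpret curve_place emb x y f Q by (rule curve_place_I[OF Q(1)])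
  have "Q \<noteq> Qinf" using Q(2) val_Qinf(1)[OF b] by auto
  then show ?thesis using that[OF Q(1)] x_regular_iff[OF Q(1)] v_P[of "pv b"] b Q(2) by simp
qed

text \<open>Take a denominator b of least degree. Above a prime factor of b there is a place; z is
  regular there, so that prime divides the numerator as well and could be cancelled.\<close>

lemma poly_if_regular:
  assumes z: "z \<in> Kx" and reg: "\<And>Q. Q \<in> places emb UNIV \<Longrightarrow> Q \<noteq> Qinf \<Longrightarrow> z \<in> place_ring UNIV Q"
  shows "\<exists>a. z = pv a"
proof -
  define d where "d = (LEAST d. \<exists>a b. z = pv a / pv b \<and> b \<noteq> 0 \<and> degree b = d)"
  have ex: "\<exists>d a b. z = pv a / pv b \<and> b \<noteq> 0 \<and> degree b = d" using z Kx_E by metis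
  have "\<exists>a b. z = pv a / pv b \<and> b \<noteq> 0 \<and> degree b = d"
    unfolding d_def using ex by (rule LeastI_ex)
  then obtain a b where ab: "z = pv a / pv b" "b \<noteq> 0" "degree b = d" by blast
  have min: "d \<le> degree b'" if "z = pv a' / pv b'" "b' \<noteq> 0" for a' b'
    unfolding d_def by (rule Least_le) (use that in blast)
  have "degree b = 0"
  proof (rule ccontr)
    assume "degree b \<noteq> 0"
    then obtain Q where Q: "Q \<in> places emb UNIV" "x \<in> place_ring UNIV Q" "pv b \<in> Q"
      using zero_exists by blast
    interpret curve_place emb x y f Q by (rule curve_place_I[OF Q(1)])
    obtain q where q: "irreducible q" "\<forall>a. pv a \<in> Q \<longleftrightarrow> q dvd a"
      by (rule finite_place_poly[OF Q(2)])
    have "z \<in> A" using reg[OF Q(1)] x_regular_iff[OF Q(1)] Q(2) by blast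
    then have "z * pv b \<in> Q" using P_mult Q(3) by blast
    then have "pv a \<in> Q" using ab by simp
    then obtain a' where a': "a = q * a'" using q(2) by auto
    obtain b' where b': "b = q * b'" using q(2) Q(3) by auto
    have nz: "q \<noteq> 0" "b' \<noteq> 0" using b' ab(2) by auto
    have "z = pv a' / pv b'" unfolding ab(1) a' b' using nz by simp
    then have "d \<le> degree b'" using min nz(2) by blast
    moreover have "degree b = degree q + degree b'" unfolding b' using nz by (simp add: degree_mult_eq)
    moreover have "degree q > 0" using q(1) nz(1) by (auto simp: irreducible_def is_unit_iff_degree)
    ultimately show False using ab(3) by simp
  qed
  then obtain c where "b = [:c:]" using degree_0_id by metis
  then have "c \<noteq> 0" "pv b = emb c" using ab(2) by auto
  then have "z = pv (Polynomial.smult (inverse c) a)"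
    unfolding ab(1) by (simp add: hom_inverse divide_inverse mult.commute)
  then show ?thesis by blast
qed

text \<open>K[x] + K[x] y is the integral closure of K[x] in F. Conjugation permutes the places
  other than Qinf, so half the trace, the first coefficient, is regular too; the second one needs
  that f is square-free.\<close>

lemma regular_repr:
  assumes reg: "\<And>Q. Q \<in> places emb UNIV \<Longrightarrow> Q \<noteq> Qinf \<Longrightarrow> z \<in> place_ring UNIV Q"
  shows "\<exists>a b. z = pv a + pv b * y"
proof -
  obtain c d where cd: "c \<in> Kx" "d \<in> Kx" "z = c + d * y" "bar z = c - d * y" by (rule repr_obtain)
  have bar_reg: "bar z \<in> place_ring UNIV Q" if Q: "Q \<in> places emb UNIV" "Q \<noteq> Qinf" for Q
  proof -
    note B = bar_place[OF Q(1)]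
    have "x \<in> place_ring UNIV (bar -` Q)"
      using x_regular_iff[OF Q(1)] Q(2) B(2) bar_Kx[OF x_Kx] by simp
    then have "z \<in> place_ring UNIV (bar -` Q)" using reg[OF B(1)] x_regular_iff[OF B(1)] by blast
    then show ?thesis using B(2) by simp
  qed
  have c_reg: "c \<in> place_ring UNIV Q" if Q: "Q \<in> places emb UNIV" "Q \<noteq> Qinf" for Q
  proof -
    interpret curve_place emb x y f Q by (rule curve_place_I[OF Q(1)])
    have "emb (inverse 2) * (z + bar z) \<in> A"
      by (intro A_mult A_emb A_add reg[OF Q] bar_reg[OF Q])
    moreover have "emb (inverse 2) * (z + bar z) = c"
    proof -
      have "emb 2 = 2" using hom_add[of 1 1] by simp
      then have "emb (inverse 2) = inverse 2" by (simp only: hom_inverse)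
      then have "emb (inverse 2) * 2 = 1" by (simp only: left_inverse[OF two_F])
      moreover have "z + bar z = 2 * c" unfolding cd(3) bar_eq[OF cd(1,2)] by simp
      ultimately show ?thesis by (simp flip: mult.assoc)
    qed
    ultimately show ?thesis by simp
  qed
  have d_reg: "d \<in> place_ring UNIV Q" if Q: "Q \<in> places emb UNIV" "Q \<noteq> Qinf" for Q
  proof (cases "d = 0")
    case False
    interpret curve_place emb x y f Q by (rule curve_place_I[OF Q(1)])
    have xA: "x \<in> A" using x_regular_iff[OF Q(1)] Q(2) by simp
    have "(z - c) ^ 2 \<in> A" using reg[OF Q] c_reg[OF Q] by (intro A_power A_diff)
    moreover have "(z - c) ^ 2 = d ^ 2 * pv f" using cd(3) eqn by (simp add: power_mult_distrib)
    ultimately have dA: "d ^ 2 * pv f \<in> A" by simp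
    have K: "d ^ 2 * pv f \<in> Kx" "d ^ 2 * pv f \<noteq> 0" "d ^ 2 \<in> Kx" "d ^ 2 \<noteq> 0"
      using cd(2) Kx_closed(4) is_subfield_power[OF is_subfield_Kx] False by auto
    \<comment> \<open>2 w(d) + w(f) \<ge> 0 together with w(f) \<le> 1 leaves no room for a pole of
      d.\<close>
    have "w (d ^ 2 * pv f) \<ge> 0" using R.v_A[OF K(1,2)] dA K(1) restrict_ring by simp
    moreover have "w (d ^ 2 * pv f) = 2 * w d + w (pv f)"
      using R.v_mult[OF K(3) pv_Kx K(4)] R.v_power[OF cd(2) False, of 2] by simp
    ultimately have "w d \<ge> 0" using w_f(2)[OF xA] by linarith
    then show ?thesis using R.v_A[OF cd(2) False] restrict_ring by simp
  next
    case True
    interpret curve_place emb x y f Q by (rule curve_place_I[OF Q(1)])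
    show ?thesis using True by simp
  qed
  show ?thesis using poly_if_regular[OF cd(1) c_reg] poly_if_regular[OF cd(2) d_reg] cd(3) by auto
qed

text \<open>The pole orders 2 deg a and 2 deg b + 3 at infinity have different parity, so the
  leading terms cannot cancel. This makes L(k Qinf) explicit; k = 0 leaves the constants.\<close>

lemma pole_order_repr:
  assumes reg: "\<And>Q. Q \<in> places emb UNIV \<Longrightarrow> Q \<noteq> Qinf \<Longrightarrow> z = 0 \<or> place_val UNIV Q z \<ge> 0"
    and ord: "z = 0 \<or> place_val UNIV Qinf z \<ge> - int k"
  shows "\<exists>a b. z = pv a + pv b * y \<and> (a = 0 \<or> 2 * degree a \<le> k) \<and> (b = 0 \<or> 2 * degree b + 3 \<le> k)"
proof (cases "z = 0")
  case True
  then show ?thesis by (intro exI[of _ 0]) simp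
next
  case False
  have "z \<in> place_ring UNIV Q" if Q: "Q \<in> places emb UNIV" "Q \<noteq> Qinf" for Q
  proof -
    interpret curve_place emb x y f Q by (rule curve_place_I[OF Q(1)])
    show ?thesis using v_A[of z] reg[OF Q] False by simp
  qed
  then obtain a b where ab: "z = pv a + pv b * y" using regular_repr by blast
  interpret curve_place emb x y f Qinf by (rule curve_place_I[OF Qinf])
  have va: "a \<noteq> 0 \<Longrightarrow> v (pv a) = - 2 * int (degree a)" by (rule val_Qinf(1))
  have vb: "b \<noteq> 0 \<Longrightarrow> v (pv b * y) = - 2 * int (degree b) - 3"
    using val_Qinf(1)[of b] val_Qinf(2) v_mult[of "pv b" y] by simp
  have "(a = 0 \<or> 2 * degree a \<le> k) \<and> (b = 0 \<or> 2 * degree b + 3 \<le> k)"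
  proof (cases "a = 0 \<or> b = 0")
    case True
    then show ?thesis using va vb ord False ab by auto
  next
    case ne: False
    then have ne': "pv a \<noteq> 0" "pv b * y \<noteq> 0" by auto
    have "v (pv a) \<noteq> v (pv b * y)" using va vb ne by presburger
    then consider "v (pv a) < v (pv b * y)" | "v (pv b * y) < v (pv a)" by linarith
    then show ?thesis
    proof cases
      case 1
      then have "v z = v (pv a)" unfolding ab using v_add_less(2)[of "pv a" "pv b * y"] ne' by simp
      then show ?thesis using 1 va vb ord False ne by auto
    next
      case 2
      then have "v z = v (pv b * y)" unfolding ab
        using v_add_less(2)[of "pv b * y" "pv a"] ne' by (simp add: add.commute)
      then show ?thesis using 2 va vb ord False ne by auto
    qed
  qed
  then show ?thesis using ab by blast
qed

text \<open>The origin of the places Q_i and of the constant 3 in the divisor equation of the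
  theorem.\<close>

lemma pdiv_y:
  assumes "finite I" "inj_on Qs I" "Qs ` I = {Q \<in> places emb UNIV. y \<in> Q}"
  shows "pdiv emb y = (\<Sum>i\<in>I. frag_of (Qs i)) - frag_cmul 3 (frag_of Qinf)"
proof (rule poly_mapping_eqI)
  fix Q
  have sum: "Poly_Mapping.lookup (\<Sum>i\<in>I. frag_of (Qs i)) Q = (if Q \<in> Qs ` I then 1 else 0)"
  proof -
    have "Poly_Mapping.lookup (\<Sum>i\<in>I. frag_of (Qs i)) Q = (\<Sum>i\<in>I. if Q = Qs i then 1 else 0)"
      by (simp add: lookup_sum)
    also have "\<dots> = (\<Sum>R\<in>Qs ` I. if Q = R then 1 else 0)"
      using assms(2) by (simp add: sum.reindex)
    also have "\<dots> = (if Q \<in> Qs ` I then 1 else 0)" using assms(1) by simp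
    finally show ?thesis .
  qed
  have "y \<notin> Qinf" 
  proof -
    interpret curve_place emb x y f Qinf by (rule curve_place_I[OF Qinf])
    show ?thesis using v_P[of y] val_Qinf(2) by simp
  qed
  then show "Poly_Mapping.lookup (pdiv emb y) Q =
      Poly_Mapping.lookup ((\<Sum>i\<in>I. frag_of (Qs i)) - frag_cmul 3 (frag_of Qinf)) Q"
  proof (cases "Q \<in> places emb UNIV")
    case True
    interpret curve_place emb x y f Q by (rule curve_place_I[OF True])
    show ?thesis
    proof (cases "Q = Qinf")
      case True
      then show ?thesis using sum assms(3) val_Qinf(2) Qinf \<open>y \<notin> Qinf\<close>
        by (simp add: lookup_pdiv lookup_minus)
    next
      case False
      then show ?thesis using sum assms(3) val_y_finite x_regular_iff[OF True] True
        by (simp add: lookup_pdiv lookup_minus)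
    qed
  qed (use sum assms(3) Qinf in \<open>auto simp: lookup_pdiv lookup_minus\<close>)
qed

end

section \<open>Dual codes over finite fields\<close>

text \<open>Words of length n as functions vanishing from n on, so that an induction over n stays
  within one type.\<close>

definition supported :: "nat \<Rightarrow> (nat \<Rightarrow> 'k::zero) set" where
  "supported n = {v. \<forall>i\<ge>n. v i = 0}"

definition function_dual :: "nat \<Rightarrow> (nat \<Rightarrow> 'k::comm_ring) set \<Rightarrow> (nat \<Rightarrow> 'k) set" where
  "function_dual n V = {w \<in> supported n. \<forall>v\<in>V. (\<Sum>i<n. v i * w i) = 0}"

lemma function_dual_zero: "w \<in> function_dual n V \<Longrightarrow> i \<ge> n \<Longrightarrow> w i = 0"
  by (simp add: function_dual_def supported_def)

lemma finite_supported: "finite (supported n :: (nat \<Rightarrow> 'k::{zero,finite}) set)"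
proof -
  have "(supported n :: (nat \<Rightarrow> 'k) set) \<subseteq> {v. \<forall>i. (i \<in> {..<n} \<longrightarrow> v i \<in> UNIV) \<and> (i \<notin> {..<n} \<longrightarrow> v i = 0)}"
    by (auto simp: supported_def)
  then show ?thesis by (rule finite_subset) (intro finite_set_of_finite_funs, auto)
qed

text \<open>Induction by deleting the last coordinate. If the last unit vector e lies in V, dual
  words end in 0, while V has at most q words over each shortened word. If not, V embeds in the
  shortened code, while the dual has at most q words for each word of the shorter dual.\<close>

lemma function_dual_card:
  fixes V :: "(nat \<Rightarrow> 'k::{field,finite}) set"
  assumes "V \<subseteq> supported n" "(\<lambda>_. 0) \<in> V" "\<And>c v w. v \<in> V \<Longrightarrow> w \<in> V \<Longrightarrow> (\<lambda>i. c * v i + w i) \<in> V"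
  shows "card V * card (function_dual n V) \<le> card (UNIV :: 'k set) ^ n"
  using assms
proof (induction n arbitrary: V)
  case 0
  have "supported 0 = {\<lambda>_. 0 :: 'k}" by (auto simp: supported_def)
  then have sub: "V \<subseteq> {\<lambda>_. 0}" "function_dual 0 V \<subseteq> {\<lambda>_. 0}"
    using 0(1) by (auto simp: function_dual_def)
  have "card V \<le> 1" "card (function_dual 0 V) \<le> 1"
    using card_mono[OF _ sub(1)] card_mono[OF _ sub(2)] by simp_all
  then show ?case using mult_le_mono[of "card V" 1 "card (function_dual 0 V)" 1] by simp
next
  case (Suc n)
  define q where "q = card (UNIV :: 'k set)"
  define \<pi> where "\<pi> v = v(n := (0::'k))" for v :: "nat \<Rightarrow> 'k"
  define V' where "V' = \<pi> ` V"
  have finV: "finite V" using Suc.prems(1) finite_supported finite_subset by blast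
  have sup': "V' \<subseteq> supported n"
  proof
    fix w assume "w \<in> V'"
    then obtain v where v: "v \<in> supported (Suc n)" "w = v(n := 0)"
      using Suc.prems(1) by (auto simp: V'_def \<pi>_def)
    have "w i = 0" if "i \<ge> n" for i
      using v that by (cases "i = n") (auto simp: supported_def)
    then show "w \<in> supported n" by (simp add: supported_def)
  qed
  have IH: "card V' * card (function_dual n V') \<le> q ^ n"
    unfolding q_def
  proof (rule Suc.IH[OF sup'])
    have "\<pi> (\<lambda>_. 0) = (\<lambda>_. 0)" by (auto simp: \<pi>_def)
    then show "(\<lambda>_. 0) \<in> V'" unfolding V'_def using Suc.prems(2) by (rule image_eqI[OF sym])
    fix c v w assume "v \<in> V'" "w \<in> V'"
    then obtain v0 w0 where "v0 \<in> V" "v = \<pi> v0" "w0 \<in> V" "w = \<pi> w0" by (auto simp: V'_def)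
    moreover then have "(\<lambda>i. c * v i + w i) = \<pi> (\<lambda>i. c * v0 i + w0 i)" by (auto simp: \<pi>_def)
    ultimately show "(\<lambda>i. c * v i + w i) \<in> V'" using Suc.prems(3) by (auto simp: V'_def)
  qed
  have finV': "finite V'" using finV by (simp add: V'_def)
  have find: "finite (function_dual n V')"
    using finite_supported[of n, where 'k = 'k] by (rule finite_subset[rotated]) (auto simp: function_dual_def)
  have dualI: "w \<in> function_dual n V'"
    if "w \<in> supported n" "\<And>v. v \<in> V \<Longrightarrow> (\<Sum>i<n. v i * w i) = 0" for w
  proof -
    have "(\<Sum>i<n. \<pi> v i * w i) = 0" if "v \<in> V" for v
    proof -
      have "(\<Sum>i<n. \<pi> v i * w i) = (\<Sum>i<n. v i * w i)" by (rule sum.cong) (auto simp: \<pi>_def)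
      then show ?thesis using that \<open>\<And>v. v \<in> V \<Longrightarrow> _\<close> by simp
    qed
    then show ?thesis using that(1) by (auto simp: function_dual_def V'_def)
  qed
  have sumS: "(\<Sum>i<n. v i * w i) + v n * w n = 0" if "w \<in> function_dual (Suc n) V" "v \<in> V" for v w
    using that by (simp add: function_dual_def)
  define e where "e = (\<lambda>i. if i = n then 1 else 0 :: 'k)"
  have "card V * card (function_dual (Suc n) V) \<le> q * (card V' * card (function_dual n V'))"
  proof (cases "e \<in> V")
    case True
    have "function_dual (Suc n) V \<subseteq> function_dual n V'"
    proof
      fix w assume w: "w \<in> function_dual (Suc n) V"
      have "(\<Sum>i<n. e i * w i) = 0" by (rule sum.neutral) (auto simp: e_def)
      then have wn: "w n = 0" using sumS[OF w True] by (simp add: e_def)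
      show "w \<in> function_dual n V'"
      proof (rule dualI)
        have "w i = 0" if "i \<ge> n" for i
        proof (cases "i = n")
          case False
          then have "i \<ge> Suc n" using that by simp
          then show ?thesis using w by (simp add: function_dual_def supported_def)
        qed (use wn in simp)
        then show "w \<in> supported n" by (simp add: supported_def)
        show "(\<Sum>i<n. v i * w i) = 0" if "v \<in> V" for v using sumS[OF w that] wn by simp
      qed
    qed
    then have 1: "card (function_dual (Suc n) V) \<le> card (function_dual n V')" by (rule card_mono[OF find])
    have "inj_on (\<lambda>v. (\<pi> v, v n)) V"
    proof
      fix v w assume "(\<pi> v, v n) = (\<pi> w, w n)"
      then have eq: "\<pi> v = \<pi> w" "v n = w n" by simp_all
      have "v i = w i" for i using fun_cong[OF eq(1), of i] eq(2) by (cases "i = n") (simp_all add: \<pi>_def)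
      then show "v = w" by blast
    qed
    moreover have "(\<lambda>v. (\<pi> v, v n)) ` V \<subseteq> V' \<times> UNIV" by (auto simp: V'_def)
    ultimately have "card V \<le> card (V' \<times> (UNIV :: 'k set))" using finV' by (intro card_inj_on_le) auto
    then have "card V \<le> q * card V'" by (simp add: card_cartesian_product q_def mult.commute)
    from mult_le_mono[OF this 1] show ?thesis by (simp add: mult.assoc)
  next
    case False
    have "inj_on \<pi> V"
    proof (rule inj_onI, rule ccontr)
      fix v w assume vw: "v \<in> V" "w \<in> V" "\<pi> v = \<pi> w" "v \<noteq> w"
      have eq: "v i = w i" if "i \<noteq> n" for i using fun_cong[OF vw(3), of i] that by (simp add: \<pi>_def)
      have ne: "v n - w n \<noteq> 0"
      proof
        assume "v n - w n = 0"
        then have "v i = w i" for i using eq by (cases "i = n") simp_all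
        then show False using vw(4) by blast
      qed
      \<comment> \<open>Two words of V differing only in the last coordinate would have e as a
        scaled difference.\<close>
      have "(\<lambda>i. (- 1) * w i + v i) \<in> V" using Suc.prems(3) vw by blast
      then have "(\<lambda>i. inverse (v n - w n) * ((- 1) * w i + v i) + 0) \<in> V"
        using Suc.prems(2,3) by blast
      moreover have "(\<lambda>i. inverse (v n - w n) * ((- 1) * w i + v i) + 0) = e"
      proof
        show "inverse (v n - w n) * ((- 1) * w i + v i) + 0 = e i" for i
        proof (cases "i = n")
          case True
          then show ?thesis using ne by (simp add: e_def left_inverse)
        next
          case False
          then show ?thesis using eq[OF False] by (simp add: e_def)
        qed
      qed
      ultimately show False using False by simp
    qed
    then have 1: "card V \<le> card V'" unfolding V'_def by (simp add: card_image)
    \<comment> \<open>\<open>base k\<close> is one chosen dual word ending in k. Subtracting it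
      leaves a word ending in 0, so a dual word is determined by its last entry and a word of the
      shorter dual.\<close>
    define base where "base k = (SOME w. w \<in> function_dual (Suc n) V \<and> w n = k)" for k
    have base: "base (w n) \<in> function_dual (Suc n) V \<and> base (w n) n = w n"
      if "w \<in> function_dual (Suc n) V" for w
      unfolding base_def by (rule someI[of _ w]) (use that in simp)
    have "inj_on (\<lambda>w. (w n, \<lambda>i. w i - base (w n) i)) (function_dual (Suc n) V)"
    proof (rule inj_onI)
      fix w w' assume "(w n, \<lambda>i. w i - base (w n) i) = (w' n, \<lambda>i. w' i - base (w' n) i)"
      then have p: "w n = w' n \<and> (\<lambda>i. w i - base (w n) i) = (\<lambda>i. w' i - base (w' n) i)"
        by (rule iffD1[OF prod.inject])
      have "w i = w' i" for i using fun_cong[OF conjunct2[OF p], of i] conjunct1[OF p] by simp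
      then show "w = w'" by blast
    qed
    moreover have "(\<lambda>w. (w n, \<lambda>i. w i - base (w n) i)) ` function_dual (Suc n) V \<subseteq> UNIV \<times> function_dual n V'"
    proof
      fix z assume "z \<in> (\<lambda>w. (w n, \<lambda>i. w i - base (w n) i)) ` function_dual (Suc n) V"
      then obtain w where w: "w \<in> function_dual (Suc n) V" "z = (w n, \<lambda>i. w i - base (w n) i)" by blast
      note b = base[OF w(1)]
      have "(\<lambda>i. w i - base (w n) i) \<in> function_dual n V'"
      proof (rule dualI)
        have 0: "w i - base (w n) i = 0" if "i \<ge> n" for i
        proof (cases "i = n")
          case False
          then have "i \<ge> Suc n" using that by simp
          then show ?thesis
            by (simp only: function_dual_zero[OF w(1)] function_dual_zero[OF conjunct1[OF b]] diff_self)
        qed (use conjunct2[OF b] in \<open>simp only: diff_self\<close>)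
        show "(\<lambda>i. w i - base (w n) i) \<in> supported n"
          unfolding supported_def mem_Collect_eq by (intro allI impI 0)
        fix v assume v: "v \<in> V"
        have "(\<Sum>i<n. v i * w i) = (\<Sum>i<n. v i * base (w n) i)"
        proof (rule add_right_imp_eq)
          have "(\<Sum>i<n. v i * base (w n) i) + v n * w n = 0"
            using sumS[OF conjunct1[OF b] v] unfolding conjunct2[OF b] .
          with sumS[OF w(1) v]
          show "(\<Sum>i<n. v i * w i) + v n * w n = (\<Sum>i<n. v i * base (w n) i) + v n * w n"
            by (simp only:)
        qed
        then show "(\<Sum>i<n. v i * (w i - base (w n) i)) = 0"
          by (simp only: right_diff_distrib sum_subtractf diff_self)
      qed
      then show "z \<in> UNIV \<times> function_dual n V'" using w(2) by simp
    qed
    ultimately have "card (function_dual (Suc n) V) \<le> card ((UNIV :: 'k set) \<times> function_dual n V')"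
      using find by (intro card_inj_on_le) auto
    then have "card (function_dual (Suc n) V) \<le> q * card (function_dual n V')"
      by (simp add: card_cartesian_product q_def)
    from mult_le_mono[OF 1 this] show ?thesis by (simp add: mult.left_commute)
  qed
  also have "\<dots> \<le> q * q ^ n" by (intro mult_left_mono IH) simp
  finally show ?case by (simp add: q_def)
qed

lemma dual_code_card:
  fixes C :: "'k::{field,finite} vec set"
  assumes C: "C \<subseteq> carrier_vec n" "0\<^sub>v n \<in> C" "\<And>c v w. v \<in> C \<Longrightarrow> w \<in> C \<Longrightarrow> c \<cdot>\<^sub>v v + w \<in> C"
  shows "card C * card (dual_code n C) \<le> card (UNIV :: 'k set) ^ n"
proof -
  define h where "h v = (\<lambda>i. if i < n then v $ i else 0)" for v :: "'k vec"
  have inj: "inj_on h (carrier_vec n)"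
  proof
    fix v w assume vw: "v \<in> carrier_vec n" "w \<in> carrier_vec n" "h v = h w"
    show "v = w"
    proof (rule eq_vecI)
      fix i assume "i < dim_vec w"
      then show "v $ i = w $ i" using fun_cong[OF vw(3), of i] vw(2) by (simp add: h_def)
    qed (use vw in simp)
  qed
  have "card (h ` C) * card (function_dual n (h ` C)) \<le> card (UNIV :: 'k set) ^ n"
  proof (rule function_dual_card)
    show "h ` C \<subseteq> supported n" by (auto simp: h_def supported_def)
    have "h (0\<^sub>v n) = (\<lambda>_. 0)" by (auto simp: h_def)
    then show "(\<lambda>_. 0) \<in> h ` C" using C(2) by (rule image_eqI[OF sym])
    fix c v w assume "v \<in> h ` C" "w \<in> h ` C"
    then obtain v0 w0 where 0: "v0 \<in> C" "v = h v0" "w0 \<in> C" "w = h w0" by blast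
    then have car: "v0 \<in> carrier_vec n" "w0 \<in> carrier_vec n" using C(1) by auto
    have "(\<lambda>i. c * v i + w i) = h (c \<cdot>\<^sub>v v0 + w0)" using car by (auto simp: 0 h_def)
    then show "(\<lambda>i. c * v i + w i) \<in> h ` C" using C(3)[OF 0(1,3), of c] by blast
  qed
  moreover have "card (h ` C) = card C" using inj C(1) by (intro card_image) (rule inj_on_subset)
  moreover have "card (h ` dual_code n C) = card (dual_code n C)"
    using inj by (intro card_image) (auto simp: dual_code_def intro: inj_on_subset)
  moreover have "h ` dual_code n C \<subseteq> function_dual n (h ` C)"
  proof
    fix w assume "w \<in> h ` dual_code n C"
    then obtain w0 where w0: "w0 \<in> carrier_vec n" "\<forall>v\<in>C. v \<bullet> w0 = 0" "w = h w0"
      by (auto simp: dual_code_def)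
    have "(\<Sum>i<n. h v i * w i) = v \<bullet> w0" for v
      using w0(1,3) by (auto simp: scalar_prod_def h_def intro!: sum.cong)
    then show "w \<in> function_dual n (h ` C)"
      using w0(2,3) by (auto simp: function_dual_def supported_def h_def)
  qed
  then have "card (h ` dual_code n C) \<le> card (function_dual n (h ` C))"
    using finite_supported[of n, where 'k = 'k]
    by (intro card_mono) (auto simp: function_dual_def intro: finite_subset)
  ultimately have "card (dual_code n C) \<le> card (function_dual n (h ` C))"
    and le: "card C * card (function_dual n (h ` C)) \<le> card (UNIV :: 'k set) ^ n" by simp_all
  then have "card C * card (dual_code n C) \<le> card C * card (function_dual n (h ` C))"
    by (intro mult_le_mono2)
  then show ?thesis using le by (rule order_trans)
qed

section \<open>Lagrange interpolation\<close>

lemma prod_linear: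
  fixes a :: "'i \<Rightarrow> 'k::field"
  assumes "finite I"
  shows "degree (\<Prod>j\<in>I. [:- a j, 1:]) = card I" "lead_coeff (\<Prod>j\<in>I. [:- a j, 1:]) = 1"
proof -
  show "degree (\<Prod>j\<in>I. [:- a j, 1:]) = card I"
    by (subst degree_prod_eq_sum_degree) (use assms in auto)
  show "lead_coeff (\<Prod>j\<in>I. [:- a j, 1:]) = 1"
    by (simp add: lead_coeff_prod)
qed

text \<open>L interpolates b at card I points and both have degree below card I, so L = b. The sum
  is the coefficient of L in degree card I - 1, and that coefficient of b is 0.\<close>

lemma lagrange_sum:
  fixes a :: "'i \<Rightarrow> 'k::field" and b :: "'k poly"
  assumes I: "finite I" "inj_on a I" and b: "b = 0 \<or> degree b + 2 \<le> card I"
  shows "(\<Sum>i\<in>I. poly b (a i) / (\<Prod>j\<in>I - {i}. a i - a j)) = 0"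
proof -
  define h where "h i = (\<Prod>j\<in>I - {i}. [:- a j, 1:])" for i
  define k where "k i = poly b (a i) / (\<Prod>j\<in>I - {i}. a i - a j)" for i
  define L where "L = (\<Sum>i\<in>I. Polynomial.smult (k i) (h i))"
  have deg_h: "degree (h i) = card I - 1" "coeff (h i) (card I - 1) = 1" if "i \<in> I" for i
    using prod_linear[of "I - {i}" a] I that by (simp_all add: h_def)
  have h_at: "poly (h i) (a j) = (if i = j then (\<Prod>l\<in>I - {i}. a i - a l) else 0)"
    if "i \<in> I" "j \<in> I" for i j
  proof (cases "i = j")
    case True
    then show ?thesis by (simp add: h_def poly_prod)
  next
    case False
    then have "\<exists>l\<in>I - {i}. poly [:- a l, 1:] (a j) = 0" using that by (intro bexI[of _ j]) auto
    then show ?thesis using False I(1) by (simp add: h_def poly_prod prod_zero)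
  qed
  have nz: "(\<Prod>j\<in>I - {i}. a i - a j) \<noteq> 0" if "i \<in> I" for i
    using I that by (auto simp: inj_on_def)
  have "L - b = 0"
  proof (rule ccontr)
    assume ne: "L - b \<noteq> 0"
    have root: "poly (L - b) (a i) = 0" if i: "i \<in> I" for i
    proof -
      have "poly L (a i) = (\<Sum>j\<in>I. k j * poly (h j) (a i))" by (simp add: L_def poly_sum)
      also have "\<dots> = (\<Sum>j\<in>I. if j = i then k i * (\<Prod>l\<in>I - {i}. a i - a l) else 0)"
        using h_at i by (intro sum.cong) auto
      also have "\<dots> = poly b (a i)" using I(1) i nz[OF i] by (simp add: k_def)
      finally show ?thesis by simp
    qed
    have I0: "I \<noteq> {}"
    proof
      assume "I = {}"
      then show False using ne b by (simp add: L_def)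
    qed
    have "card I = card (a ` I)" using I by (simp add: card_image)
    also have "\<dots> \<le> card {z. poly (L - b) z = 0}"
      using root poly_roots_finite[OF ne] by (intro card_mono) auto
    also have "\<dots> \<le> degree (L - b)" by (rule card_poly_roots_bound[OF ne])
    also have "\<dots> \<le> card I - 1"
    proof (rule degree_diff_le)
      show "degree L \<le> card I - 1" unfolding L_def
      proof (rule degree_sum_le[OF I(1)])
        fix i assume "i \<in> I"
        then show "degree (Polynomial.smult (k i) (h i)) \<le> card I - 1"
          using degree_smult_le[of "k i" "h i"] deg_h(1) by simp
      qed
      show "degree b \<le> card I - 1" using b by auto
    qed
    finally show False using I0 I(1) card_gt_0_iff[of I] by linarith
  qed
  then have "coeff L (card I - 1) = coeff b (card I - 1)" by simp
  also have "\<dots> = 0" using b by (cases "b = 0") (auto intro: coeff_eq_0)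
  finally have "(\<Sum>i\<in>I. k i * coeff (h i) (card I - 1)) = 0" by (simp add: L_def coeff_sum)
  moreover have "(\<Sum>i\<in>I. k i * coeff (h i) (card I - 1)) = (\<Sum>i\<in>I. k i)"
    by (rule sum.cong[OF refl]) (simp only: deg_h(2) mult_1_right)
  ultimately show ?thesis by (simp add: k_def)
qed

text \<open>Identifies the denominators in \<open>lagrange_sum\<close> with values of the
  derivative.\<close>

lemma pderiv_prod_linear:
  fixes a :: "'i \<Rightarrow> 'k::field"
  assumes "finite I" "i \<in> I"
  shows "poly (pderiv (\<Prod>j\<in>I. [:- a j, 1:])) (a i) = (\<Prod>j\<in>I - {i}. a i - a j)"
proof -
  have eq: "(\<Prod>j\<in>I. [:- a j, 1:]) = [:- a i, 1:] * (\<Prod>j\<in>I - {i}. [:- a j, 1:])"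
    using assms by (rule prod.remove)
  show ?thesis unfolding eq pderiv_mult
    by (simp add: pderiv_pCons poly_prod del: mult_pCons_left)
qed

section \<open>Codes on pairs of conjugate points\<close>

text \<open>m is n/2, and S i is one of the two points over x = a i, the other being its conjugate.
  D occurs as a sum of conjugate pairs, for the trace argument, and as a list, for the coordinates
  of the code.\<close>

locale split_divisor = pointed_curve emb x y f Qinf
  for emb :: "'k::{field,finite} \<Rightarrow> 'f::field" and x y f Qinf +
  fixes m :: nat and S :: "nat \<Rightarrow> 'f set" and a :: "nat \<Rightarrow> 'k" and g :: "'k poly" and c :: 'k
    and D :: "'f set \<Rightarrow>\<^sub>0 int" and Ts :: "'f set list"
  assumes m: "m \<ge> 3"
    and S_place: "i \<in> {1..m} \<Longrightarrow> S i \<in> places emb UNIV"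
    and S_over: "i \<in> {1..m} \<Longrightarrow> x - emb (a i) \<in> S i"
    and S_unramified: "i \<in> {1..m} \<Longrightarrow> y \<notin> S i"
    and S_split: "i \<in> {1..m} \<Longrightarrow> bar -` S i \<noteq> S i"
    and inj_a: "inj_on a {1..m}"
    and g: "g = Polynomial.smult c (\<Prod>i\<in>{1..m}. [:- a i, 1:])" "c \<noteq> 0"
    and D: "D = (\<Sum>i\<in>{1..m}. frag_of (S i) + frag_of (bar -` S i))"
    and Ts: "distinct Ts" "D = sum_list (map frag_of Ts)"
    and pdiv_g: "pdiv emb (pv g) = D - frag_cmul (2 * int m) (frag_of Qinf)"
begin

lemma lookup_D: "Poly_Mapping.lookup D T = (if T \<in> set Ts then 1 else 0)"
proof -
  have "Poly_Mapping.lookup (sum_list (map frag_of Us)) T = (if T \<in> set Us then 1 else 0)"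
    if "distinct Us" for Us
    using that by (induction Us) (auto simp: lookup_add)
  then show ?thesis using Ts by simp
qed

lemma keys_D: "Poly_Mapping.keys D = set Ts"
  by (auto simp: in_keys_iff lookup_D split: if_splits)

text \<open>Both sides are the linear extension of h evaluated at D, which turns a sum over
  coordinates into a sum over conjugate pairs.\<close>

lemma sum_Ts:
  fixes h :: "'f set \<Rightarrow> 'b::comm_ring_1"
  shows "(\<Sum>T\<in>set Ts. h T) = (\<Sum>i\<in>{1..m}. h (S i) + h (bar -` S i))"
proof -
  have "frag_sum h D = (\<Sum>T\<in>set Ts. h T)"
    by (simp only: Ts(2) sum_list_distinct_conv_sum_set[OF Ts(1)] frag_sum_sum frag_sum_of)
  moreover have "frag_sum h D = (\<Sum>i\<in>{1..m}. h (S i) + h (bar -` S i))"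
    unfolding D by (simp add: frag_sum_sum frag_sum_add)
  ultimately show ?thesis by simp
qed

text \<open>\<open>sum_Ts\<close> for the constant 1, taken in the integers because in K it would
  only count modulo the characteristic.\<close>

lemma card_Ts: "card (set Ts) = 2 * m" "length Ts = 2 * m"
proof -
  have "int (card (set Ts)) = int (2 * m)" using sum_Ts[of "\<lambda>_. 1 :: int"] by simp
  then show "card (set Ts) = 2 * m" by (simp only: of_nat_eq_iff)
  then show "length Ts = 2 * m" using distinct_card[OF Ts(1)] by simp
qed

lemma Ts_cases:
  assumes "T \<in> set Ts"
  obtains i where "i \<in> {1..m}" "T = S i \<or> T = bar -` S i"
proof -
  have "\<exists>i\<in>{1..m}. T = S i \<or> T = bar -` S i"
  proof (rule ccontr)
    assume no: "\<not> ?thesis"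
    have "Poly_Mapping.lookup D T = 0"
      unfolding D lookup_sum by (rule sum.neutral) (use no in \<open>auto simp: lookup_add\<close>)
    then show False using assms by (simp add: lookup_D)
  qed
  then show ?thesis using that by blast
qed

lemma Ts_split:
  assumes "T \<in> set Ts"
  shows "\<exists>i\<in>{1..m}. T \<in> places emb UNIV \<and> x - emb (a i) \<in> T \<and> y \<notin> T \<and> bar -` T \<noteq> T"
proof -
  obtain i where i: "i \<in> {1..m}" "T = S i \<or> T = bar -` S i" by (rule Ts_cases[OF assms])
  note Si = S_place[OF i(1)] S_over[OF i(1)] S_unramified[OF i(1)] S_split[OF i(1)]
  interpret curve_place emb x y f "S i" by (rule curve_place_I[OF Si(1)])
  have "bar -` S i \<in> places emb UNIV" by (rule bar_place(1)[OF Si(1)])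
  moreover have "bar (x - emb (a i)) = x - emb (a i)" using bar_Kx Kx_closed(3)[OF x_Kx emb_Kx] by blast
  then have "x - emb (a i) \<in> bar -` S i" using Si(2) by simp
  moreover have "y \<notin> bar -` S i" using Si(3) by simp
  moreover have "bar -` (bar -` S i) \<noteq> bar -` S i"
  proof -
    have "bar -` (bar -` S i) = S i" by auto
    then show ?thesis using Si(4) by simp
  qed
  ultimately show ?thesis using i Si by blast
qed

lemma Ts_place: "T \<in> set Ts \<Longrightarrow> T \<in> places emb UNIV"
  using Ts_split by blast

lemma Ts_residue:
  assumes "T \<in> set Ts" "z \<in> place_ring UNIV T"
  shows "\<exists>c. z - emb c \<in> T"
proof -
  obtain i where T: "T \<in> places emb UNIV" "x - emb (a i) \<in> T" "y \<notin> T" "bar -` T \<noteq> T"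
    using Ts_split[OF assms(1)] by blast
  interpret curve_place emb x y f T by (rule curve_place_I[OF T(1)])
  obtain b where "\<forall>z\<in>A. has_residue z" by (rule split_place[OF T(2-4)])
  then show ?thesis using assms(2) unfolding has_residue_def by blast
qed

lemma Ts_degree: "T \<in> set Ts \<Longrightarrow> place_degree emb UNIV T = 1"
proof -
  assume T: "T \<in> set Ts"
  interpret curve_place emb x y f T by (rule curve_place_I[OF Ts_place[OF T]])
  show ?thesis by (rule place_degree_one) (rule Ts_residue[OF T])
qed

lemma Ts_neq_Qinf: "T \<in> set Ts \<Longrightarrow> T \<noteq> Qinf"
proof -
  assume T: "T \<in> set Ts"
  interpret curve_place emb x y f T by (rule curve_place_I[OF Ts_place[OF T]])
  obtain i where "x - emb (a i) \<in> T" using Ts_split[OF T] by blast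
  from A_add[OF P_in_A[OF this] A_emb[of "a i"]] have "x \<in> A" by simp
  then show ?thesis using x_regular_iff[OF Ts_place[OF T]] by simp
qed

lemma residue_ops:
  assumes "T \<in> set Ts" "z \<in> place_ring UNIV T" "w \<in> place_ring UNIV T"
  shows "residue_at emb T (z + w) = residue_at emb T z + residue_at emb T w"
    "residue_at emb T (z * w) = residue_at emb T z * residue_at emb T w"
    "residue_at emb T (z - w) = residue_at emb T z - residue_at emb T w"
    "residue_at emb T z = 0 \<longleftrightarrow> z \<in> T" "residue_at emb T (emb k) = k"
    "z \<notin> T \<Longrightarrow> residue_at emb T (inverse z) = inverse (residue_at emb T z)"
    "z - emb (residue_at emb T z) \<in> T" "z - emb k \<in> T \<Longrightarrow> residue_at emb T z = k"
proof -
  interpret curve_place emb x y f T by (rule curve_place_I[OF Ts_place[OF assms(1)]])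
  have z: "has_residue z" "has_residue w" using Ts_residue assms unfolding has_residue_def by auto
  show 1: "residue_at emb T (z + w) = residue_at emb T z + residue_at emb T w" by (rule residue_at_add[OF z])
  show "residue_at emb T (z * w) = residue_at emb T z * residue_at emb T w" by (rule residue_at_mult[OF z])
  have "(z + - w) - emb (residue_at emb T z + - residue_at emb T w) \<in> T"
    by (intro residue_add_cong residue_uminus_cong residue_at_diff z)
  then show "residue_at emb T (z - w) = residue_at emb T z - residue_at emb T w"
    using residue_at_eq by (simp flip: diff_conv_add_uminus)
  show 0: "residue_at emb T z = 0 \<longleftrightarrow> z \<in> T" by (rule residue_at_0_iff[OF z(1)])
  show "residue_at emb T (emb k) = k" by simp
  show "residue_at emb T (inverse z) = inverse (residue_at emb T z)" if "z \<notin> T"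
    by (rule residue_at_eq[OF residue_inverse_cong[OF residue_at_diff[OF z(1)]]]) (use 0 that in simp)
  show "z - emb (residue_at emb T z) \<in> T" by (rule residue_at_diff[OF z(1)])
  show "z - emb k \<in> T \<Longrightarrow> residue_at emb T z = k" by (rule residue_at_eq)
qed

definition disjoint_Ts :: "('f set \<Rightarrow>\<^sub>0 int) \<Rightarrow> bool" where
  "disjoint_Ts X \<longleftrightarrow> X \<in> divisors emb \<and> (\<forall>T\<in>set Ts. Poly_Mapping.lookup X T = 0)"

lemma disjoint_Ts_diff: "disjoint_Ts X \<Longrightarrow> disjoint_Ts Y \<Longrightarrow> disjoint_Ts (X - Y)"
  and disjoint_Ts_add: "disjoint_Ts X \<Longrightarrow> disjoint_Ts Y \<Longrightarrow> disjoint_Ts (X + Y)"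
  by (auto simp: disjoint_Ts_def divisors_diff divisors_add lookup_minus lookup_add)

lemma disjoint_Ts_of: "Q \<in> places emb UNIV \<Longrightarrow> Q \<notin> set Ts \<Longrightarrow> disjoint_Ts (frag_of Q)"
  by (auto simp: disjoint_Ts_def divisors_of)

lemma RR_regular:
  assumes "disjoint_Ts X" "z \<in> RR_space emb X" "T \<in> set Ts"
  shows "z \<in> place_ring UNIV T"
proof -
  interpret curve_place emb x y f T by (rule curve_place_I[OF Ts_place[OF assms(3)]])
  have X: "X \<in> divisors emb" "Poly_Mapping.lookup X T = 0" using assms by (auto simp: disjoint_Ts_def)
  have "z = 0 \<or> 0 \<le> v z + Poly_Mapping.lookup X T"
    using assms(2) Ts_place[OF assms(3)] unfolding RR_iff[OF X(1)] by blast
  then show ?thesis using v_A[of z] X(2) by (cases "z = 0") simp_all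
qed

text \<open>Each prescribed zero costs exactly one degree: the points have degree 1, and X has
  coefficient 0 there.\<close>

lemma RR_vanish:
  assumes X: "disjoint_Ts X" and z: "z \<in> RR_space emb X" and U: "U \<subseteq> set Ts"
    and van: "\<And>T. T \<in> U \<Longrightarrow> residue_at emb T z = 0"
  shows "X - (\<Sum>T\<in>U. frag_of T) \<in> divisors emb" "z \<in> RR_space emb (X - (\<Sum>T\<in>U. frag_of T))"
    "div_degree emb (X - (\<Sum>T\<in>U. frag_of T)) = div_degree emb X - int (card U)"
proof -
  have Xd: "X \<in> divisors emb" using X by (simp add: disjoint_Ts_def)
  have finU: "finite U" using U finite_subset by blast
  have lk: "Poly_Mapping.lookup (\<Sum>T\<in>U. frag_of T) Q = (if Q \<in> U then 1 else 0)" for Q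
    using finU by (simp add: lookup_sum)
  show d: "X - (\<Sum>T\<in>U. frag_of T) \<in> divisors emb"
    using Xd U Ts_place unfolding divisors_iff by (auto simp: lookup_minus lk)
  have "div_degree emb (\<Sum>T\<in>U. frag_of T) = (\<Sum>T\<in>U. int (place_degree emb UNIV T))"
    by (simp add: div_degree_eq frag_sum_sum)
  also have "\<dots> = (\<Sum>T\<in>U. 1)" using U Ts_degree by (intro sum.cong) auto
  finally show "div_degree emb (X - (\<Sum>T\<in>U. frag_of T)) = div_degree emb X - int (card U)"
    by (simp add: div_degree_diff)
  show "z \<in> RR_space emb (X - (\<Sum>T\<in>U. frag_of T))"
  proof (cases "z = 0")
    case False
    have "0 \<le> place_val UNIV Q z + Poly_Mapping.lookup (X - (\<Sum>T\<in>U. frag_of T)) Q"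
      if Q: "Q \<in> places emb UNIV" for Q
    proof (cases "Q \<in> U")
      case True
      then have QT: "Q \<in> set Ts" using U by blast
      interpret curve_place emb x y f Q by (rule curve_place_I[OF Q])
      have "z \<in> A" by (rule RR_regular[OF X z QT])
      then have "z \<in> Q" using residue_ops(4)[OF QT] van[OF True] by blast
      then have "v z > 0" using v_P[of z] False by simp
      moreover have "Poly_Mapping.lookup X Q = 0" using X QT by (simp add: disjoint_Ts_def)
      ultimately show ?thesis using True by (simp add: lookup_minus lk)
    next
      case nU: False
      then show ?thesis using z Q False unfolding RR_iff[OF Xd] by (simp add: lookup_minus lk)
    qed
    then show ?thesis unfolding RR_iff[OF d] by blast
  qed simp
qed

lemma RR_many_zeros:
  assumes "disjoint_Ts X" "z \<in> RR_space emb X" "U \<subseteq> set Ts" "\<And>T. T \<in> U \<Longrightarrow> residue_at emb T z = 0"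
    "div_degree emb X < int (card U)"
  shows "z = 0"
  using RR_negative[OF RR_vanish(1)[OF assms(1-4)] _ RR_vanish(2)[OF assms(1-4)]]
    RR_vanish(3)[OF assms(1-4)] assms(5) by simp

section \<open>Evaluation at the points of D\<close>

definition ev :: "'f \<Rightarrow> 'k vec" where
  "ev z = vec (length Ts) (\<lambda>i. residue_at emb (Ts ! i) z)"

lemma goppa_code_eq: "goppa_code emb Ts X = ev ` RR_space emb X"
  unfolding goppa_code_def ev_def by blast

lemma ev_eq_iff: "ev z = ev w \<longleftrightarrow> (\<forall>T\<in>set Ts. residue_at emb T z = residue_at emb T w)"
  unfolding ev_def vec_eq_iff all_set_conv_all_nth by auto

lemma ev_scalar_prod: "ev z \<bullet> ev w = (\<Sum>T\<in>set Ts. residue_at emb T z * residue_at emb T w)"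
proof -
  have "ev z \<bullet> ev w = (\<Sum>i<length Ts. residue_at emb (Ts ! i) z * residue_at emb (Ts ! i) w)"
    by (simp add: ev_def scalar_prod_def lessThan_atLeast0)
  also have "\<dots> = (\<Sum>T\<in>set Ts. residue_at emb T z * residue_at emb T w)"
    using Ts(1) by (intro sum.reindex_bij_betw[OF bij_betw_nth]) auto
  finally show ?thesis .
qed

lemma ev_inj:
  assumes X: "disjoint_Ts X" and deg: "div_degree emb X < 2 * int m"
  shows "inj_on ev (RR_space emb X)"
proof
  fix z w assume z: "z \<in> RR_space emb X" and w: "w \<in> RR_space emb X" and eq: "ev z = ev w"
  have Xd: "X \<in> divisors emb" using X by (simp add: disjoint_Ts_def)
  have "z - w = 0"
  proof (rule RR_many_zeros[OF X RR_diff[OF Xd z w] subset_refl])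
    show "residue_at emb T (z - w) = 0" if "T \<in> set Ts" for T
      using residue_ops(3)[OF that RR_regular[OF X z that] RR_regular[OF X w that]] eq that
      by (simp add: ev_eq_iff)
  qed (use deg card_Ts in simp)
  then show "z = w" by simp
qed

lemma ev_carrier: "ev ` V \<subseteq> carrier_vec (2 * m)"
  by (auto simp: ev_def card_Ts)

lemma finite_carrier_vec: "finite (carrier_vec (2 * m) :: 'k vec set)"
proof -
  have "(carrier_vec (2 * m) :: 'k vec set) \<subseteq> vec_of_list ` {xs. set xs \<subseteq> UNIV \<and> length xs = 2 * m}"
  proof
    fix v :: "'k vec" assume "v \<in> carrier_vec (2 * m)"
    then have "v = vec_of_list (list_of_vec v)" "length (list_of_vec v) = 2 * m"
      by (simp_all add: vec_list)
    then show "v \<in> vec_of_list ` {xs. set xs \<subseteq> UNIV \<and> length xs = 2 * m}" by blast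
  qed
  then show ?thesis by (rule finite_subset) (intro finite_imageI finite_lists_length_eq, simp)
qed

lemma finite_ev: "finite (ev ` V)"
  using ev_carrier finite_carrier_vec finite_subset by blast

text \<open>Evaluation embeds L(X) in the finite set of words of length 2 m; this is the source of
  all upper bounds.\<close>

lemma finite_RR: "disjoint_Ts X \<Longrightarrow> div_degree emb X < 2 * int m \<Longrightarrow> finite (RR_space emb X)"
  using finite_ev ev_inj finite_imageD by blast

lemma card_RR_disjoint:
  assumes "disjoint_Ts X" "int d \<le> div_degree emb X" "div_degree emb X < 2 * int m"
  shows "card (UNIV :: 'k set) ^ d \<le> card (RR_space emb X)"
    "card (UNIV :: 'k set) ^ d \<le> card (ev ` RR_space emb X)"
proof -
  have "X \<in> divisors emb" using assms(1) by (simp add: disjoint_Ts_def)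
  from card_RR[OF this finite_RR[OF assms(1,3)] assms(2)]
  show "card (UNIV :: 'k set) ^ d \<le> card (RR_space emb X)" .
  then show "card (UNIV :: 'k set) ^ d \<le> card (ev ` RR_space emb X)"
    by (simp add: card_image[OF ev_inj[OF assms(1,3)]])
qed

lemma ev_add_mult:
  assumes "\<And>T. T \<in> set Ts \<Longrightarrow> z \<in> place_ring UNIV T" "\<And>T. T \<in> set Ts \<Longrightarrow> w \<in> place_ring UNIV T"
  shows "ev (emb k * z + w) = k \<cdot>\<^sub>v ev z + ev w"
proof -
  have "residue_at emb T (emb k * z + w) = k * residue_at emb T z + residue_at emb T w" if T: "T \<in> set Ts" for T
  proof -
    interpret curve_place emb x y f T by (rule curve_place_I[OF Ts_place[OF T]])
    have "residue_at emb T (emb k * z) = k * residue_at emb T z"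
      using residue_ops(2)[OF T A_emb[of k] assms(1)[OF T]] by simp
    then show ?thesis using residue_ops(1)[OF T A_mult[OF A_emb[of k] assms(1)[OF T]] assms(2)[OF T]] by simp
  qed
  then show ?thesis by (auto simp: ev_def intro!: eq_vecI)
qed

lemma code_closed:
  assumes "disjoint_Ts X"
  shows "0\<^sub>v (2 * m) \<in> ev ` RR_space emb X"
    "v \<in> ev ` RR_space emb X \<Longrightarrow> w \<in> ev ` RR_space emb X \<Longrightarrow> k \<cdot>\<^sub>v v + w \<in> ev ` RR_space emb X"
proof -
  have Xd: "X \<in> divisors emb" using assms by (simp add: disjoint_Ts_def)
  have "residue_at emb T 0 = 0" if "T \<in> set Ts" for T
  proof -
    interpret curve_place emb x y f T by (rule curve_place_I[OF Ts_place[OF that]])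
    show ?thesis by simp
  qed
  then have "ev 0 = 0\<^sub>v (2 * m)" by (intro eq_vecI) (simp_all add: ev_def card_Ts)
  then show "0\<^sub>v (2 * m) \<in> ev ` RR_space emb X" using RR_0 by (metis imageI)
  assume "v \<in> ev ` RR_space emb X" "w \<in> ev ` RR_space emb X"
  then obtain z z' where z: "v = ev z" "z \<in> RR_space emb X" "w = ev z'" "z' \<in> RR_space emb X" by blast
  have "k \<cdot>\<^sub>v v + w = ev (emb k * z + z')"
    unfolding z using ev_add_mult RR_regular[OF assms] z by simp
  then show "k \<cdot>\<^sub>v v + w \<in> ev ` RR_space emb X" using RR_closed[OF Xd z(2,4)] by blast
qed

lemma card_dual_le:
  assumes "disjoint_Ts X" "card (UNIV :: 'k set) ^ m \<le> card (ev ` RR_space emb X)"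
  shows "card (dual_code (2 * m) (ev ` RR_space emb X)) \<le> card (UNIV :: 'k set) ^ m"
proof -
  let ?q = "card (UNIV :: 'k set) ^ m" and ?d = "card (dual_code (2 * m) (ev ` RR_space emb X))"
  have q: "?q > 0" by (simp add: card_gt_0_iff)
  have "?q * ?d \<le> card (ev ` RR_space emb X) * ?d" using assms(2) by (rule mult_le_mono1)
  also have "\<dots> \<le> card (UNIV :: 'k set) ^ (2 * m)"
    by (rule dual_code_card[OF ev_carrier code_closed(1)[OF assms(1)]]) (rule code_closed(2)[OF assms(1)])
  also have "\<dots> = ?q * ?q" by (simp add: mult_2 power_add)
  finally show ?thesis by (simp only: nat_mult_le_cancel1[OF q])
qed

section \<open>The residue theorem for dg/g\<close>

definition "g' = pderiv g"

lemma g'_at: "i \<in> {1..m} \<Longrightarrow> poly g' (a i) = c * (\<Prod>j\<in>{1..m} - {i}. a i - a j)"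
proof -
  assume i: "i \<in> {1..m}"
  have "g' = Polynomial.smult c (pderiv (\<Prod>i\<in>{1..m}. [:- a i, 1:]))"
    unfolding g'_def by (subst g(1)) (rule pderiv_smult)
  then show ?thesis by (simp only: poly_smult pderiv_prod_linear[OF finite_atLeastAtMost i])
qed

lemma g'_at_nz:
  assumes "i \<in> {1..m}"
  shows "poly g' (a i) \<noteq> 0"
proof -
  have "a i - a j \<noteq> 0" if "j \<in> {1..m} - {i}" for j
    using inj_onD[OF inj_a, of i j] assms that by auto
  then have "(\<Prod>j\<in>{1..m} - {i}. a i - a j) \<noteq> 0" by (subst prod_zero_iff) auto
  then show ?thesis using g(2) by (simp only: g'_at[OF assms] mult_eq_0_iff) simp
qed

lemma g'_nz: "g' \<noteq> 0"
  using g'_at_nz[of 1] m by auto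

definition "\<eta> = pv g' * y"

lemma eta_nz: "\<eta> \<noteq> 0"
  by (simp add: \<eta>_def g'_nz)

text \<open>The divisor of the differential \<open>dg/g = g' y dx/(g y)\<close> plus \<open>D\<close>; here \<open>dx/y\<close> has divisor \<open>0\<close>.\<close>

definition residual :: "'f set \<Rightarrow>\<^sub>0 int" where
  "residual = pdiv emb \<eta> + frag_cmul (2 * int m) (frag_of Qinf)"

lemma pv_residue:
  assumes "x - emb k \<in> T" "T \<in> places emb UNIV"
  shows "pv p - emb (poly p k) \<in> T"
proof -
  interpret curve_place emb x y f T by (rule curve_place_I[OF assms(2)])
  have xA: "x \<in> A" using A_add[OF P_in_A[OF assms(1)] A_emb[of k]] by simp
  obtain q where "pv p = emb (poly p k) + (x - emb k) * pv q" using peval_minus_linear by blast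
  then show ?thesis using P_mult2[OF assms(1) A_peval[OF xA, of q]] by simp
qed

lemma eta_unit:
  assumes "T \<in> set Ts"
  shows "\<eta> \<in> place_ring UNIV T" "\<eta> \<notin> T" "y \<in> place_ring UNIV T" "pv p \<in> place_ring UNIV T" "pv g' \<notin> T"
proof -
  obtain i where i: "i \<in> {1..m}" "x - emb (a i) \<in> T" "y \<notin> T" using Ts_split[OF assms] by blast
  interpret curve_place emb x y f T by (rule curve_place_I[OF Ts_place[OF assms]])
  have xA: "x \<in> A" using A_add[OF P_in_A[OF i(2)] A_emb[of "a i"]] by simp
  show yA: "y \<in> A" by (rule y_in_A[OF xA])
  show pA: "pv p \<in> A" for p by (rule A_peval[OF xA])
  show gT: "pv g' \<notin> T"
  proof
    assume "pv g' \<in> T"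
    from P_diff[OF this pv_residue[OF i(2) Ts_place[OF assms], of g']]
    show False using g'_at_nz[OF i(1)] by simp
  qed
  show "\<eta> \<in> A" unfolding \<eta>_def by (intro A_mult pA yA)
  show "\<eta> \<notin> T" unfolding \<eta>_def using unit_mult[OF pA gT yA i(3)] .
qed

lemma residual_disjoint: "disjoint_Ts residual" "div_degree emb residual = 2 * int m * int (place_degree emb UNIV Qinf)"
proof -
  have "Poly_Mapping.lookup residual T = 0" if T: "T \<in> set Ts" for T
  proof -
    interpret curve_place emb x y f T by (rule curve_place_I[OF Ts_place[OF T]])
    have "v \<eta> = 0" using v_unit[of \<eta>] eta_nz eta_unit(1,2)[OF T] by simp
    then show ?thesis
      using Ts_neq_Qinf[OF T] Ts_place[OF T] eta_nz by (simp add: residual_def lookup_add lookup_pdiv)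
  qed
  moreover have "residual \<in> divisors emb"
    unfolding residual_def by (intro divisors_add pdiv_divisors divisors_cmul divisors_of Qinf eta_nz)
  ultimately show "disjoint_Ts residual" by (simp add: disjoint_Ts_def)
  show "div_degree emb residual = 2 * int m * int (place_degree emb UNIV Qinf)"
    by (simp add: residual_def div_degree_add div_degree_cmul div_degree_of degree_pdiv[OF eta_nz])
qed

text \<open>s \<eta> has poles only at infinity, of order at most 2m. For its y-part this means 2
  deg b + 3 \<le> 2m, and parity sharpens it to deg b + 2 \<le> m, exactly the bound in
  \<open>lagrange_sum\<close>.\<close>

lemma residual_repr:
  assumes "s \<in> RR_space emb residual"
  shows "\<exists>b0 b. s * \<eta> = pv b0 + pv b * y \<and> (b = 0 \<or> degree b + 2 \<le> m)"
proof (cases "s = 0")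
  case True
  then show ?thesis by (intro exI[of _ 0]) simp
next
  case False
  have "effective (pdiv emb s + residual)" using assms False by (simp add: RR_space_def)
  then have eff: "0 \<le> Poly_Mapping.lookup (pdiv emb (s * \<eta>)) Q + 2 * int m * (if Q = Qinf then 1 else 0)" for Q
    using False eta_nz by (simp add: effective_def residual_def pdiv_mult lookup_add add.assoc)
  have "\<exists>b0 b. s * \<eta> = pv b0 + pv b * y \<and> (b0 = 0 \<or> 2 * degree b0 \<le> 2 * m) \<and> (b = 0 \<or> 2 * degree b + 3 \<le> 2 * m)"
  proof (rule pole_order_repr)
    show "s * \<eta> = 0 \<or> 0 \<le> place_val UNIV Q (s * \<eta>)" if "Q \<in> places emb UNIV" "Q \<noteq> Qinf" for Q
      using eff[of Q] that False eta_nz by (simp add: lookup_pdiv)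
    show "s * \<eta> = 0 \<or> - int (2 * m) \<le> place_val UNIV Qinf (s * \<eta>)"
      using eff[of Qinf] Qinf False eta_nz by (simp add: lookup_pdiv)
  qed
  then obtain b0 b where b: "s * \<eta> = pv b0 + pv b * y" "b = 0 \<or> 2 * degree b + 3 \<le> 2 * m" by blast
  then have "b = 0 \<or> degree b + 2 \<le> m" by auto
  then show ?thesis using b(1) by blast
qed

text \<open>
  The residue theorem for \<open>s dg/g\<close>: adding the residues at the two points over \<open>x = a i\<close> leaves the
  trace of \<open>s\<close>, which is \<open>2 b/g'\<close>, and Lagrange interpolation applies as \<open>deg b \<le> deg g - 2\<close>.
\<close>

lemma residue_sum:
  assumes s: "s \<in> RR_space emb residual"
  shows "(\<Sum>T\<in>set Ts. residue_at emb T s) = 0"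
proof -
  obtain b0 b where b: "s * \<eta> = pv b0 + pv b * y" "b = 0 \<or> degree b + 2 \<le> m"
    using residual_repr[OF s] by blast
  \<comment> \<open>Conjugation changes the sign of \<eta>, so subtracting the conjugate of s \<eta>
    = b0 + b y gives (s + bar s) \<eta> = 2 b y.\<close>
  have trace: "(s + bar s) * pv g' = 2 * pv b"
  proof -
    have "bar s * bar \<eta> = bar (pv b0 + pv b * y)" by (simp only: b(1)[symmetric] bar_mult)
    then have "bar s * (pv g' * (- y)) = pv b0 - pv b * y"
      using bar_eq[OF pv_Kx pv_Kx, of b0 b] by (simp add: \<eta>_def bar_mult)
    moreover have "bar s * (pv g' * y) = - (bar s * (pv g' * (- y)))" by simp
    ultimately have B: "bar s * (pv g' * y) = - (pv b0 - pv b * y)" by (simp only:)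
    have A: "s * (pv g' * y) = pv b0 + pv b * y" using b(1) by (simp add: \<eta>_def)
    have "((s + bar s) * pv g') * y = s * (pv g' * y) + bar s * (pv g' * y)"
      by (simp only: distrib_right mult.assoc)
    also have "\<dots> = (2 * pv b) * y" unfolding A B by simp
    finally have "((s + bar s) * pv g') * y = (2 * pv b) * y" .
    then show ?thesis using y_nz by (simp only: mult_cancel_right) simp
  qed
  have pair: "residue_at emb (S i) s + residue_at emb (bar -` S i) s = (2 / c) * (poly b (a i) / (\<Prod>j\<in>{1..m} - {i}. a i - a j))"
    if i: "i \<in> {1..m}" for i
  proof -
    have ST: "S i \<in> set Ts" "bar -` S i \<in> set Ts"
    proof -
      have pos: "Poly_Mapping.lookup D T > 0" if "T = S i \<or> T = bar -` S i" for T
        unfolding D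
        by (rule lookup_sum_pairs_pos[where a = S and b = "\<lambda>i. bar -` S i", OF finite_atLeastAtMost i that])
      show "S i \<in> set Ts" using pos[of "S i"] by (simp add: lookup_D split: if_splits)
      show "bar -` S i \<in> set Ts" using pos[of "bar -` S i"] by (simp add: lookup_D split: if_splits)
    qed
    interpret curve_place emb x y f "S i" by (rule curve_place_I[OF S_place[OF i]])
    have sA: "s \<in> A" by (rule RR_regular[OF residual_disjoint(1) s ST(1)])
    have "s \<in> place_ring UNIV (bar -` S i)" by (rule RR_regular[OF residual_disjoint(1) s ST(2)])
    then have bA: "bar s \<in> A" using bar_place(2)[OF S_place[OF i]] by simp
    \<comment> \<open>The value of s at the conjugate point is the value of the conjugate of s at S
      i.\<close>
    have "residue_at emb (bar -` S i) s = residue_at emb (S i) (bar s)"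
      unfolding residue_at_def by (simp add: bar_diff)
    then have 1: "residue_at emb (S i) s + residue_at emb (bar -` S i) s = residue_at emb (S i) (s + bar s)"
      using residue_ops(1)[OF ST(1) sA bA] by simp
    have res_pv: "residue_at emb (S i) (pv p) = poly p (a i)" for p
      by (rule residue_ops(8)[OF ST(1) eta_unit(4)[OF ST(1)] eta_unit(4)[OF ST(1)]])
        (rule pv_residue[OF S_over[OF i] S_place[OF i]])
    have "residue_at emb (S i) (s + bar s) * poly g' (a i) = residue_at emb (S i) ((s + bar s) * pv g')"
      using residue_ops(2)[OF ST(1) A_add[OF sA bA] eta_unit(4)[OF ST(1)]] res_pv by simp
    also have "\<dots> = residue_at emb (S i) (pv (b + b))" unfolding trace by (simp only: mult_2 peval_add)
    also have "\<dots> = 2 * poly b (a i)" unfolding res_pv by simp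
    finally show ?thesis unfolding 1 using g'_at[OF i] g'_at_nz[OF i] g(2) by (simp add: field_simps)
  qed
  have "(\<Sum>T\<in>set Ts. residue_at emb T s) = (\<Sum>i\<in>{1..m}. residue_at emb (S i) s + residue_at emb (bar -` S i) s)"
    by (rule sum_Ts)
  also have "\<dots> = (\<Sum>i\<in>{1..m}. (2 / c) * (poly b (a i) / (\<Prod>j\<in>{1..m} - {i}. a i - a j)))"
    by (rule sum.cong[OF refl pair])
  also have "\<dots> = (2 / c) * (\<Sum>i\<in>{1..m}. poly b (a i) / (\<Prod>j\<in>{1..m} - {i}. a i - a j))"
    by (simp only: sum_distrib_left)
  also have "\<dots> = 0" using lagrange_sum[OF _ inj_a, of b] b(2) by simp
  finally show ?thesis .
qed

text \<open>s lies in L(residual - D), and residual - D = (\<eta>) - (g) is principal: s \<eta>/g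
  has no poles, hence is constant.\<close>

lemma vanishing_residual:
  assumes s: "s \<in> RR_space emb residual" and van: "\<And>T. T \<in> set Ts \<Longrightarrow> residue_at emb T s = 0"
  shows "\<exists>k. s = emb k * (pv g / \<eta>)"
proof (cases "s = 0")
  case True
  then show ?thesis by (intro exI[of _ 0]) simp
next
  case False
  have gnz: "pv g \<noteq> 0"
  proof -
    have "g \<noteq> 0" using g'_nz by (auto simp: g'_def)
    then show ?thesis by simp
  qed
  have DT: "(\<Sum>T\<in>set Ts. frag_of T) = D"
    using Ts by (simp add: sum_list_distinct_conv_sum_set)
  have "s \<in> RR_space emb (residual - D)"
    using RR_vanish(2)[OF residual_disjoint(1) s subset_refl van] unfolding DT by blast
  then have "effective (pdiv emb s + (residual - D))" using False by (simp add: RR_space_def)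
  moreover have "pdiv emb (s * \<eta> / pv g) = pdiv emb s + (residual - D)"
    using False eta_nz gnz by (simp add: pdiv_divide pdiv_mult pdiv_g residual_def)
  ultimately have eff: "0 \<le> Poly_Mapping.lookup (pdiv emb (s * \<eta> / pv g)) Q" for Q
    by (simp only: effective_def)
  have nz: "s * \<eta> / pv g \<noteq> 0" using False eta_nz gnz by simp
  have val: "0 \<le> place_val UNIV Q (s * \<eta> / pv g)" if "Q \<in> places emb UNIV" for Q
    using eff[of Q] that by (simp only: lookup_pdiv[OF nz] if_True)
  have "\<exists>b0 b. s * \<eta> / pv g = pv b0 + pv b * y \<and> (b0 = 0 \<or> 2 * degree b0 \<le> 0) \<and> (b = 0 \<or> 2 * degree b + 3 \<le> 0)"
    by (rule pole_order_repr) (use val Qinf in simp_all)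
  then obtain b0 where b0: "s * \<eta> / pv g = pv b0" "degree b0 = 0" by auto
  obtain k where "b0 = [:k:]" using b0(2) degree_0_id by metis
  then have "s * \<eta> / pv g = emb k" using b0(1) by simp
  then have "s = emb k * (pv g / \<eta>)" using gnz eta_nz by (simp add: field_simps)
  then show ?thesis by blast
qed

end

section \<open>Self-duality\<close>

context split_divisor
begin

lemma orthogonal:
  assumes XY: "disjoint_Ts X" "disjoint_Ts Y" "X + Y = residual"
    and z: "z \<in> RR_space emb X" and w: "w \<in> RR_space emb Y"
  shows "ev z \<bullet> ev w = 0"
proof -
  have "ev z \<bullet> ev w = (\<Sum>T\<in>set Ts. residue_at emb T (z * w))"
    unfolding ev_scalar_prod
    by (rule sum.cong[OF refl])
      (rule residue_ops(2)[symmetric, OF _ RR_regular[OF XY(1) z] RR_regular[OF XY(2) w]])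
  also have "\<dots> = 0" using residue_sum RR_mult[OF z w] XY(3) by simp
  finally show ?thesis .
qed

lemma code_subset_dual:
  assumes "disjoint_Ts X" "disjoint_Ts Y" "X + Y = residual"
  shows "ev ` RR_space emb Y \<subseteq> dual_code (2 * m) (ev ` RR_space emb X)"
  using orthogonal[OF assms] ev_carrier[of "RR_space emb Y"] by (auto simp: dual_code_def)

text \<open>(g) has degree 0, with 2m simple zeros at points of degree 1 and a pole of order 2m at
  infinity.\<close>

lemma degree_Qinf: "place_degree emb UNIV Qinf = 1"
proof -
  have "pv g \<noteq> 0" using g'_nz by (auto simp: g'_def)
  then have "div_degree emb D - 2 * int m * int (place_degree emb UNIV Qinf) = 0"
    using degree_pdiv[of "pv g"] by (simp add: pdiv_g div_degree_diff div_degree_cmul div_degree_of)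
  moreover have "div_degree emb D = 2 * int m"
  proof -
    have "div_degree emb D = (\<Sum>T\<in>set Ts. int (place_degree emb UNIV T))"
      unfolding div_degree_eq
      by (simp only: Ts(2) sum_list_distinct_conv_sum_set[OF Ts(1)] frag_sum_sum frag_sum_of)
    then show ?thesis using Ts_degree card_Ts by simp
  qed
  ultimately show ?thesis using m by simp
qed

lemma residual_degree: "div_degree emb residual = 2 * int m"
  using residual_disjoint(2) degree_Qinf by simp

lemma dual_code_antimono: "C \<subseteq> C' \<Longrightarrow> dual_code k C' \<subseteq> dual_code k C"
  by (auto simp: dual_code_def)

lemma finite_dual_code: "finite (dual_code (2 * m) (C :: 'k vec set))"
  using finite_carrier_vec by (rule finite_subset[rotated]) (auto simp: dual_code_def)

lemma dual_code_eq:
  assumes X: "disjoint_Ts X" "div_degree emb X = int m"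
  shows "dual_code (2 * m) (ev ` RR_space emb X) = ev ` RR_space emb (residual - X)"
proof -
  have Y: "disjoint_Ts (residual - X)" by (rule disjoint_Ts_diff[OF residual_disjoint(1) X(1)])
  have "div_degree emb (residual - X) = int m" using residual_degree X(2) by (simp add: div_degree_diff)
  then have le: "card (UNIV :: 'k set) ^ m \<le> card (ev ` RR_space emb (residual - X))"
    using card_RR_disjoint(2)[OF Y, of m] m by simp
  have "card (UNIV :: 'k set) ^ m \<le> card (ev ` RR_space emb X)"
    using card_RR_disjoint(2)[OF X(1), of m] m X(2) by simp
  then have "card (dual_code (2 * m) (ev ` RR_space emb X)) \<le> card (UNIV :: 'k set) ^ m"
    by (rule card_dual_le[OF X(1)])
  also note le
  finally have "card (dual_code (2 * m) (ev ` RR_space emb X)) \<le> card (ev ` RR_space emb (residual - X))" .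
  moreover note finite_dual_code
  ultimately show ?thesis
    using code_subset_dual[OF X(1) Y] by (intro card_seteq[symmetric]) simp_all
qed

lemma frag_cmul_2: "frag_cmul 2 G = G + G"
  using frag_cmul_distrib[of 1 1 G] by simp

lemma self_dual_if:
  assumes G: "disjoint_Ts G" "div_degree emb G = int m"
    and u: "u \<noteq> 0" "\<And>T. T \<in> set Ts \<Longrightarrow> u \<in> place_ring UNIV T \<and> residue_at emb T u = 1"
    and eq: "residual - G = G - pdiv emb u"
  shows "self_dual (2 * m) (goppa_code emb Ts G)"
proof -
  have "ev (u * z) = ev z" if z: "z \<in> RR_space emb G" for z
    unfolding ev_eq_iff using residue_ops(2) u(2) RR_regular[OF G(1) z] by simp
  then have "ev ` (*) u ` RR_space emb G = ev ` RR_space emb G" by (force simp: image_image)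
  moreover have "RR_space emb (residual - G) = (*) u ` RR_space emb G"
    using RR_shift[of "inverse u" G] u(1) unfolding eq by (simp add: pdiv_inverse)
  ultimately show ?thesis
    unfolding self_dual_def goppa_code_eq dual_code_eq[OF G] by simp
qed

text \<open>
  If \<open>P\<close> were a base point, \<open>L(residual - G + P)\<close> would be orthogonal to the whole code of \<open>G\<close>,
  but it is too large for that.
\<close>

lemma no_base_point:
  assumes G: "disjoint_Ts G" "div_degree emb G = int m"
    and P: "P \<in> places emb UNIV" "P \<notin> set Ts"
  shows "\<not> RR_space emb G \<subseteq> RR_space emb (G - frag_of P)"
proof
  assume LG: "RR_space emb G \<subseteq> RR_space emb (G - frag_of P)"
  interpret curve_place emb x y f P by (rule curve_place_I[OF P(1)])
  define d where "d = place_degree emb UNIV P"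
  define q where "q = card (UNIV :: 'k set)"
  have q: "q > 1" unfolding q_def by (rule card_field_gt_1)
  have d: "d > 0" unfolding d_def by (rule degree_pos)
  define X where "X = G - frag_of P"
  define Y where "Y = residual - G + frag_of P"
  have X: "disjoint_Ts X" unfolding X_def by (intro disjoint_Ts_diff G disjoint_Ts_of P)
  have Y: "disjoint_Ts Y" unfolding Y_def
    by (intro disjoint_Ts_add disjoint_Ts_diff G disjoint_Ts_of P residual_disjoint)
  have degX: "div_degree emb X = int m - int d"
    using G(2) by (simp add: X_def div_degree_diff div_degree_of d_def)
  have degY: "div_degree emb Y = int m + int d"
    using G(2) residual_degree by (simp add: Y_def div_degree_add div_degree_diff div_degree_of d_def)
  have mG: "q ^ m \<le> card (RR_space emb G)" "q ^ m \<le> card (ev ` RR_space emb G)"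
    using card_RR_disjoint[OF G(1), of m] G(2) m by (simp_all add: q_def)
  show False
  \<comment> \<open>The code of Y has at least q^(m + d) words if evaluation is injective on L(Y),
    that is if m + d < 2m. A place of degree at least m needs another argument.\<close>
  proof (cases "d < m")
    case True
    have "ev ` RR_space emb Y \<subseteq> dual_code (2 * m) (ev ` RR_space emb X)"
      by (rule code_subset_dual[OF X Y]) (simp add: X_def Y_def)
    also have "\<dots> \<subseteq> dual_code (2 * m) (ev ` RR_space emb G)"
      unfolding X_def by (rule dual_code_antimono[OF image_mono[OF LG]])
    finally have "card (ev ` RR_space emb Y) \<le> card (dual_code (2 * m) (ev ` RR_space emb G))"
      by (intro card_mono finite_dual_code)
    also have "\<dots> \<le> q ^ m" unfolding q_def by (rule card_dual_le[OF G(1)]) (use mG in \<open>simp add: q_def\<close>)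
    finally have "q ^ (m + d) \<le> q ^ m"
      using card_RR_disjoint(2)[OF Y, of "m + d"] degY True by (simp add: q_def)
    then show False using q d by simp
  next
    case False
    \<comment> \<open>Now deg (G - P) \<le> 0. As q^m > q, two different functions in L(G) agree at
      T; their difference lies in L(G - P) and vanishes at T, hence is 0.\<close>
    have "0 < length Ts" using card_Ts(2) m by simp
    then obtain T where T: "T \<in> set Ts" using nth_mem by blast
    have "\<not> inj_on (residue_at emb T) (RR_space emb G)"
    proof
      assume "inj_on (residue_at emb T) (RR_space emb G)"
      then have "card (RR_space emb G) \<le> q"
        unfolding q_def by (rule card_inj_on_le) auto
      then have "q ^ m \<le> q ^ 1" using mG(1) by simp
      then show False using q m by (simp only: power_increasing_iff)
    qed
    then obtain z w where zw: "z \<in> RR_space emb G" "w \<in> RR_space emb G"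
      "residue_at emb T z = residue_at emb T w" "z \<noteq> w" unfolding inj_on_def by blast
    have "z - w \<in> RR_space emb G" using RR_diff zw G(1) by (simp add: disjoint_Ts_def)
    then have zX: "z - w \<in> RR_space emb X" using LG unfolding X_def by blast
    have "z - w = 0"
    proof (rule RR_many_zeros[OF X zX])
      show "{T} \<subseteq> set Ts" using T by simp
      show "residue_at emb U (z - w) = 0" if "U \<in> {T}" for U
        using that residue_ops(3)[OF T RR_regular[OF G(1) zw(1) T] RR_regular[OF G(1) zw(2) T]] zw(3) by simp
      show "div_degree emb X < int (card {T})" using degX False by simp
    qed
    then show False using zw(4) by simp
  qed
qed

text \<open>If L(G) vanished at T, the unit vector at T would be orthogonal to the code, hence the
  evaluation of some w in L(residual - G). That divisor has degree m, while w has 2m - 1 > m zeros,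
  so w = 0.\<close>

lemma nonvanishing:
  assumes G: "disjoint_Ts G" "div_degree emb G = int m" and T: "T \<in> set Ts"
  shows "\<exists>z\<in>RR_space emb G. residue_at emb T z \<noteq> 0"
proof (rule ccontr)
  assume "\<not> ?thesis"
  then have van: "residue_at emb T z = 0" if "z \<in> RR_space emb G" for z using that by blast
  define e where "e = vec (length Ts) (\<lambda>i. if Ts ! i = T then 1 else 0 :: 'k)"
  have H: "disjoint_Ts (residual - G)" by (rule disjoint_Ts_diff[OF residual_disjoint(1) G(1)])
  have "e \<in> dual_code (2 * m) (ev ` RR_space emb G)"
  proof -
    have "ev z \<bullet> e = 0" if z: "z \<in> RR_space emb G" for z
      unfolding ev_def e_def scalar_prod_def using van[OF z] by (auto intro!: sum.neutral)
    then show ?thesis using card_Ts by (auto simp: dual_code_def e_def)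
  qed
  then obtain w where w: "w \<in> RR_space emb (residual - G)" "e = ev w"
    unfolding dual_code_eq[OF G] by blast
  have res: "residue_at emb U w = (if U = T then 1 else 0)" if U: "U \<in> set Ts" for U
  proof -
    obtain i where i: "i < length Ts" "Ts ! i = U" using U by (auto simp: in_set_conv_nth)
    then have "ev w $ i = residue_at emb U w" by (simp add: ev_def)
    moreover have "e $ i = (if U = T then 1 else 0)" using i by (simp add: e_def)
    ultimately show ?thesis using w(2) by simp
  qed
  have "w = 0"
  proof (rule RR_many_zeros[OF H w(1)])
    show "set Ts - {T} \<subseteq> set Ts" by blast
    show "residue_at emb U w = 0" if "U \<in> set Ts - {T}" for U using res that by simp
    show "div_degree emb (residual - G) < int (card (set Ts - {T}))"
      using residual_degree G(2) card_Ts T m by (simp add: div_degree_diff)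
  qed
  interpret curve_place emb x y f T by (rule curve_place_I[OF Ts_place[OF T]])
  show False using res[OF T] \<open>w = 0\<close> by simp
qed

text \<open>
  The cross products lie in a one-dimensional space, which makes any three functions of \<open>L(G)\<close>
  linearly dependent unless these products vanish.
\<close>

lemma proportional:
  assumes G: "disjoint_Ts G" "div_degree emb G = int m"
    and H: "disjoint_Ts H" "G + H = residual"
    and h: "\<And>z. z \<in> RR_space emb G \<Longrightarrow> h z \<in> RR_space emb H \<and> ev (h z) = ev z"
    and z: "z1 \<in> RR_space emb G" "z2 \<in> RR_space emb G"
  shows "z1 * h z2 = z2 * h z1"
proof (rule ccontr)
  assume ne: "z1 * h z2 \<noteq> z2 * h z1"
  define W where "W = pv g / \<eta>"
  have Gd: "G \<in> divisors emb" and Rd: "residual \<in> divisors emb"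
    using G(1) residual_disjoint(1) by (auto simp: disjoint_Ts_def)
  have cross: "\<exists>k. s * h t - t * h s = emb k * W" if st: "s \<in> RR_space emb G" "t \<in> RR_space emb G" for s t
    unfolding W_def
  proof (rule vanishing_residual)
    note hs = h[OF st(1)] and ht = h[OF st(2)]
    show "s * h t - t * h s \<in> RR_space emb residual"
      using RR_mult[OF st(1) conjunct1[OF ht]] RR_mult[OF st(2) conjunct1[OF hs]] RR_diff[OF Rd] H(2) by simp
    fix T assume T: "T \<in> set Ts"
    interpret curve_place emb x y f T by (rule curve_place_I[OF Ts_place[OF T]])
    have A: "s \<in> A" "t \<in> A" "h s \<in> A" "h t \<in> A"
      using RR_regular[OF G(1) _ T] RR_regular[OF H(1) _ T] st hs ht by auto
    have "residue_at emb T (h s) = residue_at emb T s" "residue_at emb T (h t) = residue_at emb T t"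
      using hs ht T by (auto simp: ev_eq_iff)
    then show "residue_at emb T (s * h t - t * h s) = 0"
      using residue_ops(3)[OF T A_mult[OF A(1,4)] A_mult[OF A(2,3)]]
        residue_ops(2)[OF T A(1,4)] residue_ops(2)[OF T A(2,3)] by simp
  qed
  obtain k where k: "z1 * h z2 - z2 * h z1 = emb k * W" using cross[OF z] by blast
  then have k0: "k \<noteq> 0" "W \<noteq> 0" using ne by auto
  \<comment> \<open>A nonzero cross product would make every z3 a combination of z1 and z2, leaving
    L(G) at most q^2 elements, against q^m with m \<ge> 3.\<close>
  define Sp where "Sp = (\<lambda>(b, c). emb b * z1 + emb c * z2) ` (UNIV :: ('k \<times> 'k) set)"
  have "RR_space emb G \<subseteq> Sp"
  proof
    fix z3 assume z3: "z3 \<in> RR_space emb G"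
    obtain k1 where k1: "z2 * h z3 - z3 * h z2 = emb k1 * W" using cross[OF z(2) z3] by blast
    obtain k2 where k2: "z3 * h z1 - z1 * h z3 = emb k2 * W" using cross[OF z3 z(1)] by blast
    have "z1 * (z2 * h z3 - z3 * h z2) + z2 * (z3 * h z1 - z1 * h z3) + z3 * (z1 * h z2 - z2 * h z1) = 0"
      by (simp add: algebra_simps)
    then have "(emb k1 * z1 + emb k2 * z2 + emb k * z3) * W = 0"
      unfolding k k1 k2 by (simp add: algebra_simps)
    then have "emb k1 * z1 + emb k2 * z2 + emb k * z3 = 0" using k0(2) by simp
    then have "emb k * z3 + (emb k1 * z1 + emb k2 * z2) = 0" by (simp add: add.commute)
    then have eq: "emb k * z3 = - (emb k1 * z1 + emb k2 * z2)" by (simp only: eq_neg_iff_add_eq_0)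
    have "z3 = inverse (emb k) * (emb k * z3)" using k0(1) by (simp flip: mult.assoc)
    also have "\<dots> = inverse (emb k) * - (emb k1 * z1 + emb k2 * z2)" by (simp only: eq)
    also have "\<dots> = emb (- (inverse k * k1)) * z1 + emb (- (inverse k * k2)) * z2"
      by (simp add: hom_uminus hom_mult hom_inverse algebra_simps)
    finally show "z3 \<in> Sp" unfolding Sp_def by auto
  qed
  moreover have "finite Sp" unfolding Sp_def by simp
  ultimately have "card (RR_space emb G) \<le> card Sp" by (intro card_mono)
  also have "\<dots> \<le> card (UNIV :: ('k \<times> 'k) set)" unfolding Sp_def by (rule card_image_le) simp
  also have "\<dots> = card (UNIV :: 'k set) ^ 2"
    by (simp add: card_cartesian_product power2_eq_square flip: UNIV_Times_UNIV)
  finally have "card (UNIV :: 'k set) ^ m \<le> card (UNIV :: 'k set) ^ 2"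
    using card_RR_disjoint(1)[OF G(1), of m] G(2) m by simp
  moreover have "card (UNIV :: 'k set) > 1"
  proof -
    interpret curve_place emb x y f Qinf by (rule curve_place_I[OF Qinf])
    show ?thesis by (rule card_field_gt_1)
  qed
  ultimately show False using m by (simp only: power_increasing_iff)
qed

lemma self_dual_only_if:
  assumes G: "disjoint_Ts G" "div_degree emb G = int m"
    and sd: "self_dual (2 * m) (goppa_code emb Ts G)"
  shows "\<exists>u. u \<noteq> 0 \<and> (\<forall>T\<in>set Ts. u \<in> place_ring UNIV T \<and> residue_at emb T u = 1) \<and>
    residual - G = G - pdiv emb u"
proof -
  define H where "H = residual - G"
  have H: "disjoint_Ts H" unfolding H_def by (rule disjoint_Ts_diff[OF residual_disjoint(1) G(1)])
  have degH: "div_degree emb H = int m" using residual_degree G(2) by (simp add: H_def div_degree_diff)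
  have GH: "G + H = residual" by (simp add: H_def)
  have Gd: "G \<in> divisors emb" and Hd: "H \<in> divisors emb" using G(1) H by (auto simp: disjoint_Ts_def)
  have codes: "ev ` RR_space emb G = ev ` RR_space emb H"
    using sd unfolding self_dual_def goppa_code_eq dual_code_eq[OF G] H_def .
  define h where "h z = (SOME w. w \<in> RR_space emb H \<and> ev w = ev z)" for z
  have h: "h z \<in> RR_space emb H \<and> ev (h z) = ev z" if z: "z \<in> RR_space emb G" for z
  proof -
    have "ev z \<in> ev ` RR_space emb H" using z codes by blast
    then have "\<exists>w. w \<in> RR_space emb H \<and> ev w = ev z" by force
    then show ?thesis unfolding h_def by (rule someI_ex)
  qed
  have Hsurj: "\<exists>z\<in>RR_space emb G. w = h z" if w: "w \<in> RR_space emb H" for w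
  proof -
    have "ev w \<in> ev ` RR_space emb G" using w codes by blast
    then obtain z where z: "z \<in> RR_space emb G" "ev w = ev z" by blast
    have "w = h z"
      by (rule inj_onD[OF ev_inj[OF H]]) (use degH m z w h in auto)
    then show ?thesis using z(1) by blast
  qed
  have "0 < length Ts" using card_Ts(2) m by simp
  then obtain T0 where T0: "T0 \<in> set Ts" using nth_mem by blast
  obtain z0 where z0: "z0 \<in> RR_space emb G" "residue_at emb T0 z0 \<noteq> 0" using nonvanishing[OF G T0] by blast
  have res0: "residue_at emb T 0 = 0" if "T \<in> set Ts" for T
  proof -
    interpret curve_place emb x y f T by (rule curve_place_I[OF Ts_place[OF that]])
    show ?thesis by simp
  qed
  have "z0 \<noteq> 0" using z0(2) res0[OF T0] by auto
  have "residue_at emb T0 (h z0) \<noteq> 0" using h[OF z0(1)] z0(2) T0 by (simp add: ev_eq_iff)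
  then have "h z0 \<noteq> 0" using res0[OF T0] by auto
  define u where "u = h z0 / z0"
  have u0: "u \<noteq> 0" using \<open>z0 \<noteq> 0\<close> \<open>h z0 \<noteq> 0\<close> by (simp add: u_def)
  have hu: "h z = u * z" if z: "z \<in> RR_space emb G" for z
    using proportional[OF G H GH h z0(1) z] \<open>z0 \<noteq> 0\<close> by (simp add: u_def field_simps)
  have LH: "RR_space emb H = (*) u ` RR_space emb G"
  proof (intro equalityI subsetI)
    fix w assume "w \<in> RR_space emb H"
    then obtain z where "z \<in> RR_space emb G" "w = h z" using Hsurj by blast
    then show "w \<in> (*) u ` RR_space emb G" using hu by blast
  next
    fix w assume "w \<in> (*) u ` RR_space emb G"
    then obtain z where "z \<in> RR_space emb G" "w = u * z" by blast
    then show "w \<in> RR_space emb H" using hu h by metis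
  qed
  \<comment> \<open>At each T some z in L(G) does not vanish, and u = h(z)/z is a quotient of
    functions with equal nonzero values there.\<close>
  have uT: "u \<in> place_ring UNIV T \<and> residue_at emb T u = 1" if T: "T \<in> set Ts" for T
  proof -
    interpret curve_place emb x y f T by (rule curve_place_I[OF Ts_place[OF T]])
    obtain z where z: "z \<in> RR_space emb G" "residue_at emb T z \<noteq> 0" using nonvanishing[OF G T] by blast
    have A: "z \<in> A" "h z \<in> A" using RR_regular[OF G(1) z(1) T] RR_regular[OF H _ T] h[OF z(1)] by auto
    have nT: "z \<notin> T" using residue_ops(4)[OF T A(1)] z(2) A by blast
    then have iz: "inverse z \<in> A" "z \<noteq> 0" using unit_inverse[OF A(1)] by auto
    have eq: "u = h z * inverse z" using hu[OF z(1)] iz(2) by simp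
    have "residue_at emb T (h z) = residue_at emb T z" using h[OF z(1)] T by (simp add: ev_eq_iff)
    then have "residue_at emb T u = 1"
      unfolding eq using residue_ops(2)[OF T A(2) iz(1)] residue_ops(6)[OF T A(1) A(1) nT] z(2) by simp
    moreover have "u \<in> A" unfolding eq by (rule A_mult[OF A(2) iz(1)])
    ultimately show ?thesis by blast
  qed
  define G1 where "G1 = G - pdiv emb u"
  have G1d: "G1 \<in> divisors emb" unfolding G1_def by (intro divisors_diff Gd pdiv_divisors u0)
  have G1T: "Poly_Mapping.lookup G1 T = 0" if T: "T \<in> set Ts" for T
  proof -
    interpret curve_place emb x y f T by (rule curve_place_I[OF Ts_place[OF T]])
    have "u \<notin> T" using residue_ops(4)[OF T] uT[OF T] by force
    then have "v u = 0" using v_unit[of u] u0 uT[OF T] by simp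
    then show ?thesis using G(1) T u0 Ts_place[OF T]
      by (simp add: G1_def lookup_minus lookup_pdiv disjoint_Ts_def)
  qed
  have "G1 = H"
  proof (rule ccontr)
    assume ne: "G1 \<noteq> H"
    \<comment> \<open>G1 = G - (u) and H have equal degree, so if they differ, G1 exceeds H at some
      P. Since u L(G) = L(H), all of L(G) then satisfies a stricter condition at P than G imposes: P
      is a base point.\<close>
    have "\<exists>P. Poly_Mapping.lookup G1 P > Poly_Mapping.lookup H P"
    proof (rule ccontr)
      assume "\<not> ?thesis"
      then have "effective (H - G1)" by (simp add: effective_def lookup_minus not_less)
      moreover have "div_degree emb (H - G1) \<le> 0"
        using degH G(2) degree_pdiv[OF u0] by (simp add: G1_def div_degree_diff)
      ultimately have "H - G1 = 0" by (intro effective_degree(2) divisors_diff Hd G1d)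
      then show False using ne by simp
    qed
    then obtain P where P: "Poly_Mapping.lookup G1 P > Poly_Mapping.lookup H P" by blast
    have pl: "P \<in> places emb UNIV" using P G1d Hd unfolding divisors_iff by force
    have nT: "P \<notin> set Ts" using P G1T H by (auto simp: disjoint_Ts_def)
    interpret curve_place emb x y f P by (rule curve_place_I[OF pl])
    have "RR_space emb G \<subseteq> RR_space emb (G - frag_of P)"
    proof
      fix z assume z: "z \<in> RR_space emb G"
      have d: "G - frag_of P \<in> divisors emb" by (intro divisors_diff Gd divisors_of pl)
      show "z \<in> RR_space emb (G - frag_of P)"
      proof (cases "z = 0")
        case False
        have "0 \<le> place_val UNIV Q z + Poly_Mapping.lookup (G - frag_of P) Q" if Q: "Q \<in> places emb UNIV" for Q
        proof (cases "Q = P")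
          case True
          have "u * z \<in> RR_space emb H" using LH z by blast
          then have "0 \<le> v (u * z) + Poly_Mapping.lookup H P"
            using pl u0 False unfolding RR_iff[OF Hd] by simp
          moreover have "v (u * z) = v u + v z" using v_mult[of u z] u0 False by simp
          moreover have "Poly_Mapping.lookup G1 P = Poly_Mapping.lookup G P - v u"
            using pl u0 by (simp add: G1_def lookup_minus lookup_pdiv)
          ultimately show ?thesis using P True by (simp add: lookup_minus)
        next
          case nP: False
          then show ?thesis using z False Q unfolding RR_iff[OF Gd] by (simp add: lookup_minus)
        qed
        then show ?thesis unfolding RR_iff[OF d] by blast
      qed simp
    qed
    then show False using no_base_point[OF G pl nT] by blast
  qed
  then have "residual - G = G - pdiv emb u" by (simp add: G1_def H_def)
  then show ?thesis using u0 uT by blast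
qed

lemma self_dual_iff:
  assumes G: "disjoint_Ts G" "div_degree emb G = int m"
  shows "self_dual (2 * m) (goppa_code emb Ts G) \<longleftrightarrow>
    (\<exists>u. u \<noteq> 0 \<and> (\<forall>T\<in>set Ts. u \<in> place_ring UNIV T \<and> residue_at emb T u = 1) \<and>
      residual - G = G - pdiv emb u)"
  using self_dual_if[OF G] self_dual_only_if[OF G] by metis

end

section \<open>From the hypotheses of the theorem to the locale \<open>split_divisor\<close>\<close>

lemma poly_eq_smult_prod_linear:
  fixes g :: "'k::field poly"
  assumes I: "finite I" "inj_on a I" and deg: "degree g \<le> card I" and g: "g \<noteq> 0"
    and root: "\<And>i. i \<in> I \<Longrightarrow> poly g (a i) = 0"
  shows "degree g = card I" "g = Polynomial.smult (lead_coeff g) (\<Prod>i\<in>I. [:- a i, 1:])"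
proof -
  have many: "card I \<le> degree h" if "h \<noteq> 0" "\<And>i. i \<in> I \<Longrightarrow> poly h (a i) = 0" for h :: "'k poly"
  proof -
    have "card I = card (a ` I)" using I by (simp add: card_image)
    also have "\<dots> \<le> card {z. poly h z = 0}" using that poly_roots_finite[OF that(1)] by (intro card_mono) auto
    also have "\<dots> \<le> degree h" by (rule card_poly_roots_bound[OF that(1)])
    finally show ?thesis .
  qed
  show dg: "degree g = card I" using many[OF g root] deg by simp
  define p where "p = (\<Prod>i\<in>I. [:- a i, 1:])"
  have p: "degree p = card I" "lead_coeff p = 1" unfolding p_def using prod_linear[OF I(1)] by blast+
  define h where "h = g - Polynomial.smult (lead_coeff g) p"
  have "h = 0"
  proof (rule ccontr)
    assume h: "h \<noteq> 0"
    have "poly h (a i) = 0" if i: "i \<in> I" for i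
    proof -
      have "poly p (a i) = 0" unfolding p_def poly_prod using I(1) i by (auto simp: prod_zero_iff)
      then show ?thesis using root[OF i] by (simp add: h_def)
    qed
    then have "card I \<le> degree h" by (rule many[OF h])
    moreover have "degree h \<le> card I" unfolding h_def
      by (rule degree_diff_le) (use dg p degree_smult_le[of "lead_coeff g" p] in auto)
    ultimately have "degree h = card I" by simp
    moreover have "coeff h (card I) = 0" using dg p by (simp add: h_def)
    ultimately show False using h leading_coeff_0_iff[of h] by simp
  qed
  then show "g = Polynomial.smult (lead_coeff g) (\<Prod>i\<in>I. [:- a i, 1:])" by (simp add: h_def p_def)
qed

lemma (in place) prod_in_P:
  assumes "finite I" "\<And>i. i \<in> I \<Longrightarrow> h i \<in> A" "(\<Prod>i\<in>I. h i) \<in> P"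
  shows "\<exists>i\<in>I. h i \<in> P"
  using assms
proof (induction I rule: finite_induct)
  case (insert j I)
  have "(\<Prod>i\<in>I. h i) \<in> A"
    using insert.hyps(1) insert.prems(1)
    by (induction I rule: finite_induct) (auto intro: A_mult)
  then have "h j \<in> P \<or> (\<Prod>i\<in>I. h i) \<in> P"
    using P_prime[of "h j" "\<Prod>i\<in>I. h i"] insert by simp
  then show ?case using insert.IH insert.prems(1) by blast
qed simp

lemma (in rational_subfield) poly_mem_poly_place: "irreducible p \<Longrightarrow> pv p \<in> poly_place emb x p"
  unfolding poly_place_def
  by (rule CollectI, intro exI[of _ p] exI[of _ 1]) (auto simp: irreducible_def)

text \<open>An algebraic x would be constant, and then K(x) = K has no place, as a valuation ring
  lies strictly between K and the field.\<close>

lemma transcendental_if_place: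
  fixes emb :: "'k::field \<Rightarrow> 'f::field"
  assumes emb: "const_field emb" and full: "full_constant_field emb"
    and P: "P \<in> places emb (adjoin emb {x})" and 0: "peval emb p x = 0"
  shows "p = 0"
proof (rule ccontr)
  interpret const_field emb by (rule emb)
  assume "p \<noteq> 0"
  then have "algebraic_over emb x" using 0 unfolding algebraic_over_def by blast
  then obtain e where e: "x = emb e" using full unfolding full_constant_field_def by blast
  have "is_subfield (range emb)"
    unfolding is_subfield_def
  proof (intro conjI ballI)
    show "0 \<in> range emb" "1 \<in> range emb" using hom_zero hom_one by (metis rangeI)+
    show "a - b \<in> range emb" "a * b \<in> range emb" if "a \<in> range emb" "b \<in> range emb" for a b
      using that by (auto simp flip: hom_minus hom_mult)
    show "inverse a \<in> range emb" if "a \<in> range emb" for a using that by (auto simp flip: hom_inverse)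
  qed
  then have "adjoin emb {x} \<subseteq> range emb" unfolding adjoin_def using e by blast
  moreover obtain A where "valuation_ring emb (adjoin emb {x}) A" using P unfolding places_def by blast
  ultimately show False unfolding valuation_ring_def by blast
qed

text \<open>Every pole of x in F lies over the only pole of x in K(x), and that place has a single
  extension.\<close>

lemma (in quadratic_extension) infinite_place_unique:
  assumes Pinf: "Pinf \<in> places emb Kx" "place_val Kx Pinf x < 0" and ext: "extensions emb Pinf = {Qinf}"
  shows "Qinf \<in> places emb UNIV" "Q \<in> places emb UNIV \<Longrightarrow> x \<in> place_ring UNIV Q \<longleftrightarrow> Q \<noteq> Qinf"
proof -
  interpret P: rational_place emb x Pinf by unfold_locales (use Pinf is_subfield_Kx in auto)
  interpret P: discrete_place emb Kx Pinf by (rule P.discrete_place_P)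
  have x0: "x \<noteq> 0" using pv_eq_0_iff[of "[:0, 1:]"] by simp
  have xP: "x \<notin> place_ring Kx Pinf" using P.v_A[OF x_Kx x0] Pinf(2) by simp
  have Pinf_eq: "Pinf = infinite_place" by (rule P.infinite_place_facts(1)[OF xP])
  have "Qinf \<in> extensions emb Pinf" using ext by simp
  then show Qinf: "Qinf \<in> places emb UNIV" by (simp add: extensions_def)
  have sub: "Pinf \<subseteq> Qinf" using \<open>Qinf \<in> extensions emb Pinf\<close> by (simp add: extensions_def)
  show "x \<in> place_ring UNIV Q \<longleftrightarrow> Q \<noteq> Qinf" if Q: "Q \<in> places emb UNIV"
  proof -
    interpret Q: curve_place emb x y f Q by (rule curve_place_I[OF Q])
    show ?thesis
    proof
      assume xA: "x \<in> Q.A"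
      show "Q \<noteq> Qinf"
      proof
        assume "Q = Qinf"
        then have "inverse x \<in> Q" using P.not_A[OF x_Kx xP] sub by blast
        from Q.P_mult[OF xA this] show False using x0 by simp
      qed
    next
      assume ne: "Q \<noteq> Qinf"
      show "x \<in> Q.A"
      proof (rule ccontr)
        assume "x \<notin> Q.A"
        then have "x \<notin> Q.R.A" using Q.restrict_ring by simp
        then have "Q \<inter> Kx = Pinf" using Q.R.infinite_place_facts(1) Pinf_eq by simp
        then have "Q \<in> extensions emb Pinf" using Q by (auto simp: extensions_def)
        then show False using ext ne by simp
      qed
    qed
  qed
qed

context pointed_curve
begin

lemma poly_zero_finite:
  assumes "Q \<in> places emb UNIV" "p \<noteq> 0" "pv p \<in> Q"
  shows "x \<in> place_ring UNIV Q"
proof -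
  interpret curve_place emb x y f Q by (rule curve_place_I[OF assms(1)])
  have "v (pv p) > 0" using v_P[of "pv p"] assms by simp
  then have "Q \<noteq> Qinf" using val_Qinf(1)[OF assms(2)] by auto
  then show ?thesis using x_regular_iff[OF assms(1)] by simp
qed

lemma restrict_eq_poly_place:
  assumes "Q \<in> places emb UNIV" "irreducible p" "pv p \<in> Q"
  shows "Q \<inter> Kx = poly_place emb x p"
proof -
  interpret curve_place emb x y f Q by (rule curve_place_I[OF assms(1)])
  have "p \<noteq> 0" using assms(2) by auto
  then have "x \<in> R.A" using poly_zero_finite assms restrict_ring by simp
  then show ?thesis using place_eq_poly_place[OF restrict_place _ _ assms(2)] assms(3) by simp
qed

text \<open>y vanishes exactly where f(x) does, that is over some p i, and there only one place is
  available. If two indices gave the same place, the prime q below it would divide both factors, and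
  q^2 would divide f.\<close>

lemma ramified_places:
  fixes p :: "nat \<Rightarrow> 'k poly"
  assumes f_fact: "f = Polynomial.smult c (\<Prod>i\<in>I. p i)" "c \<noteq> 0" "finite I"
    and p: "\<And>i. i \<in> I \<Longrightarrow> irreducible (p i)"
    and Qs: "\<And>i. i \<in> I \<Longrightarrow> extensions emb (poly_place emb x (p i)) = {Qs i}"
  shows "inj_on Qs I" "Qs ` I = {Q \<in> places emb UNIV. y \<in> Q}"
    "\<And>Q. Q \<in> places emb UNIV \<Longrightarrow> y \<in> Q \<Longrightarrow> Q \<inter> Kx \<in> (\<lambda>i. poly_place emb x (p i)) ` I"
proof -
  have Qi: "Qs i \<in> places emb UNIV" "pv (p i) \<in> Qs i" "x \<in> place_ring UNIV (Qs i)" "y \<in> Qs i" if i: "i \<in> I" for i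
  proof -
    have ext: "Qs i \<in> extensions emb (poly_place emb x (p i))" using Qs[OF i] by simp
    then show pl: "Qs i \<in> places emb UNIV" by (simp add: extensions_def)
    show pQ: "pv (p i) \<in> Qs i" using ext poly_mem_poly_place[OF p[OF i]] by (auto simp: extensions_def)
    have "p i \<noteq> 0" using p[OF i] by auto
    then show xA: "x \<in> place_ring UNIV (Qs i)" using poly_zero_finite[OF pl _ pQ] by simp
    interpret curve_place emb x y f "Qs i" by (rule curve_place_I[OF pl])
    have "p i dvd f" unfolding f_fact(1) using dvd_prodI[OF f_fact(3) i] by (rule dvd_smult)
    then obtain s where "f = p i * s" by auto
    then have "pv f \<in> Qs i" using P_mult2[OF pQ A_peval[OF xA, of s]] by simp
    then show "y \<in> Qs i" using y_in_Q by simp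
  qed
  have over: "\<exists>i\<in>I. pv (p i) \<in> Q" if Q: "Q \<in> places emb UNIV" "y \<in> Q" for Q
  proof -
    interpret curve_place emb x y f Q by (rule curve_place_I[OF Q(1)])
    have fQ: "pv f \<in> Q" using y_in_Q Q(2) by simp
    have xA: "x \<in> A" by (rule poly_zero_finite[OF Q(1) f_nz fQ])
    have "emb (inverse c) * pv f \<in> Q" by (rule P_mult[OF A_emb fQ])
    also have "emb (inverse c) * pv f = (\<Prod>i\<in>I. pv (p i))"
    proof -
      have "emb (inverse c) * emb c = 1" using hom_mult[of "inverse c" c] f_fact(2) by simp
      moreover have "pv f = emb c * (\<Prod>i\<in>I. pv (p i))" unfolding f_fact(1) by (simp add: peval_prod)
      ultimately show ?thesis by (simp flip: mult.assoc)
    qed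
    finally show ?thesis using prod_in_P[OF f_fact(3), of "\<lambda>i. pv (p i)"] A_peval[OF xA] by blast
  qed
  show "Q \<inter> Kx \<in> (\<lambda>i. poly_place emb x (p i)) ` I" if "Q \<in> places emb UNIV" "y \<in> Q" for Q
    using over[OF that] restrict_eq_poly_place[OF that(1) p] by blast
  show "Qs ` I = {Q \<in> places emb UNIV. y \<in> Q}"
  proof (intro equalityI subsetI)
    fix Q assume "Q \<in> {Q \<in> places emb UNIV. y \<in> Q}"
    then have Q: "Q \<in> places emb UNIV" "y \<in> Q" by auto
    obtain i where i: "i \<in> I" "pv (p i) \<in> Q" using over[OF Q] by blast
    have "Q \<inter> Kx = poly_place emb x (p i)" by (rule restrict_eq_poly_place[OF Q(1) p[OF i(1)] i(2)])
    then have "Q \<in> extensions emb (poly_place emb x (p i))" using Q(1) by (auto simp: extensions_def)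
    then have "Q = Qs i" using Qs[OF i(1)] by blast
    then show "Q \<in> Qs ` I" using i(1) by blast
  qed (use Qi in blast)
  show "inj_on Qs I"
  proof (rule inj_onI, rule ccontr)
    fix i j assume ij: "i \<in> I" "j \<in> I" "Qs i = Qs j" "i \<noteq> j"
    interpret curve_place emb x y f "Qs i" by (rule curve_place_I[OF Qi(1)[OF ij(1)]])
    obtain q where q: "irreducible q" "\<forall>a. pv a \<in> Qs i \<longleftrightarrow> q dvd a"
      by (rule finite_place_poly[OF Qi(3)[OF ij(1)]])
    have "q dvd p i" "q dvd p j" using q(2) Qi(2)[OF ij(1)] Qi(2)[OF ij(2)] ij(3) by simp_all
    then have "q * q dvd p i * p j" by (rule mult_dvd_mono)
    also have "p i * p j = (\<Prod>l\<in>{i, j}. p l)" using ij(4) by simp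
    also have "\<dots> dvd (\<Prod>i\<in>I. p i)" by (rule prod_dvd_prod_subset[OF f_fact(3)]) (use ij in auto)
    also have "\<dots> dvd f" unfolding f_fact(1) by (rule dvd_smult) simp
    finally have "q ^ 2 dvd f" by (simp add: power2_eq_square)
    then have "q dvd 1" using sqf unfolding squarefree_def by blast
    then show False using q(1) by (simp add: irreducible_def)
  qed
qed

text \<open>The polynomial h, which will be g, vanishes at S1; this excludes the pole of x, so R is
  a point x = a. Both extensions restrict to R, so \<open>places_over\<close> makes them equal or
  conjugate, and they are distinct.\<close>

lemma split_extension:
  assumes R: "R \<in> places emb Kx" "place_degree emb Kx R = 1"
    and S: "extensions emb R = {S1, S2}" "S1 \<noteq> S2"
    and g: "h \<noteq> 0" "pv h \<in> S1"
  shows "S1 \<in> places emb UNIV" "S2 = bar -` S1" "bar -` S1 \<noteq> S1"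
    "\<exists>a. x - emb a \<in> R" "x \<in> place_ring Kx R" "S1 \<inter> Kx = R"
proof -
  have ext: "S1 \<in> extensions emb R" "S2 \<in> extensions emb R" using S(1) by auto
  then have S2: "S2 \<in> places emb UNIV" and RS: "R \<subseteq> S1" "R \<subseteq> S2"
    by (auto simp: extensions_def)
  show S1: "S1 \<in> places emb UNIV" using ext(1) by (simp add: extensions_def)
  interpret S1: curve_place emb x y f S1 by (rule curve_place_I[OF S1])
  interpret R: rational_place emb x R by unfold_locales (use R is_subfield_Kx in auto)
  have xS: "x \<in> S1.A" by (rule poly_zero_finite[OF S1 g])
  have x0: "x \<noteq> 0" using pv_eq_0_iff[of "[:0, 1:]"] by simp
  show xR: "x \<in> place_ring Kx R"
  proof (rule ccontr)
    assume "x \<notin> place_ring Kx R"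
    then have "inverse x \<in> S1" using R.not_A[OF x_Kx] RS by blast
    from S1.P_mult[OF xS this] show False using x0 by simp
  qed
  obtain a where a: "x - emb a \<in> R" using R.degree_one_residue[OF R.finite_residue_P R(2) xR] by blast
  then show "\<exists>a. x - emb a \<in> R" by blast
  obtain q where "lead_coeff q = 1" "irreducible q" "\<forall>a. pv a \<in> R \<longleftrightarrow> q dvd a"
    by (rule R.finite_place[OF xR])
  note q = this(2) this(3)[rule_format]
  have qR: "pv q \<in> R" using q(2)[of q] by simp
  have R_eq: "R = poly_place emb x q" by (rule place_eq_poly_place[OF R(1) qR xR q(1)])
  have over: "Q \<inter> Kx = R" if "Q \<in> places emb UNIV" "R \<subseteq> Q" for Q
    unfolding R_eq by (rule restrict_eq_poly_place[OF that(1) q(1)]) (use that(2) qR in blast)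
  show K: "S1 \<inter> Kx = R" by (rule over[OF S1 RS(1)])
  have "S2 = S1 \<or> S2 = bar -` S1"
    by (rule places_over[OF S1 S2]) (simp add: K over[OF S2 RS(2)])
  then show "S2 = bar -` S1" using S(2) by auto
  then show "bar -` S1 \<noteq> S1" using S(2) by auto
qed

end

theorem theorem3p4:
  fixes emb :: "'k::{field,finite} \<Rightarrow> 'f::field"
    and x y :: 'f
    and f g :: "'k poly" and c :: 'k
    and r n :: nat
    and p :: "nat \<Rightarrow> 'k poly"
    and P Q R :: "nat \<Rightarrow> 'f set" and Pinf Qinf :: "'f set"
    and S :: "nat \<Rightarrow> nat \<Rightarrow> 'f set"
    and D G :: "'f set \<Rightarrow>\<^sub>0 int"
    and Ts :: "'f set list"
  assumes char: "CHAR('k) \<noteq> 2"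
    and ell: "elliptic_function_field emb"
    and gen: "adjoin emb {x, y} = UNIV"
    and eqn: "y ^ 2 = peval emb f x"
    and f: "squarefree f" "degree f = 3"
    and f_fact: "f = Polynomial.smult c (\<Prod>i\<in>{1..r}. p i)" "c \<noteq> 0"
    and p: "\<And>i. i \<in> {1..r} \<Longrightarrow> lead_coeff (p i) = 1 \<and> irreducible (p i)"
    and P: "\<And>i. i \<in> {1..r} \<Longrightarrow> P i = poly_place emb x (p i)"
    and Pinf: "Pinf \<in> places emb (adjoin emb {x})" "place_val (adjoin emb {x}) Pinf x < 0"
    and Q: "\<And>i. i \<in> {1..r} \<Longrightarrow> extensions emb (P i) = {Q i}"
    and Qinf: "extensions emb Pinf = {Qinf}"
    and n: "n > 4" "even n"
    and R: "inj_on R {1..n div 2}"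
      "\<And>i. i \<in> {1..n div 2} \<Longrightarrow>
         R i \<in> places emb (adjoin emb {x}) \<and> place_degree emb (adjoin emb {x}) (R i) = 1 \<and>
         R i \<notin> P ` {1..r}"
    and S: "\<And>i. i \<in> {1..n div 2} \<Longrightarrow> extensions emb (R i) = {S i 1, S i 2} \<and> S i 1 \<noteq> S i 2"
    and D: "D = (\<Sum>i\<in>{1..n div 2}. frag_of (S i 1) + frag_of (S i 2))"
    and Ts: "distinct Ts" "D = (\<Sum>T\<leftarrow>Ts. frag_of T)"
    and g: "g \<noteq> 0" "zero_div emb (peval emb g x) = D"
    and G: "G \<in> divisors emb" "div_degree emb G = int (n div 2)" "Poly_Mapping.keys G \<inter> Poly_Mapping.keys D = {}"
  shows "self_dual n (goppa_code emb Ts G) \<longleftrightarrow>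
    (\<exists>u. u \<noteq> 0 \<and>
         (\<forall>T\<in>Poly_Mapping.keys D. u \<in> place_ring UNIV T \<and> residue_at emb T u = 1) \<and>
         pdiv emb (peval emb (pderiv g) x) =
           frag_cmul 2 G - pdiv emb u - frag_cmul (int n - 3) (frag_of Qinf)
             - (\<Sum>i\<in>{1..r}. frag_of (Q i)))"
proof -
  interpret const_field emb
    using ell unfolding elliptic_function_field_def algebraic_function_field_def const_field_def by blast
  have full: "full_constant_field emb" and genus: "has_genus emb 1"
    using ell by (auto simp: elliptic_function_field_def)
  have "const_field emb" by unfold_locales
  note transc = transcendental_if_place[OF this full Pinf(1)]
  have "CHAR('k) \<noteq> 1" by simp
  then have "\<not> CHAR('k) dvd 2" using char prime_nat_iff[of 2] two_is_prime_nat by blast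
  then have "(of_nat 2 :: 'k) \<noteq> 0" by (simp only: of_nat_eq_0_iff_char_dvd not_False_eq_True)
  then have two: "(2 :: 'k) \<noteq> 0" by simp
  interpret elliptic_curve emb x y f
    by unfold_locales (use transc two gen eqn f genus in auto)
  note Qinf_facts = infinite_place_unique[OF Pinf Qinf]
  interpret pointed_curve emb x y f Qinf
    by unfold_locales (use Qinf_facts in blast)+
  define m where "m = n div 2"
  have nm: "n = 2 * m" and m3: "m \<ge> 3" using n by (auto simp: m_def)

  note ram = ramified_places[OF f_fact finite_atLeastAtMost conjunct2[OF p]]
  have QsP: "extensions emb (poly_place emb x (p i)) = {Q i}" if "i \<in> {1..r}" for i
    using Q[OF that] P[OF that] by simp
  note ram = ram[OF _ QsP]

  have D_pos: "Poly_Mapping.lookup D T > 0" if i: "i \<in> {1..m}" and T: "T = S i 1 \<or> T = S i 2" for i T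
    unfolding D m_def[symmetric]
    by (rule lookup_sum_pairs_pos[where a = "\<lambda>i. S i 1" and b = "\<lambda>i. S i 2", OF finite_atLeastAtMost i T])
  have g0: "pv g \<noteq> 0" using g(1) by simp
  have zd: "Poly_Mapping.lookup D T = max 0 (Poly_Mapping.lookup (pdiv emb (pv g)) T)" for T
    unfolding g(2)[symmetric] zero_div_def by (simp add: Poly_Mapping.map.rep_eq when_def)
  have g_zero: "pv g \<in> S i 1" if i: "i \<in> {1..m}" for i
  proof -
    have "S i 1 \<in> extensions emb (R i)" using S[of i] i by (simp add: m_def)
    then have pl: "S i 1 \<in> places emb UNIV" by (simp add: extensions_def)
    interpret curve_place emb x y f "S i 1" by (rule curve_place_I[OF pl])
    have "Poly_Mapping.lookup (pdiv emb (pv g)) (S i 1) > 0"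
      using D_pos[OF i, of "S i 1"] zd[of "S i 1"] by simp
    then show ?thesis using g0 pl v_P[of "pv g"] by (simp add: lookup_pdiv)
  qed
  have R': "R i \<in> places emb Kx" "place_degree emb Kx (R i) = 1" "R i \<notin> P ` {1..r}"
    "extensions emb (R i) = {S i 1, S i 2}" "S i 1 \<noteq> S i 2" if "i \<in> {1..m}" for i
    using R(2)[of i] S[of i] that by (simp_all add: m_def)
  note SE = split_extension[OF R'(1,2,4,5) g(1) g_zero]
  have "\<exists>a. \<forall>i\<in>{1..m}. x - emb (a i) \<in> R i"
    by (rule bchoice) (use SE(4) in blast)
  then obtain a where a: "\<And>i. i \<in> {1..m} \<Longrightarrow> x - emb (a i) \<in> R i" by blast
  have aS: "x - emb (a i) \<in> S i 1" if "i \<in> {1..m}" for i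
    using a[OF that] SE(6)[OF that that that that that] by blast
  have inj_a: "inj_on a {1..m}"
  proof
    fix i j assume ij: "i \<in> {1..m}" "j \<in> {1..m}" "a i = a j"
    have lin: "pv [:- a i, 1:] = x - emb (a i)" by (simp add: hom_uminus)
    have "R i = R j"
    proof (rule rational_place_unique[OF R'(1)[OF ij(1)] R'(1)[OF ij(2)]])
      show "irreducible [:- a i, 1:]" by (rule irreducible_linear_field_poly) simp
      show "pv [:- a i, 1:] \<in> R i" unfolding lin by (rule a[OF ij(1)])
      show "pv [:- a i, 1:] \<in> R j" unfolding lin using a[OF ij(2)] ij(3) by simp
    qed (use SE(5) ij in blast)+
    then show "i = j" using inj_onD[OF R(1)] ij by (simp add: m_def)
  qed
  have unram: "y \<notin> S i 1" if i: "i \<in> {1..m}" for i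
  proof
    assume "y \<in> S i 1"
    then have "S i 1 \<inter> Kx \<in> (\<lambda>i. poly_place emb x (p i)) ` {1..r}"
      using ram(3)[OF _ _ SE(1)[OF i i i i i]] by blast
    then have "R i \<in> P ` {1..r}" using SE(6)[OF i i i i i] P by auto
    then show False using R'(3)[OF i] by blast
  qed
  have D': "D = (\<Sum>i\<in>{1..m}. frag_of (S i 1) + frag_of (bar -` S i 1))"
    unfolding D m_def[symmetric] by (rule sum.cong) (use SE(2) in auto)

  \<comment> \<open>The degrees of the points are needed before \<open>split_divisor\<close> can be
    interpreted, because deg g = m rests on deg D = 2m.\<close>
  have deg_one: "place_degree emb UNIV T = 1" if i: "i \<in> {1..m}" and T: "T = S i 1 \<or> T = bar -` S i 1" for i T
  proof -
    have pl: "S i 1 \<in> places emb UNIV" by (rule SE(1)[OF i i i i i])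
    interpret S1: curve_place emb x y f "S i 1" by (rule curve_place_I[OF pl])
    obtain b where b: "\<forall>z\<in>S1.A. S1.has_residue z"
      by (rule S1.split_place[OF aS[OF i] unram[OF i] SE(3)[OF i i i i i]])
    interpret S2: curve_place emb x y f "bar -` S i 1" by (rule curve_place_I[OF bar_place(1)[OF pl]])
    have "place_degree emb UNIV (S i 1) = 1"
      by (rule S1.place_degree_one) (use b S1.has_residue_def in blast)
    moreover have "place_degree emb UNIV (bar -` S i 1) = 1"
    proof (rule S2.place_degree_one)
      fix z assume "z \<in> S2.A"
      then have "bar z \<in> S1.A" using bar_place(2)[OF pl] by simp
      then obtain k where "bar z - emb k \<in> S i 1" using b S1.has_residue_def by blast
      then have "z - emb k \<in> bar -` S i 1" by (simp add: bar_diff)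
      then show "\<exists>k. z - emb k \<in> bar -` S i 1" by blast
    qed
    ultimately show ?thesis using T by blast
  qed
  \<comment> \<open>\<open>zero_div\<close> gives only the positive part of (g); the rest is known
    because the only pole of a polynomial is at infinity, of order 2 deg g.\<close>
  have pdiv_g: "pdiv emb (pv g) = D - frag_cmul (2 * int (degree g)) (frag_of Qinf)"
  proof (rule poly_mapping_eqI)
    fix T
    show "Poly_Mapping.lookup (pdiv emb (pv g)) T =
        Poly_Mapping.lookup (D - frag_cmul (2 * int (degree g)) (frag_of Qinf)) T"
    proof (cases "T = Qinf")
      case True
      have "Poly_Mapping.lookup (pdiv emb (pv g)) Qinf = - 2 * int (degree g)"
        using val_Qinf(1)[OF g(1)] Qinf_facts(1) by (simp only: lookup_pdiv[OF g0] if_True)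
      moreover from this have "Poly_Mapping.lookup D Qinf = 0" unfolding zd by simp
      ultimately show ?thesis unfolding True lookup_minus by simp
    next
      case False
      have "Poly_Mapping.lookup (pdiv emb (pv g)) T \<ge> 0"
      proof (cases "T \<in> places emb UNIV")
        case True
        then interpret curve_place emb x y f T by (rule curve_place_I)
        have "x \<in> A" using True False x_regular_iff by blast
        then have "v (pv g) \<ge> 0" using A_peval[of x g] v_A[OF _ g0] by simp
        then show ?thesis using True by (simp only: lookup_pdiv[OF g0] if_True)
      qed (simp only: lookup_pdiv[OF g0] if_False)
      then have "Poly_Mapping.lookup D T = Poly_Mapping.lookup (pdiv emb (pv g)) T"
        unfolding zd by (rule max_absorb2)
      then show ?thesis using False by (simp add: lookup_minus)
    qed
  qed
  have deg_D: "div_degree emb D = 2 * int m"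
  proof -
    have "div_degree emb D = (\<Sum>i\<in>{1..m}. int (place_degree emb UNIV (S i 1)) +
        int (place_degree emb UNIV (bar -` S i 1)))"
      unfolding D' div_degree_eq by (simp only: frag_sum_sum frag_sum_add frag_sum_of)
    also have "\<dots> = (\<Sum>i\<in>{1..m}. 2)"
    proof (rule sum.cong[OF refl])
      fix i assume i: "i \<in> {1..m}"
      show "int (place_degree emb UNIV (S i 1)) + int (place_degree emb UNIV (bar -` S i 1)) = 2"
        unfolding deg_one[OF i disjI1[OF refl]] deg_one[OF i disjI2[OF refl]] by simp
    qed
    finally show ?thesis by simp
  qed
  \<comment> \<open>The degree of Qinf is not yet known, but it is at least 1, so deg g \<le> m; the
    m distinct roots a i then give equality.\<close>
  have deg_g: "int m = int (degree g) * int (place_degree emb UNIV Qinf)"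
    using degree_pdiv[OF g0] deg_D
    by (simp add: pdiv_g div_degree_diff div_degree_cmul div_degree_of)
  have "place_degree emb UNIV Qinf > 0"
    by (rule curve_place.degree_pos[OF curve_place_I[OF Qinf_facts(1)]])
  then have "int (degree g) * 1 \<le> int (degree g) * int (place_degree emb UNIV Qinf)"
    by (intro mult_left_mono) auto
  then have deg_le: "degree g \<le> card {1..m}" using deg_g by simp
  have g_root: "poly g (a i) = 0" if i: "i \<in> {1..m}" for i
  proof -
    have pl: "S i 1 \<in> places emb UNIV" by (rule SE(1)[OF i i i i i])
    interpret curve_place emb x y f "S i 1" by (rule curve_place_I[OF pl])
    have xA: "x \<in> A" by (rule poly_zero_finite[OF pl g(1) g_zero[OF i]])
    obtain q where q: "pv g = emb (poly g (a i)) + (x - emb (a i)) * pv q" using peval_minus_linear by blast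
    have "pv g - (x - emb (a i)) * pv q \<in> S i 1"
      by (intro P_diff g_zero i P_mult2[OF aS[OF i] A_peval[OF xA]])
    then have "emb (poly g (a i)) \<in> S i 1" unfolding q by (simp only: add_diff_cancel_right')
    then show ?thesis by (simp only: emb_P_iff)
  qed
  note g_prod = poly_eq_smult_prod_linear[OF finite_atLeastAtMost inj_a deg_le g(1) g_root]
  interpret sd: split_divisor emb x y f Qinf m "\<lambda>i. S i 1" a g "lead_coeff g" D Ts
  proof unfold_locales
    show "pdiv emb (pv g) = D - frag_cmul (2 * int m) (frag_of Qinf)"
      using pdiv_g g_prod(1) by simp
    show "g = Polynomial.smult (lead_coeff g) (\<Prod>i\<in>{1..m}. [:- a i, 1:])" by (rule g_prod(2))
    show "S i 1 \<in> places emb UNIV" if i: "i \<in> {1..m}" for i by (rule SE(1)[OF i i i i i])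
    show "bar -` S i 1 \<noteq> S i 1" if i: "i \<in> {1..m}" for i by (rule SE(3)[OF i i i i i])
  qed (use m3 aS unram inj_a g(1) D' Ts in auto)

  have keysD: "Poly_Mapping.keys D = set Ts" by (rule sd.keys_D)
  have Gdis: "sd.disjoint_Ts G"
    unfolding sd.disjoint_Ts_def using G(1,3) keysD by (auto simp: in_keys_iff)
  have degG: "div_degree emb G = int m" using G(2) by (simp add: m_def)
  have pdiv_y': "pdiv emb y = (\<Sum>i\<in>{1..r}. frag_of (Q i)) - frag_cmul 3 (frag_of Qinf)"
    by (rule pdiv_y[OF finite_atLeastAtMost]) (use ram(1,2) in auto)
  \<comment> \<open>The coefficients of Qinf, 2m = n from \<open>residual\<close> and -3 from (y),
    combine to n - 3.\<close>
  have eq_iff: "sd.residual - G = G - pdiv emb u \<longleftrightarrow> pdiv emb (peval emb (pderiv g) x) =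
      frag_cmul 2 G - pdiv emb u - frag_cmul (int n - 3) (frag_of Qinf) - (\<Sum>i\<in>{1..r}. frag_of (Q i))" for u
  proof -
    have "sd.residual = pdiv emb (pv (pderiv g)) + pdiv emb y + frag_cmul (int n) (frag_of Qinf)"
      using sd.g'_nz by (simp add: sd.residual_def sd.\<eta>_def sd.g'_def pdiv_mult nm)
    then have "(sd.residual - G) - (G - pdiv emb u) = pdiv emb (pv (pderiv g)) -
        (frag_cmul 2 G - pdiv emb u - frag_cmul (int n - 3) (frag_of Qinf) - (\<Sum>i\<in>{1..r}. frag_of (Q i)))"
      unfolding pdiv_y' sd.frag_cmul_2 frag_cmul_diff_distrib by (simp add: algebra_simps)
    then show ?thesis by (metis right_minus_eq)
  qed
  show ?thesis
    using sd.self_dual_iff[OF Gdis degG] unfolding eq_iff keysD nm[symmetric] .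
qed

end
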